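(* Let $(\mathcal{C},\otimes,I)$ be a small productive symmetric monoidal category. Then the final coalgebra of the endofunctor $\Phi$ on $[(\mathcal{C}^{\mathbb{N}})^{op}\times\mathcal{C}^{\mathbb{N}},\mathbf{Set}]$, $$\Phi(Q)(\mathbf{X},\mathbf{Y})=\int^{M\in\mathcal{C}}\mathcal{C}(X_0,M\otimes Y_0)\times Q(M\cdot\mathbf{X}^+,\mathbf{Y}^+),$$ exists, and it is given by the set of observational sequences $$\mathrm{oSeq}(\mathbf{X},\mathbf{Y})=\Big(\int^{(M_n)\in\mathcal{C}^{\mathbb{N}}}\prod_{i=0}^{\infty}\mathcal{C}(M_{i-1}\otimes X_i,M_i\otimes Y_i)\Big)\Big/\approx,$$ that is, dinatural sequences quotiented by observational equivalence. In particular, the final fixpoint of the equation $Q(\mathbf{X},\mathbf{Y})\cong\int^{M}\mathcal{C}(X_0,M\otimes Y_0)\times Q(M\cdot\mathbf{X}^+,\mathbf{Y}^+)$ is $\mathrm{oSeq}$.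
   Context: $\mathcal{C}^{\mathbb{N}}$ is the category of sequences $\mathbf{X}=(X_0,X_1,\dots)$ of objects of $\mathcal{C}$ with componentwise morphisms; $\mathbf{X}^+=(X_1,X_2,\dots)$ and $M\cdot\mathbf{X}=(M\otimes X_0,X_1,\dots)$. Composition is written in diagrammatic order $;$ and associators/unitors are suppressed. $M_{-1}:=I$. Dinatural sequences: sequences $(f_n\colon M_{n-1}\otimes X_n\to M_n\otimes Y_n)_n$ modulo the equivalence generated by $(f_n;(r_n\otimes1))_n\sim((r_{n-1}\otimes1);f_n)_n$ for $f_n\colon M_{n-1}\otimes X_n\to N_n\otimes Y_n$, $r_n\colon N_n\to M_n$, $r_{-1}=\mathrm{id}_I$. For $n\in\mathbb{N}$, $\mathrm{Stage}_n(\mathbf{X},\mathbf{Y})=\int^{M_0,\dots,M_n}\prod_{i=0}^n\mathcal{C}(M_{i-1}\otimes X_i,M_i\otimes Y_i)$: tuples $(f_0,\dots,f_n)$ modulo the analogous relation (morphisms $r_i$ may slide between consecutive components, including $r_n$ after $f_n$); its class is written $\langle f_0|\dots|f_n\rangle$. Two dinatural sequences $(f_n)$, $(g_n)$ are observationally equivalent, $f\approx g$, if $\langle f_0|\dots|f_n\rangle=\langle g_0|\dots|g_n\rangle$ for every $n$. Productive: for any objects $P,Q$ write $\langle h\rangle$ for the class of $h\colon P\to W\otimes Q$ in $\int^{W}\mathcal{C}(P,W\otimes Q)$ (the quotient of morphisms $P\to W\otimes Q$, $W$ varying, by the equivalence generated by $h;(r\otimes 1_Q)\sim h$). $\mathcal{C}$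 is productive if for all objects $X_0,Y_0$, every class $\alpha\in\int^M\mathcal{C}(X_0,M\otimes Y_0)$ is terminating: there exist an object $M_0$, a morphism $\alpha_0\colon X_0\to M_0\otimes Y_0$ and, for each representative $\alpha_i\colon X_0\to M_i\otimes Y_0$ of $\alpha$, a morphism $s_i\colon M_0\to M_i$ with $\alpha_i=\alpha_0;(s_i\otimes1_{Y_0})$, such that for all objects $A,B,U,V$ and morphisms $u\colon M_i\otimes A\to U\otimes B$, $v\colon M_j\otimes A\to V\otimes B$, the equality $\langle(\alpha_i\otimes1_A);(u\otimes1_{Y_0})\rangle=\langle(\alpha_j\otimes1_A);(v\otimes1_{Y_0})\rangle$ in $\int^W\mathcal{C}(X_0\otimes A,W\otimes B\otimes Y_0)$ (symmetries inserted as needed) implies $\langle(s_i\otimes1_A);u\rangle=\langle(s_j\otimes1_A);v\rangle$ in $\int^W\mathcal{C}(M_0\otimes A,W\otimes B)$. *)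

theory Defs
  imports "HOL-Library.FuncSet"
begin

section \<open>Categories\<close>

text \<open>
  The objects and the arrows of a category form sets, over arbitrary types, so every category
  here is small. Composition \<open>f \<Zsemi> g\<close> is in diagrammatic order.
\<close>

record ('o, 'a) cat =
  Obj :: "'o set"
  Arr :: "'a set"
  Src :: "'a \<Rightarrow> 'o"
  Tgt :: "'a \<Rightarrow> 'o"
  Idt :: "'o \<Rightarrow> 'a" ("\<one>\<index>")
  Seqc :: "'a \<Rightarrow> 'a \<Rightarrow> 'a" (infixl "\<Zsemi>\<index>" 65)

definition hom :: "('o, 'a, 'm) cat_scheme \<Rightarrow> 'o \<Rightarrow> 'o \<Rightarrow> 'a set" where
  "hom C A B = {f \<in> Arr C. Src C f = A \<and> Tgt C f = B}"

locale category =
  fixes C :: "('o, 'a, 'm) cat_scheme" (structure)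
  assumes src_obj: "f \<in> Arr C \<Longrightarrow> Src C f \<in> Obj C"
    and tgt_obj: "f \<in> Arr C \<Longrightarrow> Tgt C f \<in> Obj C"
    and idt_hom: "A \<in> Obj C \<Longrightarrow> \<one> A \<in> hom C A A"
    and seqc_hom: "\<lbrakk>f \<in> hom C A B; g \<in> hom C B D\<rbrakk> \<Longrightarrow> f \<Zsemi> g \<in> hom C A D"
    and idt_left: "f \<in> hom C A B \<Longrightarrow> \<one> A \<Zsemi> f = f"
    and idt_right: "f \<in> hom C A B \<Longrightarrow> f \<Zsemi> \<one> B = f"
    and seqc_assoc: "\<lbrakk>f \<in> hom C A B; g \<in> hom C B D; h \<in> hom C D E\<rbrakk>
      \<Longrightarrow> (f \<Zsemi> g) \<Zsemi> h = f \<Zsemi> (g \<Zsemi> h)"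

definition is_inverse :: "('o, 'a, 'm) cat_scheme \<Rightarrow> 'a \<Rightarrow> 'a \<Rightarrow> bool" where
  "is_inverse C f g \<longleftrightarrow> f \<in> Arr C \<and> g \<in> hom C (Tgt C f) (Src C f) \<and>
     f \<Zsemi>\<^bsub>C\<^esub> g = \<one>\<^bsub>C\<^esub> (Src C f) \<and> g \<Zsemi>\<^bsub>C\<^esub> f = \<one>\<^bsub>C\<^esub> (Tgt C f)"

definition iso :: "('o, 'a, 'm) cat_scheme \<Rightarrow> 'a \<Rightarrow> bool" where
  "iso C f \<longleftrightarrow> (\<exists>g. is_inverse C f g)"

definition inverse_arr :: "('o, 'a, 'm) cat_scheme \<Rightarrow> 'a \<Rightarrow> 'a" where
  "inverse_arr C f = (THE g. is_inverse C f g)"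

definition op_cat :: "('o, 'a, 'm) cat_scheme \<Rightarrow> ('o, 'a) cat" where
  "op_cat C = \<lparr>Obj = Obj C, Arr = Arr C, Src = Tgt C, Tgt = Src C, Idt = Idt C,
     Seqc = (\<lambda>f g. g \<Zsemi>\<^bsub>C\<^esub> f)\<rparr>"

definition prod_cat ::
  "('o, 'a, 'm) cat_scheme \<Rightarrow> ('p, 'b, 'n) cat_scheme \<Rightarrow> ('o \<times> 'p, 'a \<times> 'b) cat" where
  "prod_cat C D = \<lparr>Obj = Obj C \<times> Obj D, Arr = Arr C \<times> Arr D,
     Src = (\<lambda>(f, g). (Src C f, Src D g)), Tgt = (\<lambda>(f, g). (Tgt C f, Tgt D g)),
     Idt = (\<lambda>(A, B). (\<one>\<^bsub>C\<^esub> A, \<one>\<^bsub>D\<^esub> B)),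
     Seqc = (\<lambda>(f, g) (h, k). (f \<Zsemi>\<^bsub>C\<^esub> h, g \<Zsemi>\<^bsub>D\<^esub> k))\<rparr>"

text \<open>
  The power \<open>C\<^sup>J\<close>: families indexed by \<open>J\<close> with componentwise morphisms. The category of
  sequences in \<open>C\<close> is the case \<open>J = UNIV\<close>, that of tuples indexed by \<open>0, \<dots>, n\<close> is \<open>J = {..n}\<close>.
\<close>

definition pow_cat ::
  "('o, 'a, 'm) cat_scheme \<Rightarrow> 'j set \<Rightarrow> ('j \<Rightarrow> 'o, 'j \<Rightarrow> 'a) cat" where
  "pow_cat C J = \<lparr>Obj = (J \<rightarrow>\<^sub>E Obj C), Arr = (J \<rightarrow>\<^sub>E Arr C),
     Src = (\<lambda>f. \<lambda>i\<in>J. Src C (f i)), Tgt = (\<lambda>f. \<lambda>i\<in>J. Tgt C (f i)),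
     Idt = (\<lambda>A. \<lambda>i\<in>J. \<one>\<^bsub>C\<^esub> (A i)), Seqc = (\<lambda>f g. \<lambda>i\<in>J. f i \<Zsemi>\<^bsub>C\<^esub> g i)\<rparr>"

abbreviation seq_cat :: "('o, 'a, 'm) cat_scheme \<Rightarrow> (nat \<Rightarrow> 'o, nat \<Rightarrow> 'a) cat" where
  "seq_cat C \<equiv> pow_cat C (UNIV :: nat set)"


section \<open>Symmetric monoidal categories\<close>

text \<open>
  \<open>A \<otimes> B\<close> is the tensor on objects and \<open>f \<odot> g\<close> the tensor on arrows. The structure is not
  assumed strict: \<open>assoc A B D : (A \<otimes> B) \<otimes> D \<rightarrow> A \<otimes> (B \<otimes> D)\<close>, \<open>lunit A : I \<otimes> A \<rightarrow> A\<close>,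
  \<open>runit A : A \<otimes> I \<rightarrow> A\<close>, \<open>braid A B : A \<otimes> B \<rightarrow> B \<otimes> A\<close>.
\<close>

record ('o, 'a) smc = "('o, 'a) cat" +
  Tensor :: "'o \<Rightarrow> 'o \<Rightarrow> 'o" (infixr "\<otimes>\<index>" 75)
  TensorArr :: "'a \<Rightarrow> 'a \<Rightarrow> 'a" (infixr "\<odot>\<index>" 75)
  Unit :: 'o ("\<I>\<index>")
  assoc :: "'o \<Rightarrow> 'o \<Rightarrow> 'o \<Rightarrow> 'a"
  lunit :: "'o \<Rightarrow> 'a"
  runit :: "'o \<Rightarrow> 'a"
  braid :: "'o \<Rightarrow> 'o \<Rightarrow> 'a"

locale symmetric_monoidal_category = category C
  for C :: "('o, 'a, 'm) smc_scheme" (structure) +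
  assumes tensor_obj: "\<lbrakk>A \<in> Obj C; B \<in> Obj C\<rbrakk> \<Longrightarrow> A \<otimes> B \<in> Obj C"
    and unit_obj: "\<I> \<in> Obj C"
    and tensor_hom: "\<lbrakk>f \<in> hom C A B; g \<in> hom C A' B'\<rbrakk> \<Longrightarrow> f \<odot> g \<in> hom C (A \<otimes> A') (B \<otimes> B')"
    and tensor_idt: "\<lbrakk>A \<in> Obj C; B \<in> Obj C\<rbrakk> \<Longrightarrow> \<one> A \<odot> \<one> B = \<one> (A \<otimes> B)"
    and tensor_seqc: "\<lbrakk>f \<in> hom C A B; g \<in> hom C B D; f' \<in> hom C A' B'; g' \<in> hom C B' D'\<rbrakk>
      \<Longrightarrow> (f \<Zsemi> g) \<odot> (f' \<Zsemi> g') = (f \<odot> f') \<Zsemi> (g \<odot> g')"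
    and assoc_hom: "\<lbrakk>A \<in> Obj C; B \<in> Obj C; D \<in> Obj C\<rbrakk>
      \<Longrightarrow> assoc C A B D \<in> hom C ((A \<otimes> B) \<otimes> D) (A \<otimes> (B \<otimes> D))"
    and assoc_iso: "\<lbrakk>A \<in> Obj C; B \<in> Obj C; D \<in> Obj C\<rbrakk> \<Longrightarrow> iso C (assoc C A B D)"
    and assoc_natural: "\<lbrakk>f \<in> hom C A A'; g \<in> hom C B B'; h \<in> hom C D D'\<rbrakk>
      \<Longrightarrow> ((f \<odot> g) \<odot> h) \<Zsemi> assoc C A' B' D' = assoc C A B D \<Zsemi> (f \<odot> (g \<odot> h))"
    and lunit_hom: "A \<in> Obj C \<Longrightarrow> lunit C A \<in> hom C (\<I> \<otimes> A) A"
    and lunit_iso: "A \<in> Obj C \<Longrightarrow> iso C (lunit C A)"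
    and lunit_natural: "f \<in> hom C A B \<Longrightarrow> (\<one> \<I> \<odot> f) \<Zsemi> lunit C B = lunit C A \<Zsemi> f"
    and runit_hom: "A \<in> Obj C \<Longrightarrow> runit C A \<in> hom C (A \<otimes> \<I>) A"
    and runit_iso: "A \<in> Obj C \<Longrightarrow> iso C (runit C A)"
    and runit_natural: "f \<in> hom C A B \<Longrightarrow> (f \<odot> \<one> \<I>) \<Zsemi> runit C B = runit C A \<Zsemi> f"
    and braid_hom: "\<lbrakk>A \<in> Obj C; B \<in> Obj C\<rbrakk> \<Longrightarrow> braid C A B \<in> hom C (A \<otimes> B) (B \<otimes> A)"
    and braid_natural: "\<lbrakk>f \<in> hom C A A'; g \<in> hom C B B'\<rbrakk>
      \<Longrightarrow> (f \<odot> g) \<Zsemi> braid C A' B' = braid C A B \<Zsemi> (g \<odot> f)"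
    and braid_braid: "\<lbrakk>A \<in> Obj C; B \<in> Obj C\<rbrakk> \<Longrightarrow> braid C A B \<Zsemi> braid C B A = \<one> (A \<otimes> B)"
    and pentagon: "\<lbrakk>A \<in> Obj C; B \<in> Obj C; D \<in> Obj C; E \<in> Obj C\<rbrakk>
      \<Longrightarrow> (assoc C A B D \<odot> \<one> E) \<Zsemi> assoc C A (B \<otimes> D) E \<Zsemi> (\<one> A \<odot> assoc C B D E)
        = assoc C (A \<otimes> B) D E \<Zsemi> assoc C A B (D \<otimes> E)"
    and triangle: "\<lbrakk>A \<in> Obj C; B \<in> Obj C\<rbrakk>
      \<Longrightarrow> assoc C A \<I> B \<Zsemi> (\<one> A \<odot> lunit C B) = runit C A \<odot> \<one> B"
    and hexagon: "\<lbrakk>A \<in> Obj C; B \<in> Obj C; D \<in> Obj C\<rbrakk>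
      \<Longrightarrow> assoc C A B D \<Zsemi> braid C A (B \<otimes> D) \<Zsemi> assoc C B D A
        = (braid C A B \<odot> \<one> D) \<Zsemi> assoc C B A D \<Zsemi> (\<one> B \<odot> braid C A D)"


section \<open>Set-valued functors and coends\<close>

record ('o, 'a, 'x) setfun =
  FOb :: "'o \<Rightarrow> 'x set"
  FAr :: "'a \<Rightarrow> 'x \<Rightarrow> 'x"

definition is_setfun :: "('o, 'a, 'm) cat_scheme \<Rightarrow> ('o, 'a, 'x) setfun \<Rightarrow> bool" where
  "is_setfun D F \<longleftrightarrow>
     (\<forall>f\<in>Arr D. FAr F f \<in> FOb F (Src D f) \<rightarrow> FOb F (Tgt D f)) \<and>
     (\<forall>A\<in>Obj D. \<forall>x\<in>FOb F A. FAr F (\<one>\<^bsub>D\<^esub> A) x = x) \<and>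
     (\<forall>f\<in>Arr D. \<forall>g\<in>Arr D. Tgt D f = Src D g \<longrightarrow>
        (\<forall>x\<in>FOb F (Src D f). FAr F (f \<Zsemi>\<^bsub>D\<^esub> g) x = FAr F g (FAr F f x)))"

text \<open>Components are extensional, so that equality of functions is equality of transformations.\<close>

definition is_nat_trans :: "('o, 'a, 'm) cat_scheme \<Rightarrow> ('o, 'a, 'x) setfun \<Rightarrow>
    ('o, 'a, 'y) setfun \<Rightarrow> ('o \<Rightarrow> 'x \<Rightarrow> 'y) \<Rightarrow> bool" where
  "is_nat_trans D F G \<eta> \<longleftrightarrow>
     \<eta> \<in> (\<Pi>\<^sub>E A\<in>Obj D. FOb F A \<rightarrow>\<^sub>E FOb G A) \<and>
     (\<forall>f\<in>Arr D. \<forall>x\<in>FOb F (Src D f). \<eta> (Tgt D f) (FAr F f x) = FAr G f (\<eta> (Src D f) x))"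

text \<open>
  The coend of \<open>P : D\<^sup>o\<^sup>p \<times> D \<rightarrow> Set\<close> is the disjoint union of the sets \<open>P(M, M)\<close> modulo the
  equivalence relation generated by \<open>P(1, r)(x) \<sim> P(r, 1)(x)\<close> for \<open>r : N \<rightarrow> M\<close> and \<open>x \<in> P(M, N)\<close>.
\<close>

definition coend_rel :: "('d, 'b, 'm) cat_scheme \<Rightarrow> ('d \<times> 'd, 'b \<times> 'b, 'x) setfun \<Rightarrow>
    (('d \<times> 'x) \<times> ('d \<times> 'x)) set" where
  "coend_rel D P =
     (let R = {((M, FAr P (\<one>\<^bsub>D\<^esub> M, r) x), (N, FAr P (r, \<one>\<^bsub>D\<^esub> N) x)) | M N r x.
                 M \<in> Obj D \<and> N \<in> Obj D \<and> r \<in> hom D N M \<and> x \<in> FOb P (M, N)}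
      in (R \<union> R\<inverse>)\<^sup>*)"

definition coend :: "('d, 'b, 'm) cat_scheme \<Rightarrow> ('d \<times> 'd, 'b \<times> 'b, 'x) setfun \<Rightarrow>
    ('d \<times> 'x) set set" where
  "coend D P = (SIGMA M : Obj D. FOb P (M, M)) // coend_rel D P"

definition coend_class :: "('d, 'b, 'm) cat_scheme \<Rightarrow> ('d \<times> 'd, 'b \<times> 'b, 'x) setfun \<Rightarrow>
    'd \<Rightarrow> 'x \<Rightarrow> ('d \<times> 'x) set" where
  "coend_class D P M x = coend_rel D P `` {(M, x)}"


section \<open>Productive categories\<close>

text \<open>The functor \<open>(W', W) \<mapsto> C(P, W \<otimes> Q)\<close>, constant in \<open>W'\<close>.\<close>

definition out_fun :: "('o, 'a, 'm) smc_scheme \<Rightarrow> 'o \<Rightarrow> 'o \<Rightarrow> ('o \<times> 'o, 'a \<times> 'a, 'a) setfun" where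
  "out_fun C P Q = \<lparr>FOb = (\<lambda>(W', W). hom C P (W \<otimes>\<^bsub>C\<^esub> Q)),
     FAr = (\<lambda>(r, s) h. h \<Zsemi>\<^bsub>C\<^esub> (s \<odot>\<^bsub>C\<^esub> \<one>\<^bsub>C\<^esub> Q))\<rparr>"

definition out_class :: "('o, 'a, 'm) smc_scheme \<Rightarrow> 'o \<Rightarrow> 'o \<Rightarrow> 'o \<Rightarrow> 'a \<Rightarrow> ('o \<times> 'a) set" where
  "out_class C P Q W h = coend_class C (out_fun C P Q) W h"

text \<open>The canonical isomorphism \<open>(M \<otimes> Y) \<otimes> A \<rightarrow> (M \<otimes> A) \<otimes> Y\<close>.\<close>

definition swap_right :: "('o, 'a, 'm) smc_scheme \<Rightarrow> 'o \<Rightarrow> 'o \<Rightarrow> 'o \<Rightarrow> 'a" where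
  "swap_right C M Y A =
     assoc C M Y A \<Zsemi>\<^bsub>C\<^esub> (\<one>\<^bsub>C\<^esub> M \<odot>\<^bsub>C\<^esub> braid C Y A) \<Zsemi>\<^bsub>C\<^esub> inverse_arr C (assoc C M A Y)"

text \<open>
  For \<open>a : X \<rightarrow> M \<otimes> Y\<close> and \<open>u : M \<otimes> A \<rightarrow> U \<otimes> B\<close>, the composite
  \<open>X \<otimes> A \<rightarrow> (M \<otimes> Y) \<otimes> A \<rightarrow> (M \<otimes> A) \<otimes> Y \<rightarrow> (U \<otimes> B) \<otimes> Y \<rightarrow> U \<otimes> (B \<otimes> Y)\<close>.
\<close>

definition followed_by ::
  "('o, 'a, 'm) smc_scheme \<Rightarrow> 'o \<Rightarrow> 'o \<Rightarrow> 'o \<Rightarrow> 'o \<Rightarrow> 'o \<Rightarrow> 'a \<Rightarrow> 'a \<Rightarrow> 'a" where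
  "followed_by C M Y A U B a u =
     (a \<odot>\<^bsub>C\<^esub> \<one>\<^bsub>C\<^esub> A) \<Zsemi>\<^bsub>C\<^esub> swap_right C M Y A \<Zsemi>\<^bsub>C\<^esub> (u \<odot>\<^bsub>C\<^esub> \<one>\<^bsub>C\<^esub> Y) \<Zsemi>\<^bsub>C\<^esub> assoc C U B Y"

definition terminating ::
  "('o, 'a, 'm) smc_scheme \<Rightarrow> 'o \<Rightarrow> 'o \<Rightarrow> ('o \<times> 'a) set \<Rightarrow> bool" where
  "terminating C X Y \<alpha> \<longleftrightarrow>
     (\<exists>M\<^sub>0\<in>Obj C. \<exists>\<alpha>\<^sub>0\<in>hom C X (M\<^sub>0 \<otimes>\<^bsub>C\<^esub> Y). \<exists>s.
        (\<forall>(M, a)\<in>\<alpha>. s M a \<in> hom C M\<^sub>0 M \<and> a = \<alpha>\<^sub>0 \<Zsemi>\<^bsub>C\<^esub> (s M a \<odot>\<^bsub>C\<^esub> \<one>\<^bsub>C\<^esub> Y)) \<and>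
        (\<forall>(M, a)\<in>\<alpha>. \<forall>(N, b)\<in>\<alpha>. \<forall>A\<in>Obj C. \<forall>B\<in>Obj C. \<forall>U\<in>Obj C. \<forall>V\<in>Obj C.
           \<forall>u\<in>hom C (M \<otimes>\<^bsub>C\<^esub> A) (U \<otimes>\<^bsub>C\<^esub> B). \<forall>v\<in>hom C (N \<otimes>\<^bsub>C\<^esub> A) (V \<otimes>\<^bsub>C\<^esub> B).
             out_class C (X \<otimes>\<^bsub>C\<^esub> A) (B \<otimes>\<^bsub>C\<^esub> Y) U (followed_by C M Y A U B a u) =
             out_class C (X \<otimes>\<^bsub>C\<^esub> A) (B \<otimes>\<^bsub>C\<^esub> Y) V (followed_by C N Y A V B b v) \<longrightarrow>
             out_class C (M\<^sub>0 \<otimes>\<^bsub>C\<^esub> A) B U ((s M a \<odot>\<^bsub>C\<^esub> \<one>\<^bsub>C\<^esub> A) \<Zsemi>\<^bsub>C\<^esub> u) =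
             out_class C (M\<^sub>0 \<otimes>\<^bsub>C\<^esub> A) B V ((s N b \<odot>\<^bsub>C\<^esub> \<one>\<^bsub>C\<^esub> A) \<Zsemi>\<^bsub>C\<^esub> v)))"

definition productive :: "('o, 'a, 'm) smc_scheme \<Rightarrow> bool" where
  "productive C \<longleftrightarrow>
     (\<forall>X\<in>Obj C. \<forall>Y\<in>Obj C. \<forall>\<alpha>\<in>coend C (out_fun C X Y). terminating C X Y \<alpha>)"


section \<open>The endofunctor and its coalgebras\<close>

definition shift :: "(nat \<Rightarrow> 'b) \<Rightarrow> nat \<Rightarrow> 'b" where
  "shift X = (\<lambda>n. X (Suc n))"

definition act_obj :: "('o, 'a, 'm) smc_scheme \<Rightarrow> 'o \<Rightarrow> (nat \<Rightarrow> 'o) \<Rightarrow> nat \<Rightarrow> 'o" where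
  "act_obj C M X = X(0 := M \<otimes>\<^bsub>C\<^esub> X 0)"

definition act_arr :: "('o, 'a, 'm) smc_scheme \<Rightarrow> 'a \<Rightarrow> (nat \<Rightarrow> 'a) \<Rightarrow> nat \<Rightarrow> 'a" where
  "act_arr C r u = u(0 := r \<odot>\<^bsub>C\<^esub> u 0)"

abbreviation prof_cat :: "('o, 'a, 'm) cat_scheme \<Rightarrow>
    ((nat \<Rightarrow> 'o) \<times> (nat \<Rightarrow> 'o), (nat \<Rightarrow> 'a) \<times> (nat \<Rightarrow> 'a)) cat" where
  "prof_cat C \<equiv> prod_cat (op_cat (seq_cat C)) (seq_cat C)"

type_synonym ('o, 'a, 'q) prof =
  "((nat \<Rightarrow> 'o) \<times> (nat \<Rightarrow> 'o), (nat \<Rightarrow> 'a) \<times> (nat \<Rightarrow> 'a), 'q) setfun"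

text \<open>The functor \<open>(M', M) \<mapsto> C(X\<^sub>0, M \<otimes> Y\<^sub>0) \<times> Q(M' \<cdot> X\<^sup>+, Y\<^sup>+)\<close>.\<close>

definition Phi_integrand :: "('o, 'a, 'm) smc_scheme \<Rightarrow> ('o, 'a, 'q) prof \<Rightarrow>
    (nat \<Rightarrow> 'o) \<Rightarrow> (nat \<Rightarrow> 'o) \<Rightarrow> ('o \<times> 'o, 'a \<times> 'a, 'a \<times> 'q) setfun" where
  "Phi_integrand C Q X Y =
     \<lparr>FOb = (\<lambda>(M', M). hom C (X 0) (M \<otimes>\<^bsub>C\<^esub> Y 0) \<times> FOb Q (act_obj C M' (shift X), shift Y)),
      FAr = (\<lambda>(r, s) (f, q). (f \<Zsemi>\<^bsub>C\<^esub> (s \<odot>\<^bsub>C\<^esub> \<one>\<^bsub>C\<^esub> (Y 0)),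
               FAr Q (act_arr C r (\<one>\<^bsub>seq_cat C\<^esub> (shift X)), \<one>\<^bsub>seq_cat C\<^esub> (shift Y)) q))\<rparr>"

definition Phi_class :: "('o, 'a, 'm) smc_scheme \<Rightarrow> ('o, 'a, 'q) prof \<Rightarrow>
    (nat \<Rightarrow> 'o) \<Rightarrow> (nat \<Rightarrow> 'o) \<Rightarrow> 'o \<Rightarrow> 'a \<Rightarrow> 'q \<Rightarrow> ('o \<times> ('a \<times> 'q)) set" where
  "Phi_class C Q X Y M f q = coend_class C (Phi_integrand C Q X Y) M (f, q)"

text \<open>
  Maps out of quotients are written as unions over representatives: when the map is well defined,
  this is the union of a constant family of classes. An arrow \<open>(u, v)\<close> of
  \<open>prof_cat C\<close> is a pair \<open>u : X' \<rightarrow> X\<close>, \<open>v : Y \<rightarrow> Y'\<close>; it acts by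
  \<open>[M, f, q] \<mapsto> [M, u\<^sub>0 \<Zsemi> f \<Zsemi> (1 \<otimes> v\<^sub>0), Q(M \<cdot> u\<^sup>+, v\<^sup>+)(q)]\<close>.
\<close>

definition Phi :: "('o, 'a, 'm) smc_scheme \<Rightarrow> ('o, 'a, 'q) prof \<Rightarrow>
    ('o, 'a, ('o \<times> ('a \<times> 'q)) set) prof" where
  "Phi C Q =
     \<lparr>FOb = (\<lambda>(X, Y). coend C (Phi_integrand C Q X Y)),
      FAr = (\<lambda>(u, v) c. \<Union>(M, (f, q))\<in>c.
               Phi_class C Q (Src (seq_cat C) u) (Tgt (seq_cat C) v) M
                 (u 0 \<Zsemi>\<^bsub>C\<^esub> f \<Zsemi>\<^bsub>C\<^esub> (\<one>\<^bsub>C\<^esub> M \<odot>\<^bsub>C\<^esub> v 0))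
                 (FAr Q (act_arr C (\<one>\<^bsub>C\<^esub> M) (shift u), shift v) q))\<rparr>"

text \<open>
  The action of the endofunctor on a transformation \<open>\<eta>\<close> with codomain \<open>R\<close>:
  \<open>[M, f, q] \<mapsto> [M, f, \<eta>(q)]\<close>.
\<close>

definition Phi_map :: "('o, 'a, 'm) smc_scheme \<Rightarrow> ('o, 'a, 'r) prof \<Rightarrow>
    ((nat \<Rightarrow> 'o) \<times> (nat \<Rightarrow> 'o) \<Rightarrow> 'q \<Rightarrow> 'r) \<Rightarrow> (nat \<Rightarrow> 'o) \<times> (nat \<Rightarrow> 'o) \<Rightarrow>
    ('o \<times> ('a \<times> 'q)) set \<Rightarrow> ('o \<times> ('a \<times> 'r)) set" where
  "Phi_map C R \<eta> = (\<lambda>(X, Y) c. \<Union>(M, (f, q))\<in>c.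
     Phi_class C R X Y M f (\<eta> (act_obj C M (shift X), shift Y) q))"

definition Phi_coalgebra :: "('o, 'a, 'm) smc_scheme \<Rightarrow> ('o, 'a, 'q) prof \<Rightarrow>
    ((nat \<Rightarrow> 'o) \<times> (nat \<Rightarrow> 'o) \<Rightarrow> 'q \<Rightarrow> ('o \<times> ('a \<times> 'q)) set) \<Rightarrow> bool" where
  "Phi_coalgebra C Q \<gamma> \<longleftrightarrow> is_setfun (prof_cat C) Q \<and> is_nat_trans (prof_cat C) Q (Phi C Q) \<gamma>"

definition Phi_coalgebra_hom :: "('o, 'a, 'm) smc_scheme \<Rightarrow>
    ('o, 'a, 'q) prof \<Rightarrow> ((nat \<Rightarrow> 'o) \<times> (nat \<Rightarrow> 'o) \<Rightarrow> 'q \<Rightarrow> ('o \<times> ('a \<times> 'q)) set) \<Rightarrow>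
    ('o, 'a, 'r) prof \<Rightarrow> ((nat \<Rightarrow> 'o) \<times> (nat \<Rightarrow> 'o) \<Rightarrow> 'r \<Rightarrow> ('o \<times> ('a \<times> 'r)) set) \<Rightarrow>
    ((nat \<Rightarrow> 'o) \<times> (nat \<Rightarrow> 'o) \<Rightarrow> 'q \<Rightarrow> 'r) \<Rightarrow> bool" where
  "Phi_coalgebra_hom C Q \<gamma> R \<delta> \<eta> \<longleftrightarrow> is_nat_trans (prof_cat C) Q R \<eta> \<and>
     (\<forall>A\<in>Obj (prof_cat C). \<forall>q\<in>FOb Q A. \<delta> A (\<eta> A q) = Phi_map C R \<eta> A (\<gamma> A q))"

definition Phi_fixpoint :: "('o, 'a, 'm) smc_scheme \<Rightarrow> ('o, 'a, 'q) prof \<Rightarrow>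
    ((nat \<Rightarrow> 'o) \<times> (nat \<Rightarrow> 'o) \<Rightarrow> 'q \<Rightarrow> ('o \<times> ('a \<times> 'q)) set) \<Rightarrow> bool" where
  "Phi_fixpoint C Q \<gamma> \<longleftrightarrow> Phi_coalgebra C Q \<gamma> \<and>
     (\<forall>A\<in>Obj (prof_cat C). bij_betw (\<gamma> A) (FOb Q A) (FOb (Phi C Q) A))"


section \<open>Observational sequences\<close>

text \<open>\<open>prev z M i\<close> is \<open>M\<^sub>i\<^sub>-\<^sub>1\<close>, where \<open>z\<close> is the value at index \<open>-1\<close>.\<close>

definition prev :: "'b \<Rightarrow> (nat \<Rightarrow> 'b) \<Rightarrow> nat \<Rightarrow> 'b" where
  "prev z M i = (case i of 0 \<Rightarrow> z | Suc k \<Rightarrow> M k)"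

text \<open>
  The functor \<open>(M, N) \<mapsto> \<Prod>\<^sub>i\<^sub>\<in>\<^sub>J C(M\<^sub>i\<^sub>-\<^sub>1 \<otimes> X\<^sub>i, N\<^sub>i \<otimes> Y\<^sub>i)\<close> on \<open>(C\<^sup>J)\<^sup>o\<^sup>p \<times> C\<^sup>J\<close>, for an initial
  segment \<open>J\<close> of the natural numbers.
\<close>

definition seq_integrand :: "('o, 'a, 'm) smc_scheme \<Rightarrow> nat set \<Rightarrow> (nat \<Rightarrow> 'o) \<Rightarrow> (nat \<Rightarrow> 'o) \<Rightarrow>
    ((nat \<Rightarrow> 'o) \<times> (nat \<Rightarrow> 'o), (nat \<Rightarrow> 'a) \<times> (nat \<Rightarrow> 'a), nat \<Rightarrow> 'a) setfun" where
  "seq_integrand C J X Y =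
     \<lparr>FOb = (\<lambda>(M, N). \<Pi>\<^sub>E i\<in>J. hom C (prev \<I>\<^bsub>C\<^esub> M i \<otimes>\<^bsub>C\<^esub> X i) (N i \<otimes>\<^bsub>C\<^esub> Y i)),
      FAr = (\<lambda>(r, s) f. \<lambda>i\<in>J. (prev (\<one>\<^bsub>C\<^esub> \<I>\<^bsub>C\<^esub>) r i \<odot>\<^bsub>C\<^esub> \<one>\<^bsub>C\<^esub> (X i)) \<Zsemi>\<^bsub>C\<^esub> f i
               \<Zsemi>\<^bsub>C\<^esub> (s i \<odot>\<^bsub>C\<^esub> \<one>\<^bsub>C\<^esub> (Y i)))\<rparr>"

definition dSeq :: "('o, 'a, 'm) smc_scheme \<Rightarrow> (nat \<Rightarrow> 'o) \<Rightarrow> (nat \<Rightarrow> 'o) \<Rightarrow>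
    ((nat \<Rightarrow> 'o) \<times> (nat \<Rightarrow> 'a)) set set" where
  "dSeq C X Y = coend (seq_cat C) (seq_integrand C UNIV X Y)"

definition dSeq_class :: "('o, 'a, 'm) smc_scheme \<Rightarrow> (nat \<Rightarrow> 'o) \<Rightarrow> (nat \<Rightarrow> 'o) \<Rightarrow>
    (nat \<Rightarrow> 'o) \<Rightarrow> (nat \<Rightarrow> 'a) \<Rightarrow> ((nat \<Rightarrow> 'o) \<times> (nat \<Rightarrow> 'a)) set" where
  "dSeq_class C X Y M f = coend_class (seq_cat C) (seq_integrand C UNIV X Y) M f"

definition Stage :: "('o, 'a, 'm) smc_scheme \<Rightarrow> nat \<Rightarrow> (nat \<Rightarrow> 'o) \<Rightarrow> (nat \<Rightarrow> 'o) \<Rightarrow>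
    ((nat \<Rightarrow> 'o) \<times> (nat \<Rightarrow> 'a)) set set" where
  "Stage C n X Y = coend (pow_cat C {..n}) (seq_integrand C {..n} X Y)"

text \<open>The class \<open>\<langle>f\<^sub>0 | \<dots> | f\<^sub>n\<rangle>\<close> in \<open>Stage C n X Y\<close> of the truncation of a sequence.\<close>

definition stage_class :: "('o, 'a, 'm) smc_scheme \<Rightarrow> nat \<Rightarrow> (nat \<Rightarrow> 'o) \<Rightarrow> (nat \<Rightarrow> 'o) \<Rightarrow>
    (nat \<Rightarrow> 'o) \<Rightarrow> (nat \<Rightarrow> 'a) \<Rightarrow> ((nat \<Rightarrow> 'o) \<times> (nat \<Rightarrow> 'a)) set" where
  "stage_class C n X Y M f =
     coend_class (pow_cat C {..n}) (seq_integrand C {..n} X Y) (restrict M {..n}) (restrict f {..n})"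

definition obs_equiv :: "('o, 'a, 'm) smc_scheme \<Rightarrow> (nat \<Rightarrow> 'o) \<Rightarrow> (nat \<Rightarrow> 'o) \<Rightarrow>
    (((nat \<Rightarrow> 'o) \<times> (nat \<Rightarrow> 'a)) set \<times> ((nat \<Rightarrow> 'o) \<times> (nat \<Rightarrow> 'a)) set) set" where
  "obs_equiv C X Y = {(a, b). a \<in> dSeq C X Y \<and> b \<in> dSeq C X Y \<and>
     (\<forall>(M, f)\<in>a. \<forall>(N, g)\<in>b. \<forall>n. stage_class C n X Y M f = stage_class C n X Y N g)}"

definition oSeq_class :: "('o, 'a, 'm) smc_scheme \<Rightarrow> (nat \<Rightarrow> 'o) \<Rightarrow> (nat \<Rightarrow> 'o) \<Rightarrow>
    (nat \<Rightarrow> 'o) \<Rightarrow> (nat \<Rightarrow> 'a) \<Rightarrow> ((nat \<Rightarrow> 'o) \<times> (nat \<Rightarrow> 'a)) set set" where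
  "oSeq_class C X Y M f = obs_equiv C X Y `` {dSeq_class C X Y M f}"

text \<open>
  \<open>(u, v)\<close> acts on the class of \<open>(f\<^sub>n)\<close> by \<open>((1 \<otimes> u\<^sub>n) \<Zsemi> f\<^sub>n \<Zsemi> (1 \<otimes> v\<^sub>n))\<close>.
\<close>

definition oSeq :: "('o, 'a, 'm) smc_scheme \<Rightarrow>
    ('o, 'a, ((nat \<Rightarrow> 'o) \<times> (nat \<Rightarrow> 'a)) set set) prof" where
  "oSeq C =
     \<lparr>FOb = (\<lambda>(X, Y). dSeq C X Y // obs_equiv C X Y),
      FAr = (\<lambda>(u, v) c. \<Union>a\<in>c. \<Union>(M, f)\<in>a.
               oSeq_class C (Src (seq_cat C) u) (Tgt (seq_cat C) v) M
                 (\<lambda>i. (\<one>\<^bsub>C\<^esub> (prev \<I>\<^bsub>C\<^esub> M i) \<odot>\<^bsub>C\<^esub> u i) \<Zsemi>\<^bsub>C\<^esub> f i \<Zsemi>\<^bsub>C\<^esub> (\<one>\<^bsub>C\<^esub> (M i) \<odot>\<^bsub>C\<^esub> v i)))\<rparr>"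

text \<open>
  The coalgebra structure splits off the first component, \<open>[f\<^sub>0, f\<^sub>1, \<dots>] \<mapsto> [M\<^sub>0, f\<^sub>0, [f\<^sub>1, f\<^sub>2, \<dots>]]\<close>.
  The unitors turn \<open>f\<^sub>0 : I \<otimes> X\<^sub>0 \<rightarrow> M\<^sub>0 \<otimes> Y\<^sub>0\<close> into an arrow from \<open>X\<^sub>0\<close>, and
  \<open>f\<^sub>1 : M\<^sub>0 \<otimes> X\<^sub>1 \<rightarrow> M\<^sub>1 \<otimes> Y\<^sub>1\<close> into an arrow from \<open>I \<otimes> (M\<^sub>0 \<otimes> X\<^sub>1)\<close>.
\<close>

definition oSeq_coalg :: "('o, 'a, 'm) smc_scheme \<Rightarrow> (nat \<Rightarrow> 'o) \<times> (nat \<Rightarrow> 'o) \<Rightarrow>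
    ((nat \<Rightarrow> 'o) \<times> (nat \<Rightarrow> 'a)) set set \<Rightarrow>
    ('o \<times> ('a \<times> ((nat \<Rightarrow> 'o) \<times> (nat \<Rightarrow> 'a)) set set)) set" where
  "oSeq_coalg C = (\<lambda>A\<in>Obj (prof_cat C). \<lambda>c\<in>FOb (oSeq C) A.
     (case A of (X, Y) \<Rightarrow> \<Union>a\<in>c. \<Union>(M, f)\<in>a.
        Phi_class C (oSeq C) X Y (M 0) (inverse_arr C (lunit C (X 0)) \<Zsemi>\<^bsub>C\<^esub> f 0)
          (oSeq_class C (act_obj C (M 0) (shift X)) (shift Y) (shift M)
             ((shift f)(0 := lunit C (M 0 \<otimes>\<^bsub>C\<^esub> X 1) \<Zsemi>\<^bsub>C\<^esub> f 1)))))"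

end

theory Submission
  imports Defs
begin

text \<open>
  An element of a coalgebra unfolds, by choosing representatives, into a sequence of arrows, and
  prefixing an arrow gives a well-defined map from the value of the endofunctor at observational
  sequences back to observational sequences. Truncating at stage \<open>n\<close>, one sees by induction on \<open>n\<close>
  that the unfolding does not depend on the choices and that it is the only coalgebra morphism.
  Productivity enters only in making the splitting off of the first component well defined:
  if \<open>\<langle>f\<^sub>0|\<dots>|f\<^sub>n\<rangle> = \<langle>g\<^sub>0|\<dots>|g\<^sub>n\<rangle>\<close>, then \<open>f\<^sub>0\<close> and \<open>g\<^sub>0\<close> factor through a common \<open>\<alpha>\<^sub>0\<close> by arrows \<open>s\<close>
  and \<open>t\<close>, and the remaining \<open>\<langle>s \<Zsemi> f\<^sub>1|\<dots>|f\<^sub>n\<rangle>\<close> and \<open>\<langle>t \<Zsemi> g\<^sub>1|\<dots>|g\<^sub>n\<rangle>\<close> are equal. Along a single slide this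
  reduces to an equality of classes of one-step arrows with a side output \<open>W\<close>, which is provided by
  productivity and is carried through the later steps by tensoring these with \<open>W\<close>.
\<close>

section \<open>Coends and categories\<close>

text \<open>Equality in a coend is witnessed by one finite chain of slides, whereas observational
  equivalence supplies a separate chain for every stage \<open>n\<close>, with unrelated lengths and
  unrelated intermediate memories. The endofunctor nevertheless asks for a single chain that joins
  the first memory of one sequence to that of the other and matches the remainders. Termination
  resolves this: \<open>P\<close>, \<open>a0\<close> and \<open>s\<close> depend only on the class
  of the first component, hence not on \<open>n\<close>, so the first memories are joined through
  \<open>P\<close> once and for all, and only the remainders are compared stage by stage. The
  unfolding of a coalgebra element makes infinitely many choices, one per step. Two series of
  choices are joined by a chain at each finite stage, but no single chain over all indices is
  produced; this is why the target is the quotient by stagewise equality.\<close>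

lemma equivclp_map_on:
  assumes "equivclp R a b" "a \<in> A"
    and "\<And>a b. R a b \<Longrightarrow> a \<in> A \<longleftrightarrow> b \<in> A"
    and "\<And>a b. R a b \<Longrightarrow> a \<in> A \<Longrightarrow> b \<in> A \<Longrightarrow> equivclp S (F a) (F b)"
  shows "b \<in> A \<and> equivclp S (F a) (F b)"
  using assms(1)
proof (induction rule: equivclp_induct)
  case base
  show ?case using assms(2) by simp
next
  case (step y z)
  then show ?case using assms(3,4) by (metis equivclp_sym equivclp_trans)
qed

lemma equivclp_map:
  assumes "equivclp R a b" and "\<And>a b. R a b \<Longrightarrow> equivclp S (F a) (F b)"
  shows "equivclp S (F a) (F b)"
  using equivclp_map_on[of R a b UNIV S F] assms by simp

text \<open>Membership in \<open>A\<close> has to pass along \<open>R\<close> both ways because the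
  closure also traverses \<open>R\<close> backwards. \<open>A\<close> will be a set of well-typed
  elements, on which alone \<open>F\<close> is known to respect \<open>R\<close>.\<close>

lemma equivclp_invariant:
  assumes "equivclp R a b" "a \<in> A"
    and "\<And>a b. R a b \<Longrightarrow> a \<in> A \<longleftrightarrow> b \<in> A"
    and "\<And>a b. R a b \<Longrightarrow> a \<in> A \<Longrightarrow> b \<in> A \<Longrightarrow> F a = F b"
  shows "b \<in> A \<and> F a = F b"
  using assms(1)
proof (induction rule: equivclp_induct)
  case base
  show ?case using assms(2) by simp
next
  case (step y z)
  then show ?case using assms(3,4) by metis
qed

text \<open>The generating relation as a predicate, so that chains can be followed by the induction
  rule of \<open>equivclp\<close>. It is oriented so that a step moves \<open>r\<close> from an
  output to the next input.\<close>

definition coend_step :: "('d, 'b, 'm) cat_scheme \<Rightarrow> ('d \<times> 'd, 'b \<times> 'b, 'x) setfun \<Rightarrow>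
    'd \<times> 'x \<Rightarrow> 'd \<times> 'x \<Rightarrow> bool" where
  "coend_step D P a b \<longleftrightarrow> (\<exists>M N r x. M \<in> Obj D \<and> N \<in> Obj D \<and> r \<in> hom D N M \<and> x \<in> FOb P (M, N) \<and>
     a = (M, FAr P (\<one>\<^bsub>D\<^esub> M, r) x) \<and> b = (N, FAr P (r, \<one>\<^bsub>D\<^esub> N) x))"

lemma coend_rel_iff: "(a, b) \<in> coend_rel D P \<longleftrightarrow> equivclp (coend_step D P) a b"
proof -
  let ?R = "{((M, FAr P (\<one>\<^bsub>D\<^esub> M, r) x), (N, FAr P (r, \<one>\<^bsub>D\<^esub> N) x)) | M N r x.
                 M \<in> Obj D \<and> N \<in> Obj D \<and> r \<in> hom D N M \<and> x \<in> FOb P (M, N)}"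
  have "?R \<union> ?R\<inverse> = {(a, b). symclp (coend_step D P) a b}"
    by (auto simp: coend_step_def symclp_def) blast+
  moreover have "{(a, b). symclp (coend_step D P) a b}\<^sup>* = {(a, b). equivclp (coend_step D P) a b}"
    by (simp add: equivclp_def rtranclp_def rtrancl_def)
  ultimately show ?thesis by (simp add: coend_rel_def)
qed

text \<open>The carrier is \<open>UNIV\<close>: a reflexive transitive closure relates ill-typed
  pairs to themselves as well. Hence equality of classes needs no typing hypotheses.\<close>

lemma coend_rel_equiv: "equiv UNIV (coend_rel D P)"
  by (rule equivI) (auto simp: refl_on_def coend_rel_iff intro!: symI transI
    intro: equivclp_sym equivclp_trans)

lemma coend_class_eq_iff:
  "coend_class D P M x = coend_class D P N y \<longleftrightarrow> equivclp (coend_step D P) (M, x) (N, y)"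
  unfolding coend_class_def by (simp add: eq_equiv_class_iff[OF coend_rel_equiv] coend_rel_iff)

lemma mem_coend_class_iff:
  "a \<in> coend_class D P M x \<longleftrightarrow> equivclp (coend_step D P) (M, x) a"
  by (simp add: coend_class_def coend_rel_iff)

lemma mem_coend_classD: "(N, y) \<in> coend_class D P M x \<Longrightarrow> coend_class D P N y = coend_class D P M x"
  by (simp add: mem_coend_class_iff coend_class_eq_iff equivclp_sym)

lemma self_mem_coend_class: "(M, x) \<in> coend_class D P M x"
  by (simp add: mem_coend_class_iff)

lemma mem_coend_iff:
  "c \<in> coend D P \<longleftrightarrow> (\<exists>M x. M \<in> Obj D \<and> x \<in> FOb P (M, M) \<and> c = coend_class D P M x)"
  by (auto simp: coend_def quotient_def coend_class_def)

lemma hom_iff: "f \<in> hom C A B \<longleftrightarrow> f \<in> Arr C \<and> Src C f = A \<and> Tgt C f = B"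
  by (simp add: hom_def)

lemma prev_0 [simp]: "prev z M 0 = z" and prev_Suc [simp]: "prev z M (Suc k) = M k"
  by (simp_all add: prev_def)

lemma shift_apply [simp]: "shift X n = X (Suc n)"
  by (simp add: shift_def)

context category
begin

lemma src_tgt_obj [simp]: "f \<in> Arr C \<Longrightarrow> Src C f \<in> Obj C" "f \<in> Arr C \<Longrightarrow> Tgt C f \<in> Obj C"
  by (rule src_obj tgt_obj; assumption)+

lemma hom_obj: "f \<in> hom C A B \<Longrightarrow> A \<in> Obj C" "f \<in> hom C A B \<Longrightarrow> B \<in> Obj C"
  by (auto simp: hom_iff)

lemma idt_simps [simp]:
  assumes "A \<in> Obj C"
  shows "\<one> A \<in> Arr C" "Src C (\<one> A) = A" "Tgt C (\<one> A) = A"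
  using idt_hom[OF assms] by (simp_all add: hom_iff)

text \<open>With \<open>hom\<close>, the middle object would be a variable absent from the
  conclusion. The form with \<open>Arr\<close>, \<open>Src\<close> and \<open>Tgt\<close> lets the
  simplifier check composability by computing both ends.\<close>

lemma seqc_simps [simp]:
  assumes "f \<in> Arr C" "g \<in> Arr C" "Tgt C f = Src C g"
  shows "f \<Zsemi> g \<in> Arr C" "Src C (f \<Zsemi> g) = Src C f" "Tgt C (f \<Zsemi> g) = Tgt C g"
  using seqc_hom[of f "Src C f" "Tgt C f" g "Tgt C g"] assms by (simp_all add: hom_iff)

lemma idt_seqc [simp]: "\<lbrakk>f \<in> Arr C; Src C f = A\<rbrakk> \<Longrightarrow> \<one> A \<Zsemi> f = f"
  using idt_left[of f "Src C f" "Tgt C f"] by (simp add: hom_iff)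

lemma seqc_idt [simp]: "\<lbrakk>f \<in> Arr C; Tgt C f = A\<rbrakk> \<Longrightarrow> f \<Zsemi> \<one> A = f"
  using idt_right[of f "Src C f" "Tgt C f"] by (simp add: hom_iff)

lemma seqc_assoc' [simp]:
  "\<lbrakk>f \<in> Arr C; g \<in> Arr C; h \<in> Arr C; Tgt C f = Src C g; Tgt C g = Src C h\<rbrakk>
    \<Longrightarrow> (f \<Zsemi> g) \<Zsemi> h = f \<Zsemi> (g \<Zsemi> h)"
  by (rule seqc_assoc[of f "Src C f" "Src C g" g "Src C h" h "Tgt C h"]) (simp_all add: hom_iff)

lemma is_inverse_unique: "\<lbrakk>is_inverse C f g; is_inverse C f h\<rbrakk> \<Longrightarrow> g = h"
  unfolding is_inverse_def hom_iff by (metis idt_seqc seqc_assoc' seqc_idt)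

lemma is_inverse_inverse_arr: "iso C f \<Longrightarrow> is_inverse C f (inverse_arr C f)"
  unfolding iso_def inverse_arr_def by (metis is_inverse_unique theI)

lemma iso_simps:
  assumes "iso C f"
  shows "inverse_arr C f \<in> Arr C" "Src C (inverse_arr C f) = Tgt C f" "Tgt C (inverse_arr C f) = Src C f"
    "f \<Zsemi> inverse_arr C f = \<one> (Src C f)" "inverse_arr C f \<Zsemi> f = \<one> (Tgt C f)"
  using is_inverse_inverse_arr[OF assms] by (simp_all add: is_inverse_def hom_iff)

lemma iso_cancel:
  assumes "iso C f" "f \<in> Arr C"
  shows "\<lbrakk>h \<in> Arr C; Src C h = Tgt C f\<rbrakk> \<Longrightarrow> inverse_arr C f \<Zsemi> (f \<Zsemi> h) = h" (is "\<lbrakk>?a; ?b\<rbrakk> \<Longrightarrow> ?c")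
    and "\<lbrakk>h \<in> Arr C; Src C h = Src C f\<rbrakk> \<Longrightarrow> f \<Zsemi> (inverse_arr C f \<Zsemi> h) = h" (is "\<lbrakk>?a'; ?b'\<rbrakk> \<Longrightarrow> ?c'")
proof -
  note i = iso_simps[OF assms(1)] assms(2)
  show "?c" if ?a ?b
    using that i by (simp flip: seqc_assoc')
  show "?c'" if ?a' ?b'
    using that i by (simp flip: seqc_assoc')
qed

lemma iso_epi:
  assumes "iso C f" "f \<in> Arr C" "f \<Zsemi> g = f \<Zsemi> h" "g \<in> Arr C" "h \<in> Arr C"
    "Src C g = Tgt C f" "Src C h = Tgt C f"
  shows "g = h"
  using assms iso_cancel(1)[OF assms(1,2)] by metis

lemma inverse_natural:
  assumes "iso C a" "iso C b" "a \<in> Arr C" "b \<in> Arr C" "f \<in> Arr C" "g \<in> Arr C"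
    "Tgt C f = Src C b" "Tgt C a = Src C g" "Tgt C g = Tgt C b" "Src C f = Src C a"
    and eq: "f \<Zsemi> b = a \<Zsemi> g"
  shows "inverse_arr C a \<Zsemi> f = g \<Zsemi> inverse_arr C b"
proof -
  note i = iso_simps[OF assms(1)] iso_simps[OF assms(2)]
  have "inverse_arr C a \<Zsemi> f = inverse_arr C a \<Zsemi> (f \<Zsemi> b) \<Zsemi> inverse_arr C b"
    using i assms(3-10) by simp
  also have "\<dots> = g \<Zsemi> inverse_arr C b"
    unfolding eq using i assms(3-10) iso_cancel(1)[OF assms(1,3)] by simp
  finally show ?thesis .
qed

end

section \<open>Monoidal structure and coherence for the left unitor\<close>

context symmetric_monoidal_category
begin

declare tensor_obj [simp] unit_obj [simp]

lemma tensor_simps [simp]: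
  assumes "f \<in> Arr C" "g \<in> Arr C"
  shows "f \<odot> g \<in> Arr C" "Src C (f \<odot> g) = Src C f \<otimes> Src C g" "Tgt C (f \<odot> g) = Tgt C f \<otimes> Tgt C g"
  using tensor_hom[of f "Src C f" "Tgt C f" g "Src C g" "Tgt C g"] assms by (simp_all add: hom_iff)

lemma tensor_idt' [simp]: "\<lbrakk>A \<in> Obj C; B \<in> Obj C\<rbrakk> \<Longrightarrow> \<one> A \<odot> \<one> B = \<one> (A \<otimes> B)"
  by (rule tensor_idt)

lemma interchange [simp]:
  "\<lbrakk>f \<in> Arr C; g \<in> Arr C; f' \<in> Arr C; g' \<in> Arr C; Tgt C f = Src C g; Tgt C f' = Src C g'\<rbrakk>
    \<Longrightarrow> (f \<odot> f') \<Zsemi> (g \<odot> g') = (f \<Zsemi> g) \<odot> (f' \<Zsemi> g')"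
  by (rule tensor_seqc[symmetric]) (simp_all add: hom_iff)

text \<open>\<open>seqc_assoc'\<close> nests composites to the right, which hides two adjacent
  tensors from \<open>interchange\<close> unless they come last; this variant merges them in front
  of a remainder \<open>k\<close>.\<close>

lemma interchange' [simp]:
  "\<lbrakk>f \<in> Arr C; g \<in> Arr C; f' \<in> Arr C; g' \<in> Arr C; k \<in> Arr C; Tgt C f = Src C g; Tgt C f' = Src C g';
    Src C k = Tgt C g \<otimes> Tgt C g'\<rbrakk>
    \<Longrightarrow> (f \<odot> f') \<Zsemi> ((g \<odot> g') \<Zsemi> k) = ((f \<Zsemi> g) \<odot> (f' \<Zsemi> g')) \<Zsemi> k"
  by (simp flip: seqc_assoc')

lemma assoc_simps [simp]:
  assumes "A \<in> Obj C" "B \<in> Obj C" "D \<in> Obj C"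
  shows "assoc C A B D \<in> Arr C" "Src C (assoc C A B D) = (A \<otimes> B) \<otimes> D"
    "Tgt C (assoc C A B D) = A \<otimes> (B \<otimes> D)"
  using assoc_hom[OF assms] by (simp_all add: hom_iff)

lemma unitor_simps [simp]:
  assumes "A \<in> Obj C"
  shows "lunit C A \<in> Arr C" "Src C (lunit C A) = \<I> \<otimes> A" "Tgt C (lunit C A) = A"
    "runit C A \<in> Arr C" "Src C (runit C A) = A \<otimes> \<I>" "Tgt C (runit C A) = A"
  using lunit_hom[OF assms] runit_hom[OF assms] by (simp_all add: hom_iff)

lemma braid_simps [simp]:
  assumes "A \<in> Obj C" "B \<in> Obj C"
  shows "braid C A B \<in> Arr C" "Src C (braid C A B) = A \<otimes> B" "Tgt C (braid C A B) = B \<otimes> A"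
  using braid_hom[OF assms] by (simp_all add: hom_iff)

abbreviation assoc_inv where "assoc_inv A B D \<equiv> inverse_arr C (assoc C A B D)"
abbreviation lunit_inv where "lunit_inv A \<equiv> inverse_arr C (lunit C A)"

lemma assoc_inv_simps [simp]:
  assumes "A \<in> Obj C" "B \<in> Obj C" "D \<in> Obj C"
  shows "assoc_inv A B D \<in> Arr C" "Src C (assoc_inv A B D) = A \<otimes> (B \<otimes> D)"
    "Tgt C (assoc_inv A B D) = (A \<otimes> B) \<otimes> D"
    "assoc C A B D \<Zsemi> assoc_inv A B D = \<one> ((A \<otimes> B) \<otimes> D)"
    "assoc_inv A B D \<Zsemi> assoc C A B D = \<one> (A \<otimes> (B \<otimes> D))"
    "\<lbrakk>h \<in> Arr C; Src C h = A \<otimes> (B \<otimes> D)\<rbrakk> \<Longrightarrow> assoc_inv A B D \<Zsemi> (assoc C A B D \<Zsemi> h) = h"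
    "\<lbrakk>h \<in> Arr C; Src C h = (A \<otimes> B) \<otimes> D\<rbrakk> \<Longrightarrow> assoc C A B D \<Zsemi> (assoc_inv A B D \<Zsemi> h) = h"
  using iso_simps[OF assoc_iso[OF assms]] iso_cancel[OF assoc_iso[OF assms]] assms by simp_all

lemma lunit_inv_simps [simp]:
  assumes "A \<in> Obj C"
  shows "lunit_inv A \<in> Arr C" "Src C (lunit_inv A) = A" "Tgt C (lunit_inv A) = \<I> \<otimes> A"
    "lunit C A \<Zsemi> lunit_inv A = \<one> (\<I> \<otimes> A)" "lunit_inv A \<Zsemi> lunit C A = \<one> A"
    "\<lbrakk>h \<in> Arr C; Src C h = A\<rbrakk> \<Longrightarrow> lunit_inv A \<Zsemi> (lunit C A \<Zsemi> h) = h"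
    "\<lbrakk>h \<in> Arr C; Src C h = \<I> \<otimes> A\<rbrakk> \<Longrightarrow> lunit C A \<Zsemi> (lunit_inv A \<Zsemi> h) = h"
  using iso_simps[OF lunit_iso[OF assms]] iso_cancel[OF lunit_iso[OF assms]] assms by simp_all

lemma assoc_nat:
  "\<lbrakk>f \<in> Arr C; g \<in> Arr C; h \<in> Arr C; Tgt C f = A; Tgt C g = B; Tgt C h = D\<rbrakk>
    \<Longrightarrow> ((f \<odot> g) \<odot> h) \<Zsemi> assoc C A B D = assoc C (Src C f) (Src C g) (Src C h) \<Zsemi> (f \<odot> (g \<odot> h))"
  by (rule assoc_natural) (simp_all add: hom_iff)

lemma assoc_inv_nat:
  assumes "f \<in> Arr C" "g \<in> Arr C" "h \<in> Arr C" "Tgt C f = A" "Tgt C g = B" "Tgt C h = D"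
  shows "(f \<odot> (g \<odot> h)) \<Zsemi> assoc_inv A B D = assoc_inv (Src C f) (Src C g) (Src C h) \<Zsemi> ((f \<odot> g) \<odot> h)"
  using assms by (intro inverse_natural[symmetric] assoc_iso assoc_nat) auto

lemma lunit_nat: "\<lbrakk>f \<in> Arr C; Tgt C f = B\<rbrakk> \<Longrightarrow> (\<one> \<I> \<odot> f) \<Zsemi> lunit C B = lunit C (Src C f) \<Zsemi> f"
  by (rule lunit_natural) (simp add: hom_iff)

text \<open>Naturality of \<open>lunit\<close> turns \<open>\<one> \<I> \<odot> f\<close> into
  \<open>f\<close> up to isomorphisms that depend only on the two ends, and these cancel.\<close>

lemma unit_tensor_faithful:
  assumes "f \<in> Arr C" "g \<in> Arr C" "Src C f = Src C g" "Tgt C f = Tgt C g" "\<one> \<I> \<odot> f = \<one> \<I> \<odot> g"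
  shows "f = g"
proof (rule iso_epi[OF lunit_iso])
  show "lunit C (Src C g) \<Zsemi> f = lunit C (Src C g) \<Zsemi> g"
    using assms lunit_nat[of f "Tgt C g"] lunit_nat[of g "Tgt C g"] by simp
qed (use assms in simp_all)

lemma iso_tensor_idt:
  assumes "iso C f" "f \<in> Arr C" "A \<in> Obj C"
  shows "iso C (f \<odot> \<one> A)"
  unfolding iso_def is_inverse_def
  by (rule exI[of _ "inverse_arr C f \<odot> \<one> A"]) (simp add: assms iso_simps hom_iff)

text \<open>
  Kelly's argument: tensoring with the unit is faithful, and after tensoring the pentagon and the
  triangle apply.
\<close>

lemma assoc_lunit:
  assumes A: "A \<in> Obj C" and B: "B \<in> Obj C"
  shows "assoc C \<I> A B \<Zsemi> lunit C (A \<otimes> B) = lunit C A \<odot> \<one> B"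
proof (rule unit_tensor_faithful)
  have tri: "assoc C \<I> \<I> D \<Zsemi> (\<one> \<I> \<odot> lunit C D) = runit C \<I> \<odot> \<one> D" if "D \<in> Obj C" for D
    using triangle that by simp
  \<comment> \<open>The first two factors of the pentagon at \<open>\<I>\<close>,
    \<open>\<I>\<close>, \<open>A\<close>, \<open>B\<close>. Both are isomorphisms and are cancelled
    one after the other at the end.\<close>
  let ?p = "(assoc C \<I> \<I> A \<odot> \<one> B) \<Zsemi> assoc C \<I> (\<I> \<otimes> A) B"
  have "?p \<Zsemi> (\<one> \<I> \<odot> (assoc C \<I> A B \<Zsemi> lunit C (A \<otimes> B)))
      = ((assoc C \<I> \<I> A \<odot> \<one> B) \<Zsemi> assoc C \<I> (\<I> \<otimes> A) B \<Zsemi> (\<one> \<I> \<odot> assoc C \<I> A B))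
          \<Zsemi> (\<one> \<I> \<odot> lunit C (A \<otimes> B))"
    using A B by simp
  also have "\<dots> = assoc C (\<I> \<otimes> \<I>) A B \<Zsemi> (assoc C \<I> \<I> (A \<otimes> B) \<Zsemi> (\<one> \<I> \<odot> lunit C (A \<otimes> B)))"
    using A B by (subst pentagon) simp_all
  also have "\<dots> = assoc C (\<I> \<otimes> \<I>) A B \<Zsemi> (runit C \<I> \<odot> (\<one> A \<odot> \<one> B))"
    using A B tri[of "A \<otimes> B"] by simp
  also have "\<dots> = ((runit C \<I> \<odot> \<one> A) \<odot> \<one> B) \<Zsemi> assoc C \<I> A B"
    using A B assoc_nat[of "runit C \<I>" "\<one> A" "\<one> B" \<I> A B] by simp
  also have "\<dots> = (assoc C \<I> \<I> A \<odot> \<one> B) \<Zsemi> (((\<one> \<I> \<odot> lunit C A) \<odot> \<one> B) \<Zsemi> assoc C \<I> A B)"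
    using A B by (simp add: tri)
  also have "\<dots> = ?p \<Zsemi> (\<one> \<I> \<odot> (lunit C A \<odot> \<one> B))"
    using A B assoc_nat[of "\<one> \<I>" "lunit C A" "\<one> B" \<I> A B] by simp
  finally have *: "?p \<Zsemi> (\<one> \<I> \<odot> (assoc C \<I> A B \<Zsemi> lunit C (A \<otimes> B))) = ?p \<Zsemi> (\<one> \<I> \<odot> (lunit C A \<odot> \<one> B))" .
  have "assoc C \<I> (\<I> \<otimes> A) B \<Zsemi> (\<one> \<I> \<odot> (assoc C \<I> A B \<Zsemi> lunit C (A \<otimes> B)))
      = assoc C \<I> (\<I> \<otimes> A) B \<Zsemi> (\<one> \<I> \<odot> (lunit C A \<odot> \<one> B))"
    using A B * by - (rule iso_epi[of "assoc C \<I> \<I> A \<odot> \<one> B"]; simp add: iso_tensor_idt assoc_iso)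
  then show "\<one> \<I> \<odot> (assoc C \<I> A B \<Zsemi> lunit C (A \<otimes> B)) = \<one> \<I> \<odot> (lunit C A \<odot> \<one> B)"
    using A B by - (rule iso_epi[of "assoc C \<I> (\<I> \<otimes> A) B"]; simp add: assoc_iso)
qed (use A B in simp_all)

end

section \<open>Sliding relations\<close>

text \<open>\<open>prev\<close> doubles as the prefixing operation on sequences, with
  \<open>shift\<close> as the tail.\<close>

lemma prev_head_tail: "prev (M 0) (shift M) = M"
  by (auto simp: prev_def split: nat.split)

lemma shift_prev [simp]: "shift (prev z M) = M"
  by (auto simp: fun_eq_iff)

lemma act_obj_0 [simp]: "act_obj C M X 0 = M \<otimes>\<^bsub>C\<^esub> X 0"
  and act_obj_Suc [simp]: "act_obj C M X (Suc k) = X (Suc k)"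
  and act_arr_0 [simp]: "act_arr C r u 0 = r \<odot>\<^bsub>C\<^esub> u 0"
  and act_arr_Suc [simp]: "act_arr C r u (Suc k) = u (Suc k)"
  by (simp_all add: act_obj_def act_arr_def)

context symmetric_monoidal_category
begin

text \<open>
  Sequences are handled in a unit-free form: \<open>f 0\<close> starts at \<open>X 0\<close> instead of \<open>\<I> \<otimes> X 0\<close>. The tail
  of such a sequence over \<open>X\<close> is then literally a sequence over \<open>act_obj C (M 0) (shift X)\<close>.
\<close>

definition dm :: "(nat \<Rightarrow> 'o) \<Rightarrow> (nat \<Rightarrow> 'o) \<Rightarrow> nat \<Rightarrow> 'o" where
  "dm X M i = (case i of 0 \<Rightarrow> X 0 | Suc k \<Rightarrow> M k \<otimes> X (Suc k))"

text \<open>What a slide puts in front of component \<open>i\<close>. At index \<open>0\<close>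
  there is no memory input in the unit-free form; this replaces the convention that the arrow at
  index -1 is an identity.\<close>

definition pre :: "(nat \<Rightarrow> 'o) \<Rightarrow> (nat \<Rightarrow> 'a) \<Rightarrow> nat \<Rightarrow> 'a \<Rightarrow> 'a" where
  "pre X r i p = (case i of 0 \<Rightarrow> p | Suc k \<Rightarrow> (r k \<odot> \<one> (X (Suc k))) \<Zsemi> p)"

lemma dm_simps [simp]: "dm X M 0 = X 0" "dm X M (Suc k) = M k \<otimes> X (Suc k)"
  by (simp_all add: dm_def)

lemma pre_simps [simp]: "pre X r 0 p = p" "pre X r (Suc k) p = (r k \<odot> \<one> (X (Suc k))) \<Zsemi> p"
  by (simp_all add: pre_def)

text \<open>Values off \<open>J\<close> are left free. Truncation is thus a mere shrinking of
  \<open>J\<close>, without \<open>restrict\<close>, and one pair \<open>(M, f)\<close> represents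
  its own truncation at every stage.\<close>

definition seqs :: "nat set \<Rightarrow> (nat \<Rightarrow> 'o) \<Rightarrow> (nat \<Rightarrow> 'o) \<Rightarrow> ((nat \<Rightarrow> 'o) \<times> (nat \<Rightarrow> 'a)) set" where
  "seqs J X Y = {(M, f). \<forall>i\<in>J. M i \<in> Obj C \<and> f i \<in> hom C (dm X M i) (M i \<otimes> Y i)}"

text \<open>One generator of the coend: all \<open>r i\<close> move at once, from behind component
  \<open>i\<close> to the front of component \<open>i + 1\<close>. In between stands
  \<open>p\<close>, which reads memories from \<open>M\<close> and writes memories to
  \<open>N\<close>. If \<open>J\<close> has a last index, the arrow \<open>r\<close> there
  disappears.\<close>

definition slide :: "nat set \<Rightarrow> (nat \<Rightarrow> 'o) \<Rightarrow> (nat \<Rightarrow> 'o) \<Rightarrow>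
    (nat \<Rightarrow> 'o) \<times> (nat \<Rightarrow> 'a) \<Rightarrow> (nat \<Rightarrow> 'o) \<times> (nat \<Rightarrow> 'a) \<Rightarrow> bool" where
  "slide J X Y = (\<lambda>(M, f) (N, g). \<exists>r p. \<forall>i\<in>J. r i \<in> hom C (N i) (M i) \<and>
     p i \<in> hom C (dm X M i) (N i \<otimes> Y i) \<and> f i = p i \<Zsemi> (r i \<odot> \<one> (Y i)) \<and> g i = pre X r i (p i))"

abbreviation steq where "steq J X Y \<equiv> equivclp (slide J X Y)"

lemma slideI:
  assumes "\<And>i. i \<in> J \<Longrightarrow> r i \<in> hom C (N i) (M i)"
    and "\<And>i. i \<in> J \<Longrightarrow> p i \<in> hom C (dm X M i) (N i \<otimes> Y i)"
    and "\<And>i. i \<in> J \<Longrightarrow> f i = p i \<Zsemi> (r i \<odot> \<one> (Y i))"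
    and "\<And>i. i \<in> J \<Longrightarrow> g i = pre X r i (p i)"
  shows "slide J X Y (M, f) (N, g)"
  unfolding slide_def using assms by auto

lemma slideE:
  assumes "slide J X Y (M, f) (N, g)"
  obtains r p where "\<And>i. i \<in> J \<Longrightarrow> r i \<in> hom C (N i) (M i)"
    and "\<And>i. i \<in> J \<Longrightarrow> p i \<in> hom C (dm X M i) (N i \<otimes> Y i)"
    and "\<And>i. i \<in> J \<Longrightarrow> f i = p i \<Zsemi> (r i \<odot> \<one> (Y i))"
    and "\<And>i. i \<in> J \<Longrightarrow> g i = pre X r i (p i)"
  using assms unfolding slide_def by auto

lemma seqs_mono: "\<lbrakk>(M, f) \<in> seqs J X Y; K \<subseteq> J\<rbrakk> \<Longrightarrow> (M, f) \<in> seqs K X Y"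
  by (auto simp: seqs_def)

lemma seqsD:
  assumes "(M, f) \<in> seqs J X Y" "i \<in> J"
  shows "M i \<in> Obj C" "f i \<in> hom C (dm X M i) (M i \<otimes> Y i)"
  using assms by (auto simp: seqs_def)

lemma slide_mono: "\<lbrakk>slide J X Y a b; K \<subseteq> J\<rbrakk> \<Longrightarrow> slide K X Y a b"
  by (cases a; cases b) (simp add: slide_def subset_iff, metis)

lemma steq_mono: "\<lbrakk>steq J X Y a b; K \<subseteq> J\<rbrakk> \<Longrightarrow> steq K X Y a b"
  using equivclp_map[where F = id and R = "slide J X Y" and S = "slide K X Y"] slide_mono
  unfolding id_def by blast

lemma slide_seqs:
  assumes "slide J X Y (M, f) (N, g)" and Y: "\<And>i. Y i \<in> Obj C" and X: "\<And>i. X i \<in> Obj C"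
    and J: "\<And>i. Suc i \<in> J \<Longrightarrow> i \<in> J"
  shows "(M, f) \<in> seqs J X Y" "(N, g) \<in> seqs J X Y"
proof -
  from assms(1) obtain r p where r: "\<And>i. i \<in> J \<Longrightarrow> r i \<in> hom C (N i) (M i)"
    and p: "\<And>i. i \<in> J \<Longrightarrow> p i \<in> hom C (dm X M i) (N i \<otimes> Y i)"
    and f: "\<And>i. i \<in> J \<Longrightarrow> f i = p i \<Zsemi> (r i \<odot> \<one> (Y i))"
    and g: "\<And>i. i \<in> J \<Longrightarrow> g i = pre X r i (p i)"
    by (rule slideE) blast
  have o: "N i \<in> Obj C" "M i \<in> Obj C" if "i \<in> J" for i
    using r[OF that] hom_obj by auto
  show "(M, f) \<in> seqs J X Y"
    using o r p Y by (auto simp: seqs_def f hom_iff)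
  have "g i \<in> hom C (dm X N i) (N i \<otimes> Y i)" if "i \<in> J" for i
  proof (cases i)
    case 0
    then show ?thesis using p[OF that] g[OF that] by (simp add: hom_iff)
  next
    case (Suc k)
    then show ?thesis
      using p[OF that] g[OF that] r[of k] o[of k] X J[of k] that by (simp add: hom_iff)
  qed
  then show "(N, g) \<in> seqs J X Y" using o by (auto simp: seqs_def)
qed

text \<open>The slide along identities. Since nothing off \<open>J\<close> is compared, it also
  identifies sequences that merely agree on \<open>J\<close>.\<close>

lemma slide_refl:
  assumes "(M, f) \<in> seqs J X Y" and "\<And>i. Y i \<in> Obj C" "\<And>i. X i \<in> Obj C"
    and J: "\<And>i. Suc i \<in> J \<Longrightarrow> i \<in> J"
    and "\<And>i. i \<in> J \<Longrightarrow> N i = M i" "\<And>i. i \<in> J \<Longrightarrow> g i = f i"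
  shows "slide J X Y (M, f) (N, g)"
proof (rule slideI[where r = "\<lambda>i. \<one> (M i)" and p = f])
  fix i assume i: "i \<in> J"
  note f = seqsD[OF assms(1) i]
  show "\<one> (M i) \<in> hom C (N i) (M i)" using assms i f by (simp add: hom_iff)
  show "f i \<in> hom C (dm X M i) (N i \<otimes> Y i)" using assms i f by simp
  show "f i = f i \<Zsemi> (\<one> (M i) \<odot> \<one> (Y i))" using f assms by (simp add: hom_iff)
  show "g i = pre X (\<lambda>i. \<one> (M i)) i (f i)"
  proof (cases i)
    case 0
    then show ?thesis using assms i by simp
  next
    case (Suc k)
    then show ?thesis
      using seqsD[OF assms(1) J, of k] i f assms by (simp add: hom_iff)
  qed
qed

text \<open>The arrow chosen at the new index \<open>0\<close> is an identity, so the prefixed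
  \<open>f\<close> stays as it is. The sets \<open>J\<close> and \<open>K\<close> are kept general
  to cover both \<open>{..n}\<close> and \<open>{..<n}\<close>.\<close>

lemma slide_cons:
  assumes "slide J (act_obj C M (shift X)) (shift Y) (N, g) (N', g')"
    and f: "f \<in> hom C (X 0) (M \<otimes> Y 0)" and M: "M \<in> Obj C" and Y: "\<And>i. Y i \<in> Obj C"
    and X: "\<And>i. X i \<in> Obj C" and K: "\<And>i. Suc i \<in> K \<Longrightarrow> i \<in> J"
  shows "slide K X Y (prev M N, prev f g) (prev M N', prev f g')"
proof -
  from assms(1) obtain r p where r: "\<And>i. i \<in> J \<Longrightarrow> r i \<in> hom C (N' i) (N i)"
    and p: "\<And>i. i \<in> J \<Longrightarrow> p i \<in> hom C (dm (act_obj C M (shift X)) N i) (N' i \<otimes> shift Y i)"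
    and g: "\<And>i. i \<in> J \<Longrightarrow> g i = p i \<Zsemi> (r i \<odot> \<one> (shift Y i))"
    and g': "\<And>i. i \<in> J \<Longrightarrow> g' i = pre (act_obj C M (shift X)) r i (p i)"
    by (rule slideE) blast
  show ?thesis
  proof (rule slideI[where r = "prev (\<one> M) r" and p = "prev f p"])
    fix i assume i: "i \<in> K"
    show "prev (\<one> M) r i \<in> hom C (prev M N' i) (prev M N i)"
      using r K i M by (cases i) (auto simp: hom_iff)
    show "prev f p i \<in> hom C (dm X (prev M N) i) (prev M N' i \<otimes> Y i)"
      using p K i f
      by (cases i rule: nat.exhaust[case_product nat.exhaust[of "i - 1"]]) (auto simp: hom_iff dm_def split: nat.splits)
    show "prev f g i = prev f p i \<Zsemi> (prev (\<one> M) r i \<odot> \<one> (Y i))"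
      using g K i f M Y by (cases i) (auto simp: hom_iff)
    show "prev f g' i = pre X (prev (\<one> M) r) i (prev f p i)"
    proof (cases i)
      case (Suc j)
      then show ?thesis using g'[OF K, of j] p[OF K, of j] i M X
        by (cases j) (auto simp: hom_iff)
    qed simp
  qed
qed

lemma steq_cons:
  assumes "steq J (act_obj C M (shift X)) (shift Y) (N, g) (N', g')"
    and f: "f \<in> hom C (X 0) (M \<otimes> Y 0)" and M: "M \<in> Obj C" and Y: "\<And>i. Y i \<in> Obj C"
    and X: "\<And>i. X i \<in> Obj C" and K: "\<And>i. Suc i \<in> K \<Longrightarrow> i \<in> J"
  shows "steq K X Y (prev M N, prev f g) (prev M N', prev f g')"
proof -
  have "steq K X Y ((\<lambda>(N, g). (prev M N, prev f g)) (N, g)) ((\<lambda>(N, g). (prev M N, prev f g)) (N', g'))"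
    using assms(1) by (rule equivclp_map) (auto intro: slide_cons f M Y X K)
  then show ?thesis by simp
qed

text \<open>Only the arrow at index \<open>0\<close> is not an identity. This is the identification
  made by the coend over the first memory, seen on whole sequences.\<close>

lemma slide_head:
  assumes "(N, g) \<in> seqs J (act_obj C M' (shift X)) (shift Y)"
    and f: "f \<in> hom C (X 0) (M \<otimes> Y 0)" and s: "s \<in> hom C M M'" and Y: "\<And>i. Y i \<in> Obj C"
    and X: "\<And>i. X i \<in> Obj C" and J: "\<And>i. Suc i \<in> J \<Longrightarrow> i \<in> J" and K: "\<And>i. Suc i \<in> K \<Longrightarrow> i \<in> J"
  shows "slide K X Y (prev M' N, prev (f \<Zsemi> (s \<odot> \<one> (Y 0))) g)
    (prev M N, prev f (g(0 := (s \<odot> \<one> (X 1)) \<Zsemi> g 0)))"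
proof (rule slideI[where r = "prev s (\<lambda>i. \<one> (N i))" and p = "prev f g"])
  fix i assume i: "i \<in> K"
  have g: "N j \<in> Obj C" "g j \<in> hom C (dm (act_obj C M' (shift X)) N j) (N j \<otimes> Y (Suc j))" if "j \<in> J" for j
    using seqsD[OF assms(1) that] by auto
  show "prev s (\<lambda>i. \<one> (N i)) i \<in> hom C (prev M N i) (prev M' N i)"
    using s g i K by (cases i) (auto simp: hom_iff)
  show "prev f g i \<in> hom C (dm X (prev M' N) i) (prev M N i \<otimes> Y i)"
  proof (cases i)
    case (Suc j)
    then show ?thesis using g[OF K, of j] i by (cases j) (auto simp: hom_iff)
  qed (use f in simp)
  show "prev (f \<Zsemi> (s \<odot> \<one> (Y 0))) g i = prev f g i \<Zsemi> (prev s (\<lambda>i. \<one> (N i)) i \<odot> \<one> (Y i))"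
  proof (cases i)
    case (Suc j)
    then show ?thesis using g[OF K, of j] i Y by (cases j) (auto simp: hom_iff)
  qed simp
  show "prev f (g(0 := (s \<odot> \<one> (X 1)) \<Zsemi> g 0)) i = pre X (prev s (\<lambda>i. \<one> (N i))) i (prev f g i)"
  proof (cases i)
    case (Suc j)
    then show ?thesis
    proof (cases j)
      case (Suc k)
      then show ?thesis using g[OF K, of j] g(1)[OF J, of k] K[of "Suc k"] i \<open>i = Suc j\<close> X by (auto simp: hom_iff)
    qed simp
  qed simp
qed

lemma seqs_tail:
  assumes "(M, f) \<in> seqs K X Y" and "\<And>i. i \<in> J \<Longrightarrow> Suc i \<in> K"
  shows "(shift M, shift f) \<in> seqs J (act_obj C (M 0) (shift X)) (shift Y)"
  using assms unfolding seqs_def by (fastforce simp: dm_def split: nat.split)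

lemma seqs_prev:
  assumes "(N, g) \<in> seqs J (act_obj C M (shift X)) (shift Y)" "f \<in> hom C (X 0) (M \<otimes> Y 0)" "M \<in> Obj C"
    and "\<And>i. Suc i \<in> K \<Longrightarrow> i \<in> J"
  shows "(prev M N, prev f g) \<in> seqs K X Y"
proof -
  have "prev M N i \<in> Obj C \<and> prev f g i \<in> hom C (dm X (prev M N) i) (prev M N i \<otimes> Y i)" if "i \<in> K" for i
  proof (cases i)
    case (Suc j)
    then show ?thesis using seqsD[OF assms(1) assms(4), of j] that by (cases j) (auto simp: hom_iff)
  qed (use assms in simp)
  then show ?thesis by (simp add: seqs_def)
qed

lemma seqs_head_comp:
  assumes "(N, g) \<in> seqs J X Y" "s \<in> hom C A (X 0)" "\<And>i. Y i \<in> Obj C"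
  shows "(N, g(0 := s \<Zsemi> g 0)) \<in> seqs J (X(0 := A)) Y"
proof -
  have "(g(0 := s \<Zsemi> g 0)) i \<in> hom C (dm (X(0 := A)) N i) (N i \<otimes> Y i)" if "i \<in> J" for i
    using seqsD[OF assms(1) that] assms(2,3) by (cases i) (auto simp: hom_iff)
  then show ?thesis using assms by (auto simp: seqs_def)
qed

lemma act_obj_upd: "(act_obj C M X)(0 := M' \<otimes> X 0) = act_obj C M' X"
  by (auto simp: act_obj_def)

lemma seqs_head_slide:
  assumes "(N, g) \<in> seqs J (act_obj C M' (shift X)) (shift Y)" and s: "s \<in> hom C M M'"
    and Y: "\<And>i. Y i \<in> Obj C" and X: "\<And>i. X i \<in> Obj C"
  shows "(N, g(0 := (s \<odot> \<one> (X 1)) \<Zsemi> g 0)) \<in> seqs J (act_obj C M (shift X)) (shift Y)"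
  using seqs_head_comp[OF assms(1), of "s \<odot> \<one> (X 1)" "M \<otimes> X 1"] s X Y
    act_obj_upd[of M' "shift X" M] by (simp add: hom_iff)

text \<open>
  The \<open>r i\<close> are pushed to the right one at a time, and the last one is discarded. This is why
  the equivalence holds at every finite stage although the infinite sequences need not be
  equivalent as dinatural sequences.
\<close>

lemma steq_simulation:
  assumes "(M, f) \<in> seqs {..n} X Y" "(N, g) \<in> seqs {..n} X Y"
    and "\<And>i. i \<le> n \<Longrightarrow> r i \<in> hom C (N i) (M i)"
    and "g 0 \<Zsemi> (r 0 \<odot> \<one> (Y 0)) = f 0"
    and "\<And>i. i < n \<Longrightarrow> g (Suc i) \<Zsemi> (r (Suc i) \<odot> \<one> (Y (Suc i))) = (r i \<odot> \<one> (X (Suc i))) \<Zsemi> f (Suc i)"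
    and Y: "\<And>i. Y i \<in> Obj C" and X: "\<And>i. X i \<in> Obj C"
  shows "steq {..n} X Y (M, f) (N, g)"
  using assms
proof (induction n arbitrary: X Y M f N g r)
  case 0
  \<comment> \<open>\<open>r 0\<close> stands behind the last component, where the slide lets it
    vanish.\<close>
  have "slide {..0} X Y (M, f) (N, g)"
    by (rule slideI[where r = r and p = g]) (use 0 in \<open>auto simp: seqs_def\<close>)
  then show ?case by blast
next
  case (Suc n)
  \<comment> \<open>The tail of \<open>f\<close> after \<open>r 0\<close> has been slid out of
    component \<open>0\<close>. It now reads the memory \<open>N 0\<close>, like the tail of
    \<open>g\<close>, so the induction hypothesis applies with \<open>shift r\<close>.\<close>
  let ?t = "(shift f)(0 := (r 0 \<odot> \<one> (X 1)) \<Zsemi> f 1)"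
  have tail: "(shift M, shift f) \<in> seqs {..n} (act_obj C (M 0) (shift X)) (shift Y)"
    "(shift N, shift g) \<in> seqs {..n} (act_obj C (N 0) (shift X)) (shift Y)"
    by (rule seqs_tail[OF Suc.prems(1)], simp, rule seqs_tail[OF Suc.prems(2)], simp)
  have g0: "g 0 \<in> hom C (X 0) (N 0 \<otimes> Y 0)" "N 0 \<in> Obj C"
    using seqsD[OF Suc.prems(2), of 0] by simp_all
  have "slide {..Suc n} X Y (prev (M 0) (shift M), prev (g 0 \<Zsemi> (r 0 \<odot> \<one> (Y 0))) (shift f))
      (prev (N 0) (shift M), prev (g 0) ((shift f)(0 := (r 0 \<odot> \<one> (X 1)) \<Zsemi> shift f 0)))"
    by (rule slide_head[OF tail(1) g0(1)]) (use Suc.prems in auto)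
  then have 1: "slide {..Suc n} X Y (M, f) (prev (N 0) (shift M), prev (g 0) ?t)"
    by (simp add: Suc.prems(4) prev_head_tail)
  have wt: "(shift M, ?t) \<in> seqs {..n} (act_obj C (N 0) (shift X)) (shift Y)"
    using seqs_head_slide[OF tail(1) Suc.prems(3)] Suc.prems(6,7) by simp
  have "steq {..n} (act_obj C (N 0) (shift X)) (shift Y) (shift M, ?t) (shift N, shift g)"
  proof (rule Suc.IH[where r = "shift r"])
    show "act_obj C (N 0) (shift X) i \<in> Obj C" for i
      using Suc.prems(7) g0 by (cases i) auto
    show "shift g 0 \<Zsemi> (shift r 0 \<odot> \<one> (shift Y 0)) = ?t 0"
      using Suc.prems(5)[of 0] by simp
    show "shift g (Suc i) \<Zsemi> (shift r (Suc i) \<odot> \<one> (shift Y (Suc i)))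
        = (shift r i \<odot> \<one> (act_obj C (N 0) (shift X) (Suc i))) \<Zsemi> ?t (Suc i)" if "i < n" for i
      using Suc.prems(5)[of "Suc i"] that by simp
    show "(shift M, ?t) \<in> seqs {..n} (act_obj C (N 0) (shift X)) (shift Y)" by (rule wt)
    show "(shift N, shift g) \<in> seqs {..n} (act_obj C (N 0) (shift X)) (shift Y)" by (rule tail)
  qed (use Suc.prems in auto)
  then have "steq {..Suc n} X Y (prev (N 0) (shift M), prev (g 0) ?t) (prev (N 0) (shift N), prev (g 0) (shift g))"
    by (rule steq_cons) (use g0 Suc.prems in auto)
  then show ?case
    using 1 by (simp add: prev_head_tail) (blast intro: equivclp_trans)
qed

text \<open>The formula by which \<open>FAr (oSeq C)\<close> acts, in unit-free form;
  \<open>M\<close> enters only through the identities on the memory wires.\<close>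

definition act_seq :: "(nat \<Rightarrow> 'a) \<Rightarrow> (nat \<Rightarrow> 'a) \<Rightarrow> (nat \<Rightarrow> 'o) \<Rightarrow> (nat \<Rightarrow> 'a) \<Rightarrow> nat \<Rightarrow> 'a" where
  "act_seq u v M f = (\<lambda>i. (case i of 0 \<Rightarrow> u 0 | Suc k \<Rightarrow> \<one> (M k) \<odot> u (Suc k)) \<Zsemi> f i \<Zsemi> (\<one> (M i) \<odot> v i))"

lemma act_seq_simps:
  "act_seq u v M f 0 = u 0 \<Zsemi> f 0 \<Zsemi> (\<one> (M 0) \<odot> v 0)"
  "act_seq u v M f (Suc k) = (\<one> (M k) \<odot> u (Suc k)) \<Zsemi> f (Suc k) \<Zsemi> (\<one> (M (Suc k)) \<odot> v (Suc k))"
  by (simp_all add: act_seq_def)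

lemma act_seq_seqs:
  assumes "(M, f) \<in> seqs J X Y" and u: "\<And>i. u i \<in> hom C (X' i) (X i)" and v: "\<And>i. v i \<in> hom C (Y i) (Y' i)"
    and J: "\<And>i. Suc i \<in> J \<Longrightarrow> i \<in> J"
  shows "(M, act_seq u v M f) \<in> seqs J X' Y'"
proof -
  have "act_seq u v M f i \<in> hom C (dm X' M i) (M i \<otimes> Y' i)" if "i \<in> J" for i
    using seqsD[OF assms(1) that] u[of i] v[of i] seqsD(1)[OF assms(1) J, of "i - 1"] that
    by (cases i) (auto simp: act_seq_simps hom_iff)
  then show ?thesis using assms(1) by (auto simp: seqs_def)
qed

text \<open>\<open>r\<close> acts on the memory and \<open>u\<close>, \<open>v\<close> act on the
  visible wires, so the same \<open>r\<close> still slides.\<close>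

lemma slide_act_seq:
  assumes "slide J X Y (M, f) (N, g)"
    and u: "\<And>i. u i \<in> hom C (X' i) (X i)" and v: "\<And>i. v i \<in> hom C (Y i) (Y' i)"
    and J: "\<And>i. Suc i \<in> J \<Longrightarrow> i \<in> J"
  shows "slide J X' Y' (M, act_seq u v M f) (N, act_seq u v N g)"
proof -
  from assms(1) obtain r p where r: "\<And>i. i \<in> J \<Longrightarrow> r i \<in> hom C (N i) (M i)"
    and p: "\<And>i. i \<in> J \<Longrightarrow> p i \<in> hom C (dm X M i) (N i \<otimes> Y i)"
    and f: "\<And>i. i \<in> J \<Longrightarrow> f i = p i \<Zsemi> (r i \<odot> \<one> (Y i))"
    and g: "\<And>i. i \<in> J \<Longrightarrow> g i = pre X r i (p i)"
    by (rule slideE) blast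
  \<comment> \<open>\<open>p i\<close> reads from \<open>M\<close> at the preceding index and writes
    to \<open>N i\<close>, so the identities on its two sides belong to different sequences.\<close>
  let ?q = "\<lambda>i. (case i of 0 \<Rightarrow> u 0 | Suc k \<Rightarrow> \<one> (M k) \<odot> u (Suc k)) \<Zsemi> p i \<Zsemi> (\<one> (N i) \<odot> v i)"
  have o: "N i \<in> Obj C" "M i \<in> Obj C" if "i \<in> J" for i
    using r[OF that] hom_obj by auto
  have xy: "X i \<in> Obj C" "Y i \<in> Obj C" "X' i \<in> Obj C" "Y' i \<in> Obj C" for i
    using u[of i] v[of i] hom_obj by auto
  have uv: "u i \<in> Arr C" "Src C (u i) = X' i" "Tgt C (u i) = X i"
    "v i \<in> Arr C" "Src C (v i) = Y i" "Tgt C (v i) = Y' i" for i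
    using u[of i] v[of i] by (auto simp: hom_iff)
  show ?thesis
  proof (rule slideI[where r = r and p = ?q])
    fix i assume i: "i \<in> J"
    show "r i \<in> hom C (N i) (M i)" by (rule r[OF i])
    note pi = p[OF i, unfolded hom_iff] r[OF i, unfolded hom_iff] o[OF i] xy uv
    show "?q i \<in> hom C (dm X' M i) (N i \<otimes> Y' i)"
      using pi o(2)[OF J, of "i - 1"] i by (cases i) (auto simp: hom_iff)
    show "act_seq u v M f i = ?q i \<Zsemi> (r i \<odot> \<one> (Y' i))"
      using pi o(2)[OF J, of "i - 1"] i by (cases i) (auto simp: act_seq_simps f)
    show "act_seq u v N g i = pre X' r i (?q i)"
    proof (cases i)
      case (Suc k)
      then show ?thesis
        using pi o[OF J, of k] i r[OF J, of k] by (auto simp: act_seq_simps g hom_iff)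
    qed (use pi i in \<open>simp add: act_seq_simps g\<close>)
  qed
qed

lemma steq_act_seq:
  assumes "steq J X Y (M, f) (N, g)"
    and u: "\<And>i. u i \<in> hom C (X' i) (X i)" and v: "\<And>i. v i \<in> hom C (Y i) (Y' i)"
    and J: "\<And>i. Suc i \<in> J \<Longrightarrow> i \<in> J"
  shows "steq J X' Y' (M, act_seq u v M f) (N, act_seq u v N g)"
proof -
  let ?F = "\<lambda>(M, f). (M, act_seq u v M f)"
  have "steq J X' Y' (?F (M, f)) (?F (N, g))"
    using assms(1) by (rule equivclp_map) (auto intro!: r_into_equivclp slide_act_seq u v intro: J)
  then show ?thesis by simp
qed

text \<open>\<open>W\<close> is added on the left of the memory as an idle wire. The associators are
  there because \<open>W\<close> must be part of the memory on both sides for the result to be a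
  component of a sequence.\<close>

definition tens :: "'o \<Rightarrow> 'o \<Rightarrow> 'o \<Rightarrow> 'o \<Rightarrow> 'o \<Rightarrow> 'a \<Rightarrow> 'a" where
  "tens W A X B Y k = assoc C W A X \<Zsemi> (\<one> W \<odot> k) \<Zsemi> assoc_inv W B Y"

lemma tens_hom:
  assumes "k \<in> hom C (A \<otimes> X) (B \<otimes> Y)"
    and [simp]: "W \<in> Obj C" "A \<in> Obj C" "X \<in> Obj C" "B \<in> Obj C" "Y \<in> Obj C"
  shows "tens W A X B Y k \<in> hom C ((W \<otimes> A) \<otimes> X) ((W \<otimes> B) \<otimes> Y)"
  using assms(1) by (simp add: tens_def hom_iff)

lemma tens_nat:
  assumes "k \<in> hom C (A \<otimes> X) (B \<otimes> Y)" "r \<in> hom C W W'"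
    and [simp]: "A \<in> Obj C" "X \<in> Obj C" "B \<in> Obj C" "Y \<in> Obj C"
  shows "tens W A X B Y k \<Zsemi> ((r \<odot> \<one> B) \<odot> \<one> Y) = ((r \<odot> \<one> A) \<odot> \<one> X) \<Zsemi> tens W' A X B Y k"
proof -
  have [simp]: "k \<in> Arr C" "Src C k = A \<otimes> X" "Tgt C k = B \<otimes> Y" "r \<in> Arr C" "Src C r = W" "Tgt C r = W'"
    using assms(1,2) by (auto simp: hom_iff)
  have [simp]: "W \<in> Obj C" "W' \<in> Obj C" using assms(2) hom_obj by auto
  have "tens W A X B Y k \<Zsemi> ((r \<odot> \<one> B) \<odot> \<one> Y)
      = assoc C W A X \<Zsemi> ((\<one> W \<odot> k) \<Zsemi> (assoc_inv W B Y \<Zsemi> ((r \<odot> \<one> B) \<odot> \<one> Y)))"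
    by (simp add: tens_def)
  also have "assoc_inv W B Y \<Zsemi> ((r \<odot> \<one> B) \<odot> \<one> Y) = (r \<odot> (\<one> B \<odot> \<one> Y)) \<Zsemi> assoc_inv W' B Y"
    using assoc_inv_nat[of r "\<one> B" "\<one> Y" W' B Y] by simp
  also have "(\<one> W \<odot> k) \<Zsemi> ((r \<odot> (\<one> B \<odot> \<one> Y)) \<Zsemi> assoc_inv W' B Y)
      = (r \<odot> (\<one> A \<odot> \<one> X)) \<Zsemi> ((\<one> W' \<odot> k) \<Zsemi> assoc_inv W' B Y)"
    by simp
  also have "assoc C W A X \<Zsemi> \<dots> = (assoc C W A X \<Zsemi> (r \<odot> (\<one> A \<odot> \<one> X))) \<Zsemi> ((\<one> W' \<odot> k) \<Zsemi> assoc_inv W' B Y)"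
    by simp
  also have "assoc C W A X \<Zsemi> (r \<odot> (\<one> A \<odot> \<one> X)) = ((r \<odot> \<one> A) \<odot> \<one> X) \<Zsemi> assoc C W' A X"
    using assoc_nat[of r "\<one> A" "\<one> X" W' A X] by simp
  also have "(((r \<odot> \<one> A) \<odot> \<one> X) \<Zsemi> assoc C W' A X) \<Zsemi> ((\<one> W' \<odot> k) \<Zsemi> assoc_inv W' B Y)
      = ((r \<odot> \<one> A) \<odot> \<one> X) \<Zsemi> tens W' A X B Y k"
    by (simp add: tens_def)
  finally show ?thesis .
qed

lemma assoc_inv_lunit:
  assumes "A \<in> Obj C" "B \<in> Obj C"
  shows "assoc_inv \<I> A B \<Zsemi> (lunit C A \<odot> \<one> B) = lunit C (A \<otimes> B)"
  using assms by (simp flip: assoc_lunit)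

text \<open>For \<open>W = \<I>\<close> the idle wire is removed by \<open>lunit\<close>. That
  \<open>lunit\<close> on the memory alone agrees with \<open>lunit\<close> on memory and input
  together is \<open>assoc_lunit\<close>.\<close>

lemma tens_unit:
  assumes "k \<in> hom C (A \<otimes> X) (B \<otimes> Y)"
    and [simp]: "A \<in> Obj C" "X \<in> Obj C" "B \<in> Obj C" "Y \<in> Obj C"
  shows "tens \<I> A X B Y k \<Zsemi> (lunit C B \<odot> \<one> Y) = (lunit C A \<odot> \<one> X) \<Zsemi> k"
proof -
  have [simp]: "k \<in> Arr C" "Src C k = A \<otimes> X" "Tgt C k = B \<otimes> Y"
    using assms(1) by (auto simp: hom_iff)
  have "tens \<I> A X B Y k \<Zsemi> (lunit C B \<odot> \<one> Y)
      = assoc C \<I> A X \<Zsemi> ((\<one> \<I> \<odot> k) \<Zsemi> (assoc_inv \<I> B Y \<Zsemi> (lunit C B \<odot> \<one> Y)))"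
    by (simp add: tens_def)
  also have "\<dots> = (assoc C \<I> A X \<Zsemi> lunit C (A \<otimes> X)) \<Zsemi> k"
    using lunit_nat[of k "B \<otimes> Y"] by (simp add: assoc_inv_lunit)
  finally show ?thesis by (simp add: assoc_lunit)
qed

text \<open>The last argument is a representative \<open>(W, h)\<close> of an
  \<open>out_class\<close>, so that the map can be followed along chains of
  \<open>coend_step\<close>; \<open>h\<close> takes the place of component \<open>0\<close>.\<close>

definition tens_seq :: "(nat \<Rightarrow> 'o) \<Rightarrow> (nat \<Rightarrow> 'o) \<Rightarrow> (nat \<Rightarrow> 'o) \<Rightarrow> (nat \<Rightarrow> 'a) \<Rightarrow> 'o \<times> 'a \<Rightarrow>
    (nat \<Rightarrow> 'o) \<times> (nat \<Rightarrow> 'a)" where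
  "tens_seq X Y K k = (\<lambda>(W, h). (\<lambda>i. W \<otimes> K i, \<lambda>i. case i of 0 \<Rightarrow> h \<Zsemi> assoc_inv W (K 0) (Y 0)
     | Suc j \<Rightarrow> tens W (K j) (X (Suc j)) (K (Suc j)) (Y (Suc j)) (k (Suc j))))"

text \<open>
  A side output \<open>W\<close> of the first component can be carried along as an idle part of the memory, so
  an equality of classes in \<open>out_class\<close> extends to whole finite stages.
\<close>

lemma steq_replace_head:
  assumes wt: "(K, k(0 := a)) \<in> seqs {..n} X Y" and b: "b \<in> hom C (X 0) (K 0 \<otimes> Y 0)"
    and Y: "\<And>i. Y i \<in> Obj C" and X: "\<And>i. X i \<in> Obj C"
    and eq: "out_class C (X 0) (K 0 \<otimes> Y 0) \<I> (a \<Zsemi> lunit_inv (K 0 \<otimes> Y 0))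
      = out_class C (X 0) (K 0 \<otimes> Y 0) \<I> (b \<Zsemi> lunit_inv (K 0 \<otimes> Y 0))"
  shows "steq {..n} X Y (K, k(0 := a)) (K, k(0 := b))"
proof -
  let ?T = "tens_seq X Y K k"
  note [simp] = X Y
  have K [simp]: "K i \<in> Obj C" if "i \<le> n" for i
    using seqsD(1)[OF wt, of i] that by simp
  have k: "k (Suc i) \<in> hom C (K i \<otimes> X (Suc i)) (K (Suc i) \<otimes> Y (Suc i))" if "Suc i \<le> n" for i
    using seqsD(2)[OF wt, of "Suc i"] that by simp
  have a: "a \<in> hom C (X 0) (K 0 \<otimes> Y 0)" using seqsD(2)[OF wt, of 0] by simp
  have T_wt: "?T (W, h) \<in> seqs {..n} X Y" if "W \<in> Obj C" "h \<in> hom C (X 0) (W \<otimes> K 0 \<otimes> Y 0)" for W h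
  proof -
    have "snd (?T (W, h)) i \<in> hom C (dm X (fst (?T (W, h))) i) (fst (?T (W, h)) i \<otimes> Y i)" if "i \<le> n" for i
      using tens_hom[OF k, of "i - 1" W] that \<open>W \<in> Obj C\<close> \<open>h \<in> _\<close>
      by (cases i) (auto simp: tens_seq_def hom_iff)
    then show ?thesis using that by (auto simp: tens_seq_def seqs_def)
  qed
  have T_step: "steq {..n} X Y (?T c) (?T d)" if cd: "coend_step C (out_fun C (X 0) (K 0 \<otimes> Y 0)) c d" for c d
  proof -
    obtain W V r h where c: "c = (W, h \<Zsemi> (r \<odot> \<one> (K 0 \<otimes> Y 0)))"
      and d: "d = (V, h \<Zsemi> (\<one> V \<odot> \<one> (K 0 \<otimes> Y 0)))"
      and W [simp]: "W \<in> Obj C" and V [simp]: "V \<in> Obj C"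
      and r: "r \<in> hom C V W" and h: "h \<in> hom C (X 0) (V \<otimes> K 0 \<otimes> Y 0)"
      using cd by (auto simp: coend_step_def out_fun_def)
    have d': "d = (V, h)" using d h by (simp add: hom_iff)
    note rh [simp] = r[unfolded hom_iff] h[unfolded hom_iff]
    \<comment> \<open>The arrow \<open>r\<close> between the two side outputs acts on the idle wire
      at every index, and its last copy falls off the end of the stage.\<close>
    have "steq {..n} X Y (fst (?T c), snd (?T c)) (fst (?T d), snd (?T d))"
    proof (rule steq_simulation[where r = "\<lambda>i. r \<odot> \<one> (K i)"])
      show "(fst (?T c), snd (?T c)) \<in> seqs {..n} X Y" "(fst (?T d), snd (?T d)) \<in> seqs {..n} X Y"
        unfolding c d' prod.collapse by (rule T_wt; simp add: hom_iff)+
      show "r \<odot> \<one> (K i) \<in> hom C (fst (?T d) i) (fst (?T c) i)" if "i \<le> n" for i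
        using that by (simp add: tens_seq_def c d' hom_iff)
      show "snd (?T d) 0 \<Zsemi> ((r \<odot> \<one> (K 0)) \<odot> \<one> (Y 0)) = snd (?T c) 0"
        using assoc_inv_nat[of r "\<one> (K 0)" "\<one> (Y 0)" W "K 0" "Y 0"] by (simp add: tens_seq_def c d')
      show "snd (?T d) (Suc i) \<Zsemi> ((r \<odot> \<one> (K (Suc i))) \<odot> \<one> (Y (Suc i)))
          = ((r \<odot> \<one> (K i)) \<odot> \<one> (X (Suc i))) \<Zsemi> snd (?T c) (Suc i)" if "i < n" for i
        using tens_nat[OF k r, of i] that by (simp add: tens_seq_def c d')
    qed simp_all
    then show ?thesis by simp
  qed
  have T_unit: "steq {..n} X Y (K, k(0 := a')) (?T (\<I>, a' \<Zsemi> lunit_inv (K 0 \<otimes> Y 0)))"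
    if a': "a' \<in> hom C (X 0) (K 0 \<otimes> Y 0)" for a'
  proof -
    note [simp] = a'[unfolded hom_iff]
    let ?h = "a' \<Zsemi> lunit_inv (K 0 \<otimes> Y 0)"
    \<comment> \<open>With side output \<open>\<I>\<close>, the unitors strip the idle wire at all
      indices, which brings back the original sequence.\<close>
    have "steq {..n} X Y (K, k(0 := a')) (fst (?T (\<I>, ?h)), snd (?T (\<I>, ?h)))"
    proof (rule steq_simulation[where r = "\<lambda>i. lunit C (K i)"])
      show "(K, k(0 := a')) \<in> seqs {..n} X Y"
        using wt a' by (auto simp: seqs_def split: if_splits)
      show "(fst (?T (\<I>, ?h)), snd (?T (\<I>, ?h))) \<in> seqs {..n} X Y"
        unfolding prod.collapse by (rule T_wt; simp add: hom_iff)
      show "lunit C (K i) \<in> hom C (fst (?T (\<I>, ?h)) i) (K i)" if "i \<le> n" for i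
        using that by (simp add: tens_seq_def hom_iff)
      show "snd (?T (\<I>, ?h)) 0 \<Zsemi> (lunit C (K 0) \<odot> \<one> (Y 0)) = (k(0 := a')) 0"
        by (simp add: tens_seq_def assoc_inv_lunit)
      show "snd (?T (\<I>, ?h)) (Suc i) \<Zsemi> (lunit C (K (Suc i)) \<odot> \<one> (Y (Suc i)))
          = (lunit C (K i) \<odot> \<one> (X (Suc i))) \<Zsemi> (k(0 := a')) (Suc i)" if "i < n" for i
        using tens_unit[OF k, of i] that by (simp add: tens_seq_def)
    qed simp_all
    then show ?thesis by simp
  qed
  \<comment> \<open>The chain in the coend starts and ends at \<open>\<I>\<close> but may pass
    through arbitrary side outputs, which is why \<open>?T\<close> is set up for every
    \<open>W\<close>.\<close>
  have "steq {..n} X Y (?T (\<I>, a \<Zsemi> lunit_inv (K 0 \<otimes> Y 0))) (?T (\<I>, b \<Zsemi> lunit_inv (K 0 \<otimes> Y 0)))"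
    by (rule equivclp_map[OF _ T_step]) (use eq in \<open>simp add: out_class_def coend_class_eq_iff\<close>)
  then show ?thesis
    using T_unit[OF a] T_unit[OF b] by (meson equivclp_sym equivclp_trans)
qed

end

section \<open>The consequence of productivity\<close>

context symmetric_monoidal_category
begin

lemma swap_right_nat:
  assumes r: "r \<in> hom C N M" and [simp]: "Y \<in> Obj C" "A \<in> Obj C"
  shows "((r \<odot> \<one> Y) \<odot> \<one> A) \<Zsemi> swap_right C M Y A = swap_right C N Y A \<Zsemi> ((r \<odot> \<one> A) \<odot> \<one> Y)"
proof -
  have [simp]: "r \<in> Arr C" "Src C r = N" "Tgt C r = M" using r by (auto simp: hom_iff)
  have [simp]: "N \<in> Obj C" "M \<in> Obj C" using r hom_obj by auto
  have "((r \<odot> \<one> Y) \<odot> \<one> A) \<Zsemi> swap_right C M Y A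
      = (((r \<odot> \<one> Y) \<odot> \<one> A) \<Zsemi> assoc C M Y A) \<Zsemi> ((\<one> M \<odot> braid C Y A) \<Zsemi> assoc_inv M A Y)"
    by (simp add: swap_right_def)
  also have "\<dots> = assoc C N Y A \<Zsemi> ((r \<odot> braid C Y A) \<Zsemi> assoc_inv M A Y)"
    using assoc_nat[of r "\<one> Y" "\<one> A" M Y A] by simp
  also have "\<dots> = assoc C N Y A \<Zsemi> ((\<one> N \<odot> braid C Y A) \<Zsemi> ((r \<odot> (\<one> A \<odot> \<one> Y)) \<Zsemi> assoc_inv M A Y))"
    by simp
  also have "(r \<odot> (\<one> A \<odot> \<one> Y)) \<Zsemi> assoc_inv M A Y = assoc_inv N A Y \<Zsemi> ((r \<odot> \<one> A) \<odot> \<one> Y)"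
    using assoc_inv_nat[of r "\<one> A" "\<one> Y" M A Y] by simp
  also have "assoc C N Y A \<Zsemi> ((\<one> N \<odot> braid C Y A) \<Zsemi> \<dots>) = swap_right C N Y A \<Zsemi> ((r \<odot> \<one> A) \<odot> \<one> Y)"
    by (simp add: swap_right_def)
  finally show ?thesis .
qed

lemma swap_right_hom:
  "\<lbrakk>M \<in> Obj C; Y \<in> Obj C; A \<in> Obj C\<rbrakk> \<Longrightarrow> swap_right C M Y A \<in> hom C ((M \<otimes> Y) \<otimes> A) ((M \<otimes> A) \<otimes> Y)"
  by (simp add: swap_right_def hom_iff)

text \<open>An equality of arrows and not only of classes. For the two ends of a single slide it
  supplies the premise of the cancellation property in \<open>terminating\<close>.\<close>

lemma followed_by_slide:
  assumes r: "r \<in> hom C N M" and b: "b \<in> hom C X (N \<otimes> Y)" and v: "v \<in> hom C (M \<otimes> A) (U \<otimes> B)"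
    and [simp]: "Y \<in> Obj C" "A \<in> Obj C" "U \<in> Obj C" "B \<in> Obj C"
  shows "followed_by C M Y A U B (b \<Zsemi> (r \<odot> \<one> Y)) v = followed_by C N Y A U B b ((r \<odot> \<one> A) \<Zsemi> v)"
proof -
  note [simp] = r[unfolded hom_iff] b[unfolded hom_iff] v[unfolded hom_iff]
  have [simp]: "N \<in> Obj C" "M \<in> Obj C" using r hom_obj by auto
  note [simp] = swap_right_hom[of N Y A, unfolded hom_iff, simplified]
    swap_right_hom[of M Y A, unfolded hom_iff, simplified]
  have "followed_by C M Y A U B (b \<Zsemi> (r \<odot> \<one> Y)) v
      = (b \<odot> \<one> A) \<Zsemi> ((((r \<odot> \<one> Y) \<odot> \<one> A) \<Zsemi> swap_right C M Y A) \<Zsemi> ((v \<odot> \<one> Y) \<Zsemi> assoc C U B Y))"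
    by (simp add: followed_by_def)
  also have "\<dots> = followed_by C N Y A U B b ((r \<odot> \<one> A) \<Zsemi> v)"
    by (subst swap_right_nat[OF r]) (simp_all add: followed_by_def)
  finally show ?thesis .
qed

text \<open>The body of \<open>terminating\<close> with its witnesses as parameters: the same
  witnesses have to serve at all stages, so they are fixed before any \<open>n\<close>.\<close>

definition factors_through :: "'o \<Rightarrow> 'o \<Rightarrow> ('o \<times> 'a) set \<Rightarrow> 'o \<Rightarrow> 'a \<Rightarrow> ('o \<Rightarrow> 'a \<Rightarrow> 'a) \<Rightarrow> bool" where
  "factors_through X Y \<alpha> P a0 s \<longleftrightarrow> P \<in> Obj C \<and> a0 \<in> hom C X (P \<otimes> Y) \<and>
     (\<forall>(M, a)\<in>\<alpha>. s M a \<in> hom C P M \<and> a = a0 \<Zsemi> (s M a \<odot> \<one> Y)) \<and>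
     (\<forall>(M, a)\<in>\<alpha>. \<forall>(N, b)\<in>\<alpha>. \<forall>A\<in>Obj C. \<forall>B\<in>Obj C. \<forall>U\<in>Obj C. \<forall>V\<in>Obj C.
       \<forall>u\<in>hom C (M \<otimes> A) (U \<otimes> B). \<forall>v\<in>hom C (N \<otimes> A) (V \<otimes> B).
         out_class C (X \<otimes> A) (B \<otimes> Y) U (followed_by C M Y A U B a u) =
         out_class C (X \<otimes> A) (B \<otimes> Y) V (followed_by C N Y A V B b v) \<longrightarrow>
         out_class C (P \<otimes> A) B U ((s M a \<odot> \<one> A) \<Zsemi> u) = out_class C (P \<otimes> A) B V ((s N b \<odot> \<one> A) \<Zsemi> v))"

lemma terminating_iff: "terminating C X Y \<alpha> \<longleftrightarrow> (\<exists>P a0 s. factors_through X Y \<alpha> P a0 s)"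
  unfolding terminating_def factors_through_def Bex_def by blast

lemma factors_throughD:
  assumes "factors_through X Y \<alpha> P a0 s"
  shows "P \<in> Obj C" "a0 \<in> hom C X (P \<otimes> Y)"
    and "(M, a) \<in> \<alpha> \<Longrightarrow> s M a \<in> hom C P M" "(M, a) \<in> \<alpha> \<Longrightarrow> a = a0 \<Zsemi> (s M a \<odot> \<one> Y)"
    and "\<lbrakk>(M, a) \<in> \<alpha>; (N, b) \<in> \<alpha>; A \<in> Obj C; B \<in> Obj C; U \<in> Obj C; V \<in> Obj C;
      u \<in> hom C (M \<otimes> A) (U \<otimes> B); v \<in> hom C (N \<otimes> A) (V \<otimes> B);
      out_class C (X \<otimes> A) (B \<otimes> Y) U (followed_by C M Y A U B a u) =
      out_class C (X \<otimes> A) (B \<otimes> Y) V (followed_by C N Y A V B b v)\<rbrakk>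
    \<Longrightarrow> out_class C (P \<otimes> A) B U ((s M a \<odot> \<one> A) \<Zsemi> u) = out_class C (P \<otimes> A) B V ((s N b \<odot> \<one> A) \<Zsemi> v)"
proof -
  show "P \<in> Obj C" "a0 \<in> hom C X (P \<otimes> Y)"
    and "(M, a) \<in> \<alpha> \<Longrightarrow> s M a \<in> hom C P M" "(M, a) \<in> \<alpha> \<Longrightarrow> a = a0 \<Zsemi> (s M a \<odot> \<one> Y)"
    using assms unfolding factors_through_def by blast+
  note cancel = conjunct2[OF conjunct2[OF conjunct2[OF assms[unfolded factors_through_def]]]]
  show "out_class C (P \<otimes> A) B U ((s M a \<odot> \<one> A) \<Zsemi> u) = out_class C (P \<otimes> A) B V ((s N b \<odot> \<one> A) \<Zsemi> v)"
    if "(M, a) \<in> \<alpha>" "(N, b) \<in> \<alpha>" "A \<in> Obj C" "B \<in> Obj C" "U \<in> Obj C" "V \<in> Obj C"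
      "u \<in> hom C (M \<otimes> A) (U \<otimes> B)" "v \<in> hom C (N \<otimes> A) (V \<otimes> B)"
      "out_class C (X \<otimes> A) (B \<otimes> Y) U (followed_by C M Y A U B a u) =
       out_class C (X \<otimes> A) (B \<otimes> Y) V (followed_by C N Y A V B b v)"
    by (rule cancel[THEN bspec, OF that(1), unfolded prod.case, THEN bspec, OF that(2), unfolded prod.case,
      THEN bspec, OF that(3), THEN bspec, OF that(4), THEN bspec, OF that(5), THEN bspec, OF that(6),
      THEN bspec, OF that(7), THEN bspec, OF that(8), THEN mp, OF that(9)])
qed

text \<open>The effect of \<open>slide_act\<close> on unit-free representatives, as
  \<open>slide_act_oelt\<close> confirms.\<close>

definition head_act :: "(nat \<Rightarrow> 'o) \<Rightarrow> 'a \<Rightarrow> (nat \<Rightarrow> 'a) \<Rightarrow> nat \<Rightarrow> 'a" where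
  "head_act X s g = g(0 := (s \<odot> \<one> (X 1)) \<Zsemi> g 0)"

text \<open>Read at index \<open>0\<close> alone, a slide is a generator of the coend over the first
  memory. Hence the class of the first component is constant along a chain.\<close>

lemma slide_out_step:
  assumes "slide J X Y (M, f) (N, g)" "0 \<in> J" and "\<And>i. Y i \<in> Obj C"
  shows "coend_step C (out_fun C (X 0) (Y 0)) (M 0, f 0) (N 0, g 0)"
proof -
  from assms(1) obtain r p where r: "\<And>i. i \<in> J \<Longrightarrow> r i \<in> hom C (N i) (M i)"
    and p: "\<And>i. i \<in> J \<Longrightarrow> p i \<in> hom C (dm X M i) (N i \<otimes> Y i)"
    and f: "\<And>i. i \<in> J \<Longrightarrow> f i = p i \<Zsemi> (r i \<odot> \<one> (Y i))"
    and g: "\<And>i. i \<in> J \<Longrightarrow> g i = pre X r i (p i)"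
    by (rule slideE) blast
  note r = r[OF assms(2)] and p = p[OF assms(2)] and f = f[OF assms(2)] and g = g[OF assms(2)]
  have "N 0 \<in> Obj C" "M 0 \<in> Obj C" using r hom_obj by auto
  then show ?thesis
    unfolding coend_step_def using r p f g assms(3)
    by (intro exI[of _ "M 0"] exI[of _ "N 0"] exI[of _ "r 0"] exI[of _ "p 0"])
       (simp add: out_fun_def hom_iff)
qed

text \<open>
  For a slide \<open>r, p\<close> the two factorisations \<open>s M\<close> and \<open>s N \<Zsemi> r 0\<close> of the head may differ, but
  productivity makes them indistinguishable in front of \<open>p 1\<close>.
\<close>

lemma steq_tail_slide:
  assumes ft: "factors_through (X 0) (Y 0) \<alpha> P a0 s" and sl: "slide {..Suc n} X Y (M, f) (N, g)"
    and M: "(M 0, f 0) \<in> \<alpha>" and N: "(N 0, g 0) \<in> \<alpha>"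
    and X: "\<And>i. X i \<in> Obj C" and Y: "\<And>i. Y i \<in> Obj C"
  shows "steq {..n} (act_obj C P (shift X)) (shift Y)
    (shift M, head_act X (s (M 0) (f 0)) (shift f)) (shift N, head_act X (s (N 0) (g 0)) (shift g))"
    (is "steq _ ?X ?Y ?a ?b")
proof -
  note [simp] = X Y
  from sl obtain r p where r: "\<And>i. i \<in> {..Suc n} \<Longrightarrow> r i \<in> hom C (N i) (M i)"
    and p: "\<And>i. i \<in> {..Suc n} \<Longrightarrow> p i \<in> hom C (dm X M i) (N i \<otimes> Y i)"
    and f: "\<And>i. i \<in> {..Suc n} \<Longrightarrow> f i = p i \<Zsemi> (r i \<odot> \<one> (Y i))"
    and g: "\<And>i. i \<in> {..Suc n} \<Longrightarrow> g i = pre X r i (p i)"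
    by (rule slideE) blast
  note r = r[unfolded atMost_iff] and p = p[unfolded atMost_iff]
    and f = f[unfolded atMost_iff] and g = g[unfolded atMost_iff]
  let ?sM = "s (M 0) (f 0)" and ?sN = "s (N 0) (g 0)"
  have sM: "?sM \<in> hom C P (M 0)" and sN: "?sN \<in> hom C P (N 0)"
    using factors_throughD(3)[OF ft] M N by auto
  have P [simp]: "P \<in> Obj C" and "M 0 \<in> Obj C" and "N 0 \<in> Obj C" and N1: "N (Suc 0) \<in> Obj C" "M (Suc 0) \<in> Obj C"
    using hom_obj[OF sM] hom_obj[OF sN] hom_obj[OF r[of 1]] by auto
  note [simp] = sM[unfolded hom_iff] sN[unfolded hom_iff] r[of 0, simplified, unfolded hom_iff]
    r[of 1, simplified, unfolded hom_iff] \<open>M 0 \<in> Obj C\<close> \<open>N 0 \<in> Obj C\<close> N1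
    p[of 0, simplified, unfolded hom_iff] p[of 1, simplified, unfolded hom_iff]
  \<comment> \<open>Along the slide, \<open>f 1 = p 1 \<Zsemi> (r 1 \<odot> \<one> (Y 1))\<close>
    and \<open>g 1 = (r 0 \<odot> \<one> (X 1)) \<Zsemi> p 1\<close>. Sliding only the arrows
    \<open>r\<close> from index \<open>1\<close> on turns the head of the first tail into
    \<open>c\<close>, while the head of the second is \<open>d\<close>; what remains is to exchange
    \<open>c\<close> for \<open>d\<close>.\<close>
  define c where "c = (?sM \<odot> \<one> (X 1)) \<Zsemi> p 1"
  define d where "d = (?sN \<odot> \<one> (X 1)) \<Zsemi> ((r 0 \<odot> \<one> (X 1)) \<Zsemi> p 1)"
  have X0 [simp]: "?X i \<in> Obj C" for i by (cases i) auto
  have sl': "slide {..n} ?X ?Y ?a (shift N, (shift g)(0 := c))"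
  proof (rule slideI[where r = "shift r" and p = "(shift p)(0 := c)"])
    fix i assume "i \<in> {..n}"
    then have i: "Suc i \<le> Suc n" by simp
    show "shift r i \<in> hom C (shift N i) (shift M i)" using r[OF i] by simp
    show "((shift p)(0 := c)) i \<in> hom C (dm ?X (shift M) i) (shift N i \<otimes> ?Y i)"
      using p[OF i] by (cases i) (auto simp: c_def hom_iff)
    show "head_act X ?sM (shift f) i = ((shift p)(0 := c)) i \<Zsemi> (shift r i \<odot> \<one> (?Y i))"
      using f[OF i] by (cases i) (auto simp: c_def head_act_def)
    show "((shift g)(0 := c)) i = pre ?X (shift r) i (((shift p)(0 := c)) i)"
      using g[OF i] by (cases i) auto
  qed
  have "steq {..n} ?X ?Y (shift N, (shift g)(0 := c)) (shift N, (shift g)(0 := d))"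
  proof (rule steq_replace_head)
    show "(shift N, (shift g)(0 := c)) \<in> seqs {..n} ?X ?Y"
      by (rule slide_seqs(2)[OF sl']) auto
    show "d \<in> hom C (?X 0) (shift N 0 \<otimes> shift Y 0)" by (simp add: d_def hom_iff)
    \<comment> \<open>Cancellation is applied with \<open>B = N 1 \<otimes> Y 1\<close> and side
      output \<open>\<I>\<close>: the memory written by \<open>p 1\<close> is declared visible,
      because the later components still read it and the quotient must not touch it.\<close>
    let ?u = "p 1 \<Zsemi> lunit_inv (N 1 \<otimes> Y 1)"
    have "out_class C (P \<otimes> X 1) (N 1 \<otimes> Y 1) \<I> ((?sM \<odot> \<one> (X 1)) \<Zsemi> ?u)
        = out_class C (P \<otimes> X 1) (N 1 \<otimes> Y 1) \<I> ((?sN \<odot> \<one> (X 1)) \<Zsemi> ((r 0 \<odot> \<one> (X 1)) \<Zsemi> ?u))"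
    proof (rule factors_throughD(5)[OF ft M N])
      have "f 0 = g 0 \<Zsemi> (r 0 \<odot> \<one> (Y 0))" using f[of 0] g[of 0] by simp
      then have "followed_by C (M 0) (Y 0) (X 1) \<I> (N 1 \<otimes> Y 1) (f 0) ?u
          = followed_by C (N 0) (Y 0) (X 1) \<I> (N 1 \<otimes> Y 1) (g 0) ((r 0 \<odot> \<one> (X 1)) \<Zsemi> ?u)"
        using g[of 0] by (simp only:) (rule followed_by_slide; simp add: hom_iff)
      then show "out_class C (X 0 \<otimes> X 1) ((N 1 \<otimes> Y 1) \<otimes> Y 0) \<I>
          (followed_by C (M 0) (Y 0) (X 1) \<I> (N 1 \<otimes> Y 1) (f 0) ?u)
        = out_class C (X 0 \<otimes> X 1) ((N 1 \<otimes> Y 1) \<otimes> Y 0) \<I>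
          (followed_by C (N 0) (Y 0) (X 1) \<I> (N 1 \<otimes> Y 1) (g 0) ((r 0 \<odot> \<one> (X 1)) \<Zsemi> ?u))"
        by simp
    qed (simp_all add: hom_iff)
    then show "out_class C (?X 0) (shift N 0 \<otimes> shift Y 0) \<I> (c \<Zsemi> lunit_inv (shift N 0 \<otimes> shift Y 0))
        = out_class C (?X 0) (shift N 0 \<otimes> shift Y 0) \<I> (d \<Zsemi> lunit_inv (shift N 0 \<otimes> shift Y 0))"
      by (simp add: c_def d_def)
  qed simp_all
  from equivclp_trans[OF r_into_equivclp[where r = "slide {..n} ?X ?Y", OF sl'] this]
  have "steq {..n} ?X ?Y ?a (shift N, (shift g)(0 := d))" .
  also have "(shift g)(0 := d) = head_act X ?sN (shift g)"
    using g[of 1] by (simp add: head_act_def d_def)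
  finally show ?thesis .
qed

text \<open>The passage to tails is applied along a whole chain. It uses \<open>s\<close>, which is
  controlled only on \<alpha>, so each intermediate first component is shown to lie in \<alpha> as
  well.\<close>

lemma steq_tail:
  assumes ft: "factors_through (X 0) (Y 0) \<alpha> P a0 s" and eq: "steq {..Suc n} X Y (M, f) (N, g)"
    and \<alpha>: "\<alpha> = coend_class C (out_fun C (X 0) (Y 0)) M' a'" and M: "(M 0, f 0) \<in> \<alpha>"
    and X: "\<And>i. X i \<in> Obj C" and Y: "\<And>i. Y i \<in> Obj C"
  shows "(N 0, g 0) \<in> \<alpha> \<and> steq {..n} (act_obj C P (shift X)) (shift Y)
    (shift M, head_act X (s (M 0) (f 0)) (shift f)) (shift N, head_act X (s (N 0) (g 0)) (shift g))"
proof -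
  let ?F = "\<lambda>(M, f). (shift M, head_act X (s (M 0) (f 0)) (shift f))"
  let ?A = "{(M, f). (M 0, f 0) \<in> \<alpha>}"
  have "(N, g) \<in> ?A \<and> steq {..n} (act_obj C P (shift X)) (shift Y) (?F (M, f)) (?F (N, g))"
    using eq
  proof (rule equivclp_map_on)
    show "(M, f) \<in> ?A" using M by simp
    show "a \<in> ?A \<longleftrightarrow> b \<in> ?A" if "slide {..Suc n} X Y a b" for a b
    proof -
      have "coend_step C (out_fun C (X 0) (Y 0)) (fst a 0, snd a 0) (fst b 0, snd b 0)"
        using slide_out_step[of "{..Suc n}" X Y "fst a" "snd a" "fst b" "snd b"] that Y by simp
      then show ?thesis
        unfolding \<alpha> case_prod_unfold mem_Collect_eq mem_coend_class_iff
        by (meson equivclp_sym equivclp_trans r_into_equivclp)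
    qed
    show "steq {..n} (act_obj C P (shift X)) (shift Y) (?F a) (?F b)"
      if "slide {..Suc n} X Y a b" "a \<in> ?A" "b \<in> ?A" for a b
      using steq_tail_slide[where n = n and X = X and Y = Y and M = "fst a" and f = "snd a" and N = "fst b"
          and g = "snd b", OF ft] that X Y by (simp add: case_prod_unfold)
  qed
  then show ?thesis by simp
qed

end

section \<open>Observational sequences as unit-free sequences\<close>

lemma seq_cat_simps [simp]:
  "Obj (seq_cat C) = {X. \<forall>i. X i \<in> Obj C}" "Arr (seq_cat C) = {f. \<forall>i. f i \<in> Arr C}"
  "Src (seq_cat C) u = (\<lambda>i. Src C (u i))" "Tgt (seq_cat C) u = (\<lambda>i. Tgt C (u i))"
  "\<one>\<^bsub>seq_cat C\<^esub> X = (\<lambda>i. \<one>\<^bsub>C\<^esub> (X i))" "u \<Zsemi>\<^bsub>seq_cat C\<^esub> v = (\<lambda>i. u i \<Zsemi>\<^bsub>C\<^esub> v i)"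
  by (auto simp: pow_cat_def PiE_def)

lemma hom_pow_cat_iff: "f \<in> hom (pow_cat C J) A B \<longleftrightarrow> f \<in> extensional J \<and> A \<in> extensional J \<and>
    B \<in> extensional J \<and> (\<forall>i\<in>J. f i \<in> hom C (A i) (B i))"
  by (auto simp: pow_cat_def hom_def PiE_def Pi_def restrict_def extensional_def fun_eq_iff)

context symmetric_monoidal_category
begin

text \<open>Translation to the form of the official definitions, where component \<open>0\<close>
  starts at \<open>\<I> \<otimes> X 0\<close>.\<close>

definition pad :: "(nat \<Rightarrow> 'o) \<Rightarrow> (nat \<Rightarrow> 'a) \<Rightarrow> nat \<Rightarrow> 'a" where
  "pad X f = f(0 := lunit C (X 0) \<Zsemi> f 0)"

definition unpad :: "(nat \<Rightarrow> 'o) \<Rightarrow> (nat \<Rightarrow> 'a) \<Rightarrow> nat \<Rightarrow> 'a" where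
  "unpad X f = f(0 := lunit_inv (X 0) \<Zsemi> f 0)"

lemma pad_simps [simp]: "pad X f 0 = lunit C (X 0) \<Zsemi> f 0" "pad X f (Suc k) = f (Suc k)"
  and unpad_simps [simp]: "unpad X f 0 = lunit_inv (X 0) \<Zsemi> f 0" "unpad X f (Suc k) = f (Suc k)"
  by (simp_all add: pad_def unpad_def)

lemma pad_unpad: "\<lbrakk>f 0 \<in> Arr C; Src C (f 0) = \<I> \<otimes> X 0; X 0 \<in> Obj C\<rbrakk> \<Longrightarrow> pad X (unpad X f) = f"
  by (auto simp: pad_def unpad_def)

lemma unpad_pad: "\<lbrakk>f 0 \<in> Arr C; Src C (f 0) = X 0; X 0 \<in> Obj C\<rbrakk> \<Longrightarrow> unpad X (pad X f) = f"
  by (auto simp: pad_def unpad_def)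

text \<open>The last two conclusions say that both ends are paddings of unit-free sequences;
  \<open>mem_dSeq_class\<close> uses this to recover such a sequence from an arbitrary member of a
  class.\<close>

lemma coend_step_slide:
  assumes st: "coend_step (pow_cat C J) (seq_integrand C J X Y) (M, f) (N, g)"
    and J0: "0 \<in> J" and J: "\<And>i. Suc i \<in> J \<Longrightarrow> i \<in> J"
    and X [simp]: "\<And>i. X i \<in> Obj C" and Y [simp]: "\<And>i. Y i \<in> Obj C"
  shows "slide J X Y (M, unpad X f) (N, unpad X g)" "pad X (unpad X f) = f" "pad X (unpad X g) = g"
proof -
  obtain r x where MN: "M \<in> Obj (pow_cat C J)" "N \<in> Obj (pow_cat C J)"
    and r': "r \<in> hom (pow_cat C J) N M" and x': "x \<in> FOb (seq_integrand C J X Y) (M, N)"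
    and f': "f = FAr (seq_integrand C J X Y) (\<one>\<^bsub>pow_cat C J\<^esub> M, r) x"
    and g': "g = FAr (seq_integrand C J X Y) (r, \<one>\<^bsub>pow_cat C J\<^esub> N) x"
    using st by (auto simp: coend_step_def)
  have o [simp]: "M i \<in> Obj C" "N i \<in> Obj C" if "i \<in> J" for i
    using MN that by (auto simp: pow_cat_def)
  have r: "r i \<in> hom C (N i) (M i)" if "i \<in> J" for i
    using r' that by (simp add: hom_pow_cat_iff)
  have x: "x i \<in> hom C (prev \<I> M i \<otimes> X i) (N i \<otimes> Y i)" if "i \<in> J" for i
    using x' that by (auto simp: seq_integrand_def)
  have x0 [simp]: "x 0 \<in> Arr C" "Src C (x 0) = \<I> \<otimes> X 0" "Tgt C (x 0) = N 0 \<otimes> Y 0"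
    using x[OF J0] by (simp_all add: hom_iff)
  have f: "f i = x i \<Zsemi> (r i \<odot> \<one> (Y i))" if "i \<in> J" for i
  proof (cases i)
    case 0
    then show ?thesis
      using that r[OF that] x[OF that] by (simp add: f' seq_integrand_def pow_cat_def hom_iff)
  next
    case (Suc k)
    then show ?thesis
      using that r[OF that] x[OF that] J[of k] by (simp add: f' seq_integrand_def pow_cat_def hom_iff)
  qed
  have g: "g i = (prev (\<one> \<I>) r i \<odot> \<one> (X i)) \<Zsemi> x i" if "i \<in> J" for i
  proof (cases i)
    case 0
    then show ?thesis
      using that x[OF that] by (simp add: g' seq_integrand_def pow_cat_def hom_iff)
  next
    case (Suc k)
    then show ?thesis
      using that r[OF J, of k] x[OF that] J[of k] by (simp add: g' seq_integrand_def pow_cat_def hom_iff)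
  qed
  have x0J: "r 0 \<in> Arr C" "Src C (r 0) = N 0" "Tgt C (r 0) = M 0"
    using r[OF J0] by (simp_all add: hom_iff)
  show "slide J X Y (M, unpad X f) (N, unpad X g)"
  proof (rule slideI[where r = r and p = "unpad X x"])
    fix i assume i: "i \<in> J"
    show "r i \<in> hom C (N i) (M i)" by (rule r[OF i])
    show "unpad X x i \<in> hom C (dm X M i) (N i \<otimes> Y i)"
      using x[OF i] i by (cases i) (auto simp: hom_iff)
    show "unpad X f i = unpad X x i \<Zsemi> (r i \<odot> \<one> (Y i))"
      using f[OF i] i x0J by (cases i) auto
    show "unpad X g i = pre X r i (unpad X x i)"
      using g[OF i] i by (cases i) auto
  qed
  show "pad X (unpad X f) = f" "pad X (unpad X g) = g"
    by (rule pad_unpad; simp add: f[OF J0] g[OF J0] x0J J0)+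
qed

text \<open>The restrictions are forced: a slide ignores what happens off \<open>J\<close>, whereas
  the objects and arrows of \<open>pow_cat C J\<close> are extensional.\<close>

lemma slide_coend_step:
  assumes sl: "slide J X Y (M, f) (N, g)"
    and J0: "0 \<in> J" and J: "\<And>i. Suc i \<in> J \<Longrightarrow> i \<in> J"
    and X [simp]: "\<And>i. X i \<in> Obj C" and Y [simp]: "\<And>i. Y i \<in> Obj C"
  shows "coend_step (pow_cat C J) (seq_integrand C J X Y)
    (restrict M J, restrict (pad X f) J) (restrict N J, restrict (pad X g) J)"
proof -
  from sl obtain r p where r: "\<And>i. i \<in> J \<Longrightarrow> r i \<in> hom C (N i) (M i)"
    and p: "\<And>i. i \<in> J \<Longrightarrow> p i \<in> hom C (dm X M i) (N i \<otimes> Y i)"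
    and f: "\<And>i. i \<in> J \<Longrightarrow> f i = p i \<Zsemi> (r i \<odot> \<one> (Y i))"
    and g: "\<And>i. i \<in> J \<Longrightarrow> g i = pre X r i (p i)"
    by (rule slideE) blast
  have o [simp]: "N i \<in> Obj C" "M i \<in> Obj C" if "i \<in> J" for i
    using r[OF that] hom_obj by auto
  let ?P = "seq_integrand C J X Y" and ?x = "restrict (pad X p) J" and ?r = "restrict r J"
  have p0 [simp]: "p 0 \<in> Arr C" "Src C (p 0) = X 0" "Tgt C (p 0) = N 0 \<otimes> Y 0"
    using p[OF J0] by (simp_all add: hom_iff)
  have r0 [simp]: "r 0 \<in> Arr C" "Src C (r 0) = N 0" "Tgt C (r 0) = M 0"
    using r[OF J0] by (simp_all add: hom_iff)
  note [simp] = J0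
  have rx: "?x \<in> FOb ?P (restrict M J, restrict N J)"
  proof -
    have "pad X p i \<in> hom C (prev \<I> (restrict M J) i \<otimes> X i) (N i \<otimes> Y i)" if "i \<in> J" for i
      using p[OF that] J[of "i - 1"] that by (cases i) (auto simp: hom_iff)
    then show ?thesis by (simp add: seq_integrand_def)
  qed
  have f': "restrict (pad X f) J = FAr ?P (\<one>\<^bsub>pow_cat C J\<^esub> (restrict M J), ?r) ?x"
  proof (rule extensionalityI[of _ J])
    fix i assume i: "i \<in> J"
    show "restrict (pad X f) J i = FAr ?P (\<one>\<^bsub>pow_cat C J\<^esub> (restrict M J), ?r) ?x i"
    proof (cases i)
      case 0
      then show ?thesis by (simp add: seq_integrand_def pow_cat_def f[OF J0])
    next
      case (Suc k)
      then show ?thesis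
        using i J[of k] p[OF i] r[OF i] f[OF i] by (simp add: seq_integrand_def pow_cat_def hom_iff)
    qed
  qed (simp_all add: seq_integrand_def)
  have g': "restrict (pad X g) J = FAr ?P (?r, \<one>\<^bsub>pow_cat C J\<^esub> (restrict N J)) ?x"
  proof (rule extensionalityI[of _ J])
    fix i assume i: "i \<in> J"
    show "restrict (pad X g) J i = FAr ?P (?r, \<one>\<^bsub>pow_cat C J\<^esub> (restrict N J)) ?x i"
    proof (cases i)
      case 0
      then show ?thesis by (simp add: seq_integrand_def pow_cat_def g[OF J0])
    next
      case (Suc k)
      then show ?thesis
        using i J[of k] p[OF i] r[OF J, of k] g[OF i] by (simp add: seq_integrand_def pow_cat_def hom_iff)
    qed
  qed (simp_all add: seq_integrand_def)
  have "restrict M J \<in> Obj (pow_cat C J)" "restrict N J \<in> Obj (pow_cat C J)"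
    by (auto simp: pow_cat_def)
  moreover have "?r \<in> hom (pow_cat C J) (restrict N J) (restrict M J)"
    using r by (simp add: hom_pow_cat_iff)
  ultimately show ?thesis
    unfolding coend_step_def f' g' using rx by blast
qed

lemma stage_class_eq_iff:
  assumes wt: "(M, f) \<in> seqs {..n} X Y" "(N, g) \<in> seqs {..n} X Y"
    and X: "\<And>i. X i \<in> Obj C" and Y: "\<And>i. Y i \<in> Obj C"
  shows "stage_class C n X Y M (pad X f) = stage_class C n X Y N (pad X g) \<longleftrightarrow> steq {..n} X Y (M, f) (N, g)"
    (is "?l \<longleftrightarrow> ?r")
proof
  let ?S = "coend_step (pow_cat C {..n}) (seq_integrand C {..n} X Y)"
  let ?R = "\<lambda>(M, f). (restrict M {..n}, restrict (pad X f) {..n})"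
  let ?U = "\<lambda>(M, f). (M, unpad X f)"
  have J: "Suc i \<in> {..n} \<Longrightarrow> i \<in> {..n}" for i by simp
  \<comment> \<open>Padding, restricting and unpadding changes a sequence only off the stage, where
    slides do not look.\<close>
  have RU: "steq {..n} X Y (M, f) (?U (?R (M, f)))" if "(M, f) \<in> seqs {..n} X Y" for M f
  proof -
    have "unpad X (restrict (pad X f) {..n}) i = f i" if "i \<le> n" for i
      using seqsD(2)[OF \<open>(M, f) \<in> _\<close>, of i] that X by (cases i) (auto simp: hom_iff)
    then have "slide {..n} X Y (M, f) (?U (?R (M, f)))"
      unfolding prod.case using that X Y by (intro slide_refl) auto
    then show ?thesis by blast
  qed
  show ?r if ?l
  proof -
    have "equivclp ?S (?R (M, f)) (?R (N, g))"
      using that by (simp add: stage_class_def coend_class_eq_iff)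
    then have "steq {..n} X Y (?U (?R (M, f))) (?U (?R (N, g)))"
      by (rule equivclp_map) (use coend_step_slide(1)[OF _ _ J X Y] in auto)
    then show ?thesis using RU wt by (meson equivclp_sym equivclp_trans)
  qed
  show ?l if ?r
  proof -
    have "equivclp ?S (?R (M, f)) (?R (N, g))"
      using that
    proof (rule equivclp_map)
      fix a b assume "slide {..n} X Y a b"
      then show "equivclp ?S (?R a) (?R b)"
        using slide_coend_step[where X = X and Y = Y and J = "{..n}", OF _ _ J X Y, of "fst a" "snd a" "fst b" "snd b"]
        by (simp add: case_prod_unfold r_into_equivclp)
    qed
    then show ?thesis by (simp add: stage_class_def coend_class_eq_iff)
  qed
qed

text \<open>\<open>obs_equiv\<close> and the union in \<open>FAr (oSeq C)\<close> range over all
  members of a class. Typing survives along a chain, so every member is again a padded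
  sequence.\<close>

lemma mem_dSeq_class:
  assumes "(N, h) \<in> dSeq_class C X Y M (pad X f)" and wt: "(M, f) \<in> seqs UNIV X Y"
    and X: "\<And>i. X i \<in> Obj C" and Y: "\<And>i. Y i \<in> Obj C"
  obtains g where "h = pad X g" "(N, g) \<in> seqs UNIV X Y" "steq UNIV X Y (M, f) (N, g)"
proof -
  let ?A = "{(M, f). (M, unpad X f) \<in> seqs UNIV X Y \<and> pad X (unpad X f) = f}"
  let ?U = "\<lambda>(M, f). (M, unpad X f)"
  let ?S = "coend_step (seq_cat C) (seq_integrand C UNIV X Y)"
  have up: "unpad X (pad X f) = f"
    using seqsD(2)[OF wt, of 0] X by (intro unpad_pad) (auto simp: hom_iff)
  have "(N, h) \<in> ?A \<and> steq UNIV X Y (?U (M, pad X f)) (?U (N, h))"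
  proof (rule equivclp_map_on)
    show "equivclp ?S (M, pad X f) (N, h)"
      using assms(1) by (simp add: dSeq_class_def mem_coend_class_iff)
    show "(M, pad X f) \<in> ?A" using wt up by simp
    fix a b assume ab: "?S a b"
    obtain M1 f1 M2 f2 where [simp]: "a = (M1, f1)" "b = (M2, f2)" by (cases a, cases b)
    note st = coend_step_slide[OF ab[simplified] UNIV_I UNIV_I X Y]
    show "steq UNIV X Y (?U a) (?U b)" using st(1) by auto
    have "(M1, unpad X f1) \<in> seqs UNIV X Y" "(M2, unpad X f2) \<in> seqs UNIV X Y"
      by (rule slide_seqs[OF st(1) Y X]; simp)+
    then show "a \<in> ?A \<longleftrightarrow> b \<in> ?A" using st by simp
  qed
  then show ?thesis using that[of "unpad X h"] up by simp
qed

lemma dSeq_class_mem: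
  assumes wt: "(M, f) \<in> seqs UNIV X Y" and X: "\<And>i. X i \<in> Obj C"
  shows "dSeq_class C X Y M (pad X f) \<in> dSeq C X Y"
proof -
  have "pad X f i \<in> hom C (prev \<I> M i \<otimes> X i) (M i \<otimes> Y i)" for i
    using seqsD[OF wt, of i] X by (cases i) (auto simp: hom_iff)
  moreover have "M i \<in> Obj C" for i using seqsD[OF wt, of i] by simp
  ultimately show ?thesis
    unfolding dSeq_def dSeq_class_def mem_coend_iff
    by (intro exI[of _ M] exI[of _ "pad X f"]) (auto simp: seq_integrand_def)
qed

lemma dSeq_cases:
  assumes "a \<in> dSeq C X Y" and X: "\<And>i. X i \<in> Obj C"
  obtains M f where "a = dSeq_class C X Y M (pad X f)" "(M, f) \<in> seqs UNIV X Y"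
proof -
  obtain M h where "M \<in> Obj (seq_cat C)" "h \<in> FOb (seq_integrand C UNIV X Y) (M, M)"
    and a: "a = dSeq_class C X Y M h"
    using assms(1) unfolding dSeq_def mem_coend_iff dSeq_class_def by blast
  then have M: "M i \<in> Obj C" and h: "h i \<in> hom C (prev \<I> M i \<otimes> X i) (M i \<otimes> Y i)" for i
    by (auto simp: seq_integrand_def)
  have "unpad X h i \<in> hom C (dm X M i) (M i \<otimes> Y i)" for i
    using h[of i] X by (cases i) (auto simp: hom_iff)
  moreover have "pad X (unpad X h) = h"
    using h[of 0] X by (intro pad_unpad) (auto simp: hom_iff)
  ultimately show ?thesis using that[of M "unpad X h"] a M by (simp add: seqs_def)
qed

text \<open>A chain over all of \<open>nat\<close> restricts to every stage, so the test against all
  members of the two classes reduces to one pair of representatives.\<close>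

lemma obs_equiv_iff:
  assumes wt: "(M, f) \<in> seqs UNIV X Y" "(N, g) \<in> seqs UNIV X Y"
    and X: "\<And>i. X i \<in> Obj C" and Y: "\<And>i. Y i \<in> Obj C"
  shows "(dSeq_class C X Y M (pad X f), dSeq_class C X Y N (pad X g)) \<in> obs_equiv C X Y \<longleftrightarrow>
    (\<forall>n. steq {..n} X Y (M, f) (N, g))" (is "?l \<longleftrightarrow> ?r")
proof
  have eq: "stage_class C n X Y M (pad X f) = stage_class C n X Y N (pad X g) \<longleftrightarrow> steq {..n} X Y (M, f) (N, g)"
    if "(M, f) \<in> seqs UNIV X Y" "(N, g) \<in> seqs UNIV X Y" for n M f N g
    using stage_class_eq_iff[OF seqs_mono[OF that(1)] seqs_mono[OF that(2)] X Y] by simp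
  show ?r if ?l
  proof -
    have "(M, pad X f) \<in> dSeq_class C X Y M (pad X f)" "(N, pad X g) \<in> dSeq_class C X Y N (pad X g)"
      by (simp_all add: dSeq_class_def self_mem_coend_class)
    then have "stage_class C n X Y M (pad X f) = stage_class C n X Y N (pad X g)" for n
      using that unfolding obs_equiv_def by blast
    then show ?thesis using eq[OF wt] by simp
  qed
  show ?l if r: ?r
  proof -
    have "stage_class C n X Y M' f' = stage_class C n X Y N' g'"
      if f': "(M', f') \<in> dSeq_class C X Y M (pad X f)" and g': "(N', g') \<in> dSeq_class C X Y N (pad X g)"
      for n M' f' N' g'
    proof -
      obtain f1 where f1: "f' = pad X f1" "(M', f1) \<in> seqs UNIV X Y" "steq UNIV X Y (M, f) (M', f1)"
        using mem_dSeq_class[OF f' wt(1) X Y] .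
      obtain g1 where g1: "g' = pad X g1" "(N', g1) \<in> seqs UNIV X Y" "steq UNIV X Y (N, g) (N', g1)"
        using mem_dSeq_class[OF g' wt(2) X Y] .
      have "steq {..n} X Y (M', f1) (N', g1)"
        using steq_mono[OF f1(3), of "{..n}"] steq_mono[OF g1(3), of "{..n}"] r
        by (meson equivclp_sym equivclp_trans subset_UNIV)
      then show ?thesis using eq[OF f1(2) g1(2)] f1(1) g1(1) by simp
    qed
    then show ?thesis
      unfolding obs_equiv_def using dSeq_class_mem[OF wt(1) X] dSeq_class_mem[OF wt(2) X] by blast
  qed
qed

lemma equiv_obs_equiv:
  assumes X: "\<And>i. X i \<in> Obj C" and Y: "\<And>i. Y i \<in> Obj C"
  shows "equiv (dSeq C X Y) (obs_equiv C X Y)"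
proof (rule equivI)
  show "obs_equiv C X Y \<subseteq> dSeq C X Y \<times> dSeq C X Y" by (auto simp: obs_equiv_def)
  show "refl_on (dSeq C X Y) (obs_equiv C X Y)"
  proof (rule refl_onI)
    show "(a, a) \<in> obs_equiv C X Y" if "a \<in> dSeq C X Y" for a
      using that X by (rule dSeq_cases) (simp add: obs_equiv_iff X Y)
  qed
  show "sym (obs_equiv C X Y)" by (rule symI) (fastforce simp: obs_equiv_def)
  show "trans (obs_equiv C X Y)"
  proof (rule transI)
    fix a b c assume ab: "(a, b) \<in> obs_equiv C X Y" and bc: "(b, c) \<in> obs_equiv C X Y"
    then have "a \<in> dSeq C X Y" "b \<in> dSeq C X Y" "c \<in> dSeq C X Y" by (auto simp: obs_equiv_def)
    then obtain M f N g L h where *: "a = dSeq_class C X Y M (pad X f)" "(M, f) \<in> seqs UNIV X Y"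
      "b = dSeq_class C X Y N (pad X g)" "(N, g) \<in> seqs UNIV X Y"
      "c = dSeq_class C X Y L (pad X h)" "(L, h) \<in> seqs UNIV X Y"
      using X by (meson dSeq_cases)
    then show "(a, c) \<in> obs_equiv C X Y"
      using ab bc by (simp add: obs_equiv_iff X Y) (meson equivclp_trans)
  qed
qed

definition oelt :: "(nat \<Rightarrow> 'o) \<Rightarrow> (nat \<Rightarrow> 'o) \<Rightarrow> (nat \<Rightarrow> 'o) \<Rightarrow> (nat \<Rightarrow> 'a) \<Rightarrow>
    ((nat \<Rightarrow> 'o) \<times> (nat \<Rightarrow> 'a)) set set" where
  "oelt X Y M f = oSeq_class C X Y M (pad X f)"

text \<open>The bridge from equality in \<open>oSeq C\<close> to chains of slides at finite
  stages.\<close>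

lemma oelt_eq_iff:
  assumes "(M, f) \<in> seqs UNIV X Y" "(N, g) \<in> seqs UNIV X Y"
    and X: "\<And>i. X i \<in> Obj C" and Y: "\<And>i. Y i \<in> Obj C"
  shows "oelt X Y M f = oelt X Y N g \<longleftrightarrow> (\<forall>n. steq {..n} X Y (M, f) (N, g))"
  unfolding oelt_def oSeq_class_def
  using eq_equiv_class_iff[OF equiv_obs_equiv[OF X Y]] dSeq_class_mem assms obs_equiv_iff by simp

lemma oSeq_FOb_iff:
  assumes X: "\<And>i. X i \<in> Obj C" and Y: "\<And>i. Y i \<in> Obj C"
  shows "c \<in> FOb (oSeq C) (X, Y) \<longleftrightarrow> (\<exists>M f. (M, f) \<in> seqs UNIV X Y \<and> c = oelt X Y M f)"
proof -
  have "c \<in> FOb (oSeq C) (X, Y) \<longleftrightarrow> (\<exists>a\<in>dSeq C X Y. c = obs_equiv C X Y `` {a})"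
    by (auto simp: oSeq_def quotient_def)
  also have "\<dots> \<longleftrightarrow> (\<exists>M f. (M, f) \<in> seqs UNIV X Y \<and> c = oelt X Y M f)"
  proof
    assume "\<exists>a\<in>dSeq C X Y. c = obs_equiv C X Y `` {a}"
    then obtain a where a: "a \<in> dSeq C X Y" "c = obs_equiv C X Y `` {a}" by blast
    from a(1) X obtain M f where "a = dSeq_class C X Y M (pad X f)" "(M, f) \<in> seqs UNIV X Y"
      by (rule dSeq_cases)
    then show "\<exists>M f. (M, f) \<in> seqs UNIV X Y \<and> c = oelt X Y M f"
      using a(2) unfolding oelt_def oSeq_class_def by blast
  next
    assume "\<exists>M f. (M, f) \<in> seqs UNIV X Y \<and> c = oelt X Y M f"
    then show "\<exists>a\<in>dSeq C X Y. c = obs_equiv C X Y `` {a}"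
      unfolding oelt_def oSeq_class_def using dSeq_class_mem[where X = X and Y = Y, OF _ X] by blast
  qed
  finally show ?thesis .
qed

text \<open>Maps out of \<open>oSeq C\<close> are unions over representatives, and a union of a
  constant nonempty family is its value. Constancy need only be checked on typed sequences that are
  related at all stages.\<close>

lemma oelt_UN:
  assumes wt: "(M, f) \<in> seqs UNIV X Y" and X: "\<And>i. X i \<in> Obj C" and Y: "\<And>i. Y i \<in> Obj C"
    and H: "\<And>N g. (N, g) \<in> seqs UNIV X Y \<Longrightarrow> (\<And>n. steq {..n} X Y (M, f) (N, g)) \<Longrightarrow> H N (pad X g) = d"
  shows "(\<Union>a\<in>oelt X Y M f. \<Union>(N, h)\<in>a. H N h) = d"
proof -
  have H': "H N h = d" if a: "a \<in> oelt X Y M f" and N: "(N, h) \<in> a" for a N h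
  proof -
    have "(dSeq_class C X Y M (pad X f), a) \<in> obs_equiv C X Y"
      using a by (simp add: oelt_def oSeq_class_def)
    moreover from this have "a \<in> dSeq C X Y" by (simp add: obs_equiv_def)
    then obtain M' f' where f': "a = dSeq_class C X Y M' (pad X f')" "(M', f') \<in> seqs UNIV X Y"
      using X by (rule dSeq_cases)
    ultimately have st: "steq {..n} X Y (M, f) (M', f')" for n
      using obs_equiv_iff[OF wt f'(2) X Y] by simp
    obtain g where g: "h = pad X g" "(N, g) \<in> seqs UNIV X Y" "steq UNIV X Y (M', f') (N, g)"
      using mem_dSeq_class[OF _ f'(2) X Y] N f'(1) by auto
    show ?thesis
      unfolding g(1) by (rule H[OF g(2)]) (rule equivclp_trans[OF st steq_mono[OF g(3)]], simp)
  qed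
  have "dSeq_class C X Y M (pad X f) \<in> oelt X Y M f"
    unfolding oelt_def oSeq_class_def
    by (rule equiv_class_self[OF equiv_obs_equiv[OF X Y] dSeq_class_mem[OF wt X]])
  moreover have "(M, pad X f) \<in> dSeq_class C X Y M (pad X f)"
    by (simp add: dSeq_class_def self_mem_coend_class)
  ultimately show ?thesis using H' by blast
qed

end

lemma prof_cat_simps [simp]:
  "(X, Y) \<in> Obj (prof_cat C) \<longleftrightarrow> (\<forall>i. X i \<in> Obj C) \<and> (\<forall>i. Y i \<in> Obj C)"
  "(u, v) \<in> Arr (prof_cat C) \<longleftrightarrow> (\<forall>i. u i \<in> Arr C) \<and> (\<forall>i. v i \<in> Arr C)"
  "Src (prof_cat C) (u, v) = (\<lambda>i. Tgt C (u i), \<lambda>i. Src C (v i))"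
  "Tgt (prof_cat C) (u, v) = (\<lambda>i. Src C (u i), \<lambda>i. Tgt C (v i))"
  "\<one>\<^bsub>prof_cat C\<^esub> (X, Y) = (\<lambda>i. \<one>\<^bsub>C\<^esub> (X i), \<lambda>i. \<one>\<^bsub>C\<^esub> (Y i))"
  "(u, v) \<Zsemi>\<^bsub>prof_cat C\<^esub> (u', v') = (\<lambda>i. u' i \<Zsemi>\<^bsub>C\<^esub> u i, \<lambda>i. v i \<Zsemi>\<^bsub>C\<^esub> v' i)"
  by (auto simp: prod_cat_def op_cat_def)

lemma is_setfunD:
  assumes "is_setfun (prof_cat C) Q"
  shows "\<lbrakk>\<And>i. u i \<in> hom C (X' i) (X i); \<And>i. v i \<in> hom C (Y i) (Y' i); q \<in> FOb Q (X, Y)\<rbrakk>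
      \<Longrightarrow> FAr Q (u, v) q \<in> FOb Q (X', Y')"
    and "\<lbrakk>\<And>i. X i \<in> Obj C; \<And>i. Y i \<in> Obj C; q \<in> FOb Q (X, Y)\<rbrakk>
      \<Longrightarrow> FAr Q (\<lambda>i. \<one>\<^bsub>C\<^esub> (X i), \<lambda>i. \<one>\<^bsub>C\<^esub> (Y i)) q = q"
    and "\<lbrakk>\<And>i. u i \<in> hom C (X' i) (X i); \<And>i. v i \<in> hom C (Y i) (Y' i); q \<in> FOb Q (X, Y);
        \<And>i. u' i \<in> hom C (X'' i) (X' i); \<And>i. v' i \<in> hom C (Y' i) (Y'' i)\<rbrakk>
      \<Longrightarrow> FAr Q (\<lambda>i. u' i \<Zsemi>\<^bsub>C\<^esub> u i, \<lambda>i. v i \<Zsemi>\<^bsub>C\<^esub> v' i) q = FAr Q (u', v') (FAr Q (u, v) q)"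
proof -
  note Q = assms[unfolded is_setfun_def]
  show "FAr Q (u, v) q \<in> FOb Q (X', Y')"
    if "\<And>i. u i \<in> hom C (X' i) (X i)" "\<And>i. v i \<in> hom C (Y i) (Y' i)" "q \<in> FOb Q (X, Y)"
    using Q[THEN conjunct1, THEN bspec, of "(u, v)"] that by (auto simp: hom_iff)
  show "FAr Q (\<lambda>i. \<one>\<^bsub>C\<^esub> (X i), \<lambda>i. \<one>\<^bsub>C\<^esub> (Y i)) q = q"
    if "\<And>i. X i \<in> Obj C" "\<And>i. Y i \<in> Obj C" "q \<in> FOb Q (X, Y)"
    using Q[THEN conjunct2, THEN conjunct1, THEN bspec, of "(X, Y)"] that by auto
  show "FAr Q (\<lambda>i. u' i \<Zsemi>\<^bsub>C\<^esub> u i, \<lambda>i. v i \<Zsemi>\<^bsub>C\<^esub> v' i) q = FAr Q (u', v') (FAr Q (u, v) q)"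
    if "\<And>i. u i \<in> hom C (X' i) (X i)" "\<And>i. v i \<in> hom C (Y i) (Y' i)" "q \<in> FOb Q (X, Y)"
      "\<And>i. u' i \<in> hom C (X'' i) (X' i)" "\<And>i. v' i \<in> hom C (Y' i) (Y'' i)"
    using Q[THEN conjunct2, THEN conjunct2, THEN bspec, of "(u, v)", THEN bspec, of "(u', v')"] that
    by (auto simp: hom_iff)
qed

context symmetric_monoidal_category
begin

lemma oSeq_FAr:
  assumes wt: "(M, f) \<in> seqs UNIV X Y"
    and u: "\<And>i. u i \<in> hom C (X' i) (X i)" and v: "\<And>i. v i \<in> hom C (Y i) (Y' i)"
  shows "FAr (oSeq C) (u, v) (oelt X Y M f) = oelt X' Y' M (act_seq u v M f)"
proof -
  have X: "X i \<in> Obj C" "X' i \<in> Obj C" and Y: "Y i \<in> Obj C" "Y' i \<in> Obj C" for i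
    using hom_obj[OF u[of i]] hom_obj[OF v[of i]] by auto
  note uv = u[unfolded hom_iff] v[unfolded hom_iff]
  have eq: "oSeq_class C X' Y' N (\<lambda>i. (\<one> (prev \<I> N i) \<odot> u i) \<Zsemi> pad X g i \<Zsemi> (\<one> (N i) \<odot> v i))
      = oelt X' Y' M (act_seq u v M f)"
    if wt': "(N, g) \<in> seqs UNIV X Y" and st: "\<And>n. steq {..n} X Y (M, f) (N, g)" for N g
  proof -
    have "(\<one> (prev \<I> N i) \<odot> u i) \<Zsemi> pad X g i \<Zsemi> (\<one> (N i) \<odot> v i) = pad X' (act_seq u v N g) i" for i
    proof (cases i)
      case 0
      have g: "g 0 \<in> Arr C" "Src C (g 0) = X 0" "Tgt C (g 0) = N 0 \<otimes> Y 0" "N 0 \<in> Obj C"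
        using seqsD[OF wt', of 0] by (auto simp: hom_iff)
      \<comment> \<open>At index \<open>0\<close> the action puts
        \<open>\<one> \<I> \<odot> u 0\<close> in front of the unitor hidden in \<open>pad\<close>;
        naturality moves \<open>u 0\<close> behind it.\<close>
      have "((\<one> \<I> \<odot> u 0) \<Zsemi> lunit C (X 0)) \<Zsemi> (g 0 \<Zsemi> (\<one> (N 0) \<odot> v 0))
          = (lunit C (X' 0) \<Zsemi> u 0) \<Zsemi> (g 0 \<Zsemi> (\<one> (N 0) \<odot> v 0))"
        using lunit_nat[of "u 0" "X 0"] uv by simp
      then show ?thesis
        using 0 g uv X Y by (simp add: act_seq_simps)
    next
      case (Suc k)
      then show ?thesis by (simp add: act_seq_simps)
    qed
    then have "oSeq_class C X' Y' N (\<lambda>i. (\<one> (prev \<I> N i) \<odot> u i) \<Zsemi> pad X g i \<Zsemi> (\<one> (N i) \<odot> v i))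
        = oelt X' Y' N (act_seq u v N g)"
      by (simp add: oelt_def)
    also have "\<dots> = oelt X' Y' M (act_seq u v M f)"
      using oelt_eq_iff[OF act_seq_seqs[OF wt' u v] act_seq_seqs[OF wt u v]] X Y
        steq_act_seq[OF equivclp_sym[OF st] u v] by simp
    finally show ?thesis .
  qed
  show ?thesis
    using oelt_UN[OF wt X(1) Y(1), of "\<lambda>N h. oSeq_class C X' Y' N (\<lambda>i. (\<one> (prev \<I> N i) \<odot> u i) \<Zsemi> h i \<Zsemi> (\<one> (N i) \<odot> v i))", OF eq]
    by (simp add: oSeq_def uv)
qed

lemma act_seq_idt:
  assumes "(M, f) \<in> seqs UNIV X Y" "\<And>i. X i \<in> Obj C" "\<And>i. Y i \<in> Obj C"
  shows "act_seq (\<lambda>i. \<one> (X i)) (\<lambda>i. \<one> (Y i)) M f = f"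
proof
  fix i
  show "act_seq (\<lambda>i. \<one> (X i)) (\<lambda>i. \<one> (Y i)) M f i = f i"
    using seqsD[OF assms(1), of i] seqsD[OF assms(1), of "i - 1"] assms(2,3)
    by (cases i) (auto simp: act_seq_simps hom_iff)
qed

lemma act_seq_act_seq:
  assumes "(M, f) \<in> seqs UNIV X Y"
    and u: "\<And>i. u i \<in> hom C (X' i) (X i)" and v: "\<And>i. v i \<in> hom C (Y i) (Y' i)"
    and u': "\<And>i. u' i \<in> hom C (X'' i) (X' i)" and v': "\<And>i. v' i \<in> hom C (Y' i) (Y'' i)"
  shows "act_seq (\<lambda>i. u' i \<Zsemi> u i) (\<lambda>i. v i \<Zsemi> v' i) M f = act_seq u' v' M (act_seq u v M f)"
proof
  fix i
  note h = u[unfolded hom_iff] v[unfolded hom_iff] u'[unfolded hom_iff] v'[unfolded hom_iff]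
  have [simp]: "M i \<in> Obj C" for i using seqsD(1)[OF assms(1), of i] by simp
  have f: "f i \<in> Arr C" "Src C (f i) = dm X M i" "Tgt C (f i) = M i \<otimes> Y i" for i
    using seqsD(2)[OF assms(1), of i] by (simp_all add: hom_iff)
  show "act_seq (\<lambda>i. u' i \<Zsemi> u i) (\<lambda>i. v i \<Zsemi> v' i) M f i = act_seq u' v' M (act_seq u v M f) i"
  proof (cases i)
    case 0
    then show ?thesis using f[of 0] h by (simp add: act_seq_simps)
  next
    case (Suc k)
    have "\<one> (M k) \<odot> (u' (Suc k) \<Zsemi> u (Suc k)) = (\<one> (M k) \<odot> u' (Suc k)) \<Zsemi> (\<one> (M k) \<odot> u (Suc k))"
      using h by simp
    then show ?thesis using f[of "Suc k"] h Suc by (simp add: act_seq_simps)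
  qed
qed

text \<open>The second input of a sequence becomes, together with the memory \<open>M 0\<close>, the
  first input of its tail. There \<open>u\<close> acts as \<open>\<one> (M 0) \<odot> u 1\<close>,
  which is \<open>act_arr\<close>.\<close>

lemma act_seq_shift:
  "shift (act_seq u v M f) = act_seq (act_arr C (\<one> (M 0)) (shift u)) (shift v) (shift M) (shift f)"
proof
  fix i
  show "shift (act_seq u v M f) i = act_seq (act_arr C (\<one> (M 0)) (shift u)) (shift v) (shift M) (shift f) i"
    by (cases i) (simp_all add: act_seq_simps)
qed

lemma oSeq_setfun: "is_setfun (prof_cat C) (oSeq C)"
  unfolding is_setfun_def
proof (intro conjI ballI impI)
  fix a assume a: "a \<in> Arr (prof_cat C)"
  obtain u v where [simp]: "a = (u, v)" by (cases a)
  have u: "u i \<in> hom C (Src C (u i)) (Tgt C (u i))" and v: "v i \<in> hom C (Src C (v i)) (Tgt C (v i))" for i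
    using a by (auto simp: hom_iff)
  show "FAr (oSeq C) a \<in> FOb (oSeq C) (Src (prof_cat C) a) \<rightarrow> FOb (oSeq C) (Tgt (prof_cat C) a)"
  proof
    fix c assume "c \<in> FOb (oSeq C) (Src (prof_cat C) a)"
    then obtain M f where wt: "(M, f) \<in> seqs UNIV (\<lambda>i. Tgt C (u i)) (\<lambda>i. Src C (v i))"
      and c: "c = oelt (\<lambda>i. Tgt C (u i)) (\<lambda>i. Src C (v i)) M f"
      using a by (auto simp: oSeq_FOb_iff)
    show "FAr (oSeq C) a c \<in> FOb (oSeq C) (Tgt (prof_cat C) a)"
      using a oSeq_FAr[OF wt u v] act_seq_seqs[OF wt u v] by (auto simp: oSeq_FOb_iff c)
  qed
  fix b c assume b: "b \<in> Arr (prof_cat C)" and ab: "Tgt (prof_cat C) a = Src (prof_cat C) b"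
    and c: "c \<in> FOb (oSeq C) (Src (prof_cat C) a)"
  obtain u' v' where [simp]: "b = (u', v')" by (cases b)
  have eq: "Src C (u i) = Tgt C (u' i)" "Tgt C (v i) = Src C (v' i)" for i
    using ab by (auto simp: fun_eq_iff)
  have u': "u' i \<in> hom C (Src C (u' i)) (Src C (u i))" and v': "v' i \<in> hom C (Tgt C (v i)) (Tgt C (v' i))" for i
    using b eq by (auto simp: hom_iff)
  obtain M f where wt: "(M, f) \<in> seqs UNIV (\<lambda>i. Tgt C (u i)) (\<lambda>i. Src C (v i))"
    and c: "c = oelt (\<lambda>i. Tgt C (u i)) (\<lambda>i. Src C (v i)) M f"
    using a c by (auto simp: oSeq_FOb_iff)
  have comp: "u' i \<Zsemi> u i \<in> hom C (Src C (u' i)) (Tgt C (u i))" "v i \<Zsemi> v' i \<in> hom C (Src C (v i)) (Tgt C (v' i))" for i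
    by (rule seqc_hom[OF u' u], rule seqc_hom[OF v v'])
  show "FAr (oSeq C) (a \<Zsemi>\<^bsub>prof_cat C\<^esub> b) c = FAr (oSeq C) b (FAr (oSeq C) a c)"
    using oSeq_FAr[OF wt u v] oSeq_FAr[OF act_seq_seqs[OF wt u v] u' v'] oSeq_FAr[OF wt comp]
      act_seq_act_seq[OF wt u v u' v'] by (simp add: c)
next
  fix A c assume A: "A \<in> Obj (prof_cat C)" and c: "c \<in> FOb (oSeq C) A"
  obtain X Y where [simp]: "A = (X, Y)" by (cases A)
  have X: "X i \<in> Obj C" and Y: "Y i \<in> Obj C" for i using A by auto
  have i: "\<one> (X i) \<in> hom C (X i) (X i)" "\<one> (Y i) \<in> hom C (Y i) (Y i)" for i
    using X Y idt_hom by auto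
  obtain M f where wt: "(M, f) \<in> seqs UNIV X Y" and c: "c = oelt X Y M f"
    using c X Y by (auto simp: oSeq_FOb_iff)
  show "FAr (oSeq C) (\<one>\<^bsub>prof_cat C\<^esub> A) c = c"
    using oSeq_FAr[OF wt i] act_seq_idt[OF wt X Y] by (simp add: c)
qed

end

section \<open>The coalgebra of observational sequences\<close>

context symmetric_monoidal_category
begin

text \<open>The contravariant half of \<open>Phi_integrand\<close>: reindexing of \<open>q\<close>
  along a change \<open>r\<close> of the first memory.\<close>

definition slide_act :: "('o, 'a, 'q) prof \<Rightarrow> (nat \<Rightarrow> 'o) \<Rightarrow> (nat \<Rightarrow> 'o) \<Rightarrow> 'a \<Rightarrow> 'q \<Rightarrow> 'q" where
  "slide_act Q X Y r q = FAr Q (act_arr C r (\<lambda>i. \<one> (shift X i)), \<lambda>i. \<one> (shift Y i)) q"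

definition Phi_elts :: "('o, 'a, 'q) prof \<Rightarrow> (nat \<Rightarrow> 'o) \<Rightarrow> (nat \<Rightarrow> 'o) \<Rightarrow> ('o \<times> ('a \<times> 'q)) set" where
  "Phi_elts Q X Y = {(M, (f, q)). M \<in> Obj C \<and> f \<in> hom C (X 0) (M \<otimes> Y 0) \<and>
     q \<in> FOb Q (act_obj C M (shift X), shift Y)}"

lemma act_obj_obj [simp]: "\<lbrakk>M \<in> Obj C; \<And>i. X i \<in> Obj C\<rbrakk> \<Longrightarrow> act_obj C M X i \<in> Obj C"
  by (cases i) auto

lemma act_arr_hom:
  "\<lbrakk>r \<in> hom C N M; \<And>i. u i \<in> hom C (X' i) (X i)\<rbrakk> \<Longrightarrow> act_arr C r u i \<in> hom C (act_obj C N X' i) (act_obj C M X i)"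
  by (cases i) (auto intro: tensor_hom)

lemma slide_act_mem:
  assumes Q: "is_setfun (prof_cat C) Q" and r: "r \<in> hom C N M"
    and q: "q \<in> FOb Q (act_obj C M (shift X), shift Y)"
    and X: "\<And>i. X i \<in> Obj C" and Y: "\<And>i. Y i \<in> Obj C"
  shows "slide_act Q X Y r q \<in> FOb Q (act_obj C N (shift X), shift Y)"
  unfolding slide_act_def
  by (rule is_setfunD(1)[OF Q act_arr_hom[OF r] _ q]) (simp_all add: X Y idt_hom)

text \<open>A generator of the coend in \<open>Phi\<close> with its identity halves removed, on the
  arrow side by the category laws and on the side of \<open>q\<close> by functoriality of
  \<open>Q\<close>. Both ends are typed, which is why typing propagates along chains.\<close>

lemma Phi_stepE:
  assumes Q: "is_setfun (prof_cat C) Q" and st: "coend_step C (Phi_integrand C Q X Y) a b"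
    and X: "\<And>i. X i \<in> Obj C" and Y: "\<And>i. Y i \<in> Obj C"
  obtains M N r f q where "r \<in> hom C N M" "f \<in> hom C (X 0) (N \<otimes> Y 0)"
    "q \<in> FOb Q (act_obj C M (shift X), shift Y)"
    "a = (M, (f \<Zsemi> (r \<odot> \<one> (Y 0)), q))" "b = (N, (f, slide_act Q X Y r q))"
    "a \<in> Phi_elts Q X Y" "b \<in> Phi_elts Q X Y"
proof -
  from st obtain M N r x where M: "M \<in> Obj C" and N: "N \<in> Obj C" and r: "r \<in> hom C N M"
    and x: "x \<in> FOb (Phi_integrand C Q X Y) (M, N)"
    and a: "a = (M, FAr (Phi_integrand C Q X Y) (\<one> M, r) x)"
    and b: "b = (N, FAr (Phi_integrand C Q X Y) (r, \<one> N) x)"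
    unfolding coend_step_def by blast
  obtain f q where [simp]: "x = (f, q)" by (cases x)
  have f: "f \<in> hom C (X 0) (N \<otimes> Y 0)" and q: "q \<in> FOb Q (act_obj C M (shift X), shift Y)"
    using x by (simp_all add: Phi_integrand_def)
  have "act_arr C (\<one> M) (\<lambda>i. \<one> (shift X i)) = (\<lambda>i. \<one> (act_obj C M (shift X) i))"
    using X M by (auto simp: act_arr_def act_obj_def)
  then have "FAr Q (act_arr C (\<one> M) (\<lambda>i. \<one> (shift X i)), \<lambda>i. \<one> (shift Y i)) q = q"
    using is_setfunD(2)[OF Q _ _ q] X Y M by simp
  then have a': "a = (M, (f \<Zsemi> (r \<odot> \<one> (Y 0)), q))"
    by (simp add: a Phi_integrand_def)
  have b': "b = (N, (f, slide_act Q X Y r q))"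
    using f Y N by (simp add: b Phi_integrand_def slide_act_def hom_iff)
  show ?thesis
    by (rule that[OF r f q a' b'])
      (use f q r M N Y slide_act_mem[OF Q r q X Y] in \<open>auto simp: Phi_elts_def a' b' hom_iff\<close>)
qed

lemma Phi_step:
  assumes Q: "is_setfun (prof_cat C) Q" and r: "r \<in> hom C N M" and f: "f \<in> hom C (X 0) (N \<otimes> Y 0)"
    and q: "q \<in> FOb Q (act_obj C M (shift X), shift Y)"
    and X: "\<And>i. X i \<in> Obj C" and Y: "\<And>i. Y i \<in> Obj C"
  shows "Phi_class C Q X Y M (f \<Zsemi> (r \<odot> \<one> (Y 0))) q = Phi_class C Q X Y N f (slide_act Q X Y r q)"
proof -
  have M: "M \<in> Obj C" and N: "N \<in> Obj C" using r hom_obj by auto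
  have "act_arr C (\<one> M) (\<lambda>i. \<one> (shift X i)) = (\<lambda>i. \<one> (act_obj C M (shift X) i))"
    using X M by (auto simp: act_arr_def act_obj_def)
  then have "FAr Q (act_arr C (\<one> M) (\<lambda>i. \<one> (shift X i)), \<lambda>i. \<one> (shift Y i)) q = q"
    using is_setfunD(2)[OF Q _ _ q] X Y M by simp
  then have "coend_step C (Phi_integrand C Q X Y) (M, (f \<Zsemi> (r \<odot> \<one> (Y 0)), q)) (N, (f, slide_act Q X Y r q))"
    unfolding coend_step_def
    by (intro exI[of _ M] exI[of _ N] exI[of _ r] exI[of _ "(f, q)"])
      (use M N r f q Y in \<open>auto simp: Phi_integrand_def slide_act_def hom_iff\<close>)
  then show ?thesis
    by (simp add: Phi_class_def coend_class_eq_iff r_into_equivclp)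
qed

lemma Phi_invariant:
  assumes Q: "is_setfun (prof_cat C) Q"
    and eq: "equivclp (coend_step C (Phi_integrand C Q X Y)) (M, (f, q)) b"
    and wt: "(M, (f, q)) \<in> Phi_elts Q X Y"
    and X: "\<And>i. X i \<in> Obj C" and Y: "\<And>i. Y i \<in> Obj C"
    and H: "\<And>M N r f q. \<lbrakk>r \<in> hom C N M; f \<in> hom C (X 0) (N \<otimes> Y 0);
      q \<in> FOb Q (act_obj C M (shift X), shift Y)\<rbrakk>
      \<Longrightarrow> F (M, (f \<Zsemi> (r \<odot> \<one> (Y 0)), q)) = F (N, (f, slide_act Q X Y r q))"
  shows "b \<in> Phi_elts Q X Y \<and> F (M, (f, q)) = F b"
  using eq wt
proof (rule equivclp_invariant)
  fix a b assume st: "coend_step C (Phi_integrand C Q X Y) a b"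
  show "a \<in> Phi_elts Q X Y \<longleftrightarrow> b \<in> Phi_elts Q X Y"
    using Q st X Y by (rule Phi_stepE) blast
  show "F a = F b"
    using Q st X Y by (rule Phi_stepE) (use H in blast)
qed

lemma Phi_class_elts:
  assumes Q: "is_setfun (prof_cat C) Q" and "b \<in> Phi_class C Q X Y M f q" "(M, (f, q)) \<in> Phi_elts Q X Y"
    and X: "\<And>i. X i \<in> Obj C" and Y: "\<And>i. Y i \<in> Obj C"
  shows "b \<in> Phi_elts Q X Y"
  using Phi_invariant[where F = "\<lambda>_. ()", OF Q _ assms(3) X Y] assms(2)
  by (simp add: Phi_class_def mem_coend_class_iff)

text \<open>The counterpart of \<open>oelt_UN\<close> for maps out of \<open>Phi\<close>: constancy
  need only be checked across one generator.\<close>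

lemma Phi_class_UN:
  assumes Q: "is_setfun (prof_cat C) Q" and wt: "(M, (f, q)) \<in> Phi_elts Q X Y"
    and X: "\<And>i. X i \<in> Obj C" and Y: "\<And>i. Y i \<in> Obj C"
    and H: "\<And>M N r f q. \<lbrakk>r \<in> hom C N M; f \<in> hom C (X 0) (N \<otimes> Y 0);
      q \<in> FOb Q (act_obj C M (shift X), shift Y)\<rbrakk>
      \<Longrightarrow> H M (f \<Zsemi> (r \<odot> \<one> (Y 0))) q = H N f (slide_act Q X Y r q)"
  shows "(\<Union>(N, (g, p))\<in>Phi_class C Q X Y M f q. H N g p) = H M f q"
proof -
  let ?F = "\<lambda>(N, (g, p)). H N g p"
  have "?F b = H M f q" if "b \<in> Phi_class C Q X Y M f q" for b
    using Phi_invariant[where F = ?F and b = b, OF Q _ wt X Y] H that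
    by (simp add: Phi_class_def mem_coend_class_iff)
  moreover have "(M, (f, q)) \<in> Phi_class C Q X Y M f q"
    by (simp add: Phi_class_def self_mem_coend_class)
  ultimately show ?thesis by blast
qed

lemma Phi_FOb_iff:
  "c \<in> FOb (Phi C Q) (X, Y) \<longleftrightarrow> (\<exists>M f q. (M, (f, q)) \<in> Phi_elts Q X Y \<and> c = Phi_class C Q X Y M f q)"
  by (auto simp: Phi_def mem_coend_iff Phi_class_def Phi_elts_def Phi_integrand_def)

text \<open>Well defined because \<open>r\<close> acts on the memory and \<open>u\<close>,
  \<open>v\<close> act on the visible wires: in either order the composite arrow of
  \<open>prof_cat C\<close> is the same, and functoriality of \<open>Q\<close> turns this into equal
  actions on \<open>q\<close>.\<close>

lemma Phi_FAr:
  assumes Q: "is_setfun (prof_cat C) Q" and wt: "(M, (f, q)) \<in> Phi_elts Q X Y"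
    and u: "\<And>i. u i \<in> hom C (X' i) (X i)" and v: "\<And>i. v i \<in> hom C (Y i) (Y' i)"
  shows "FAr (Phi C Q) (u, v) (Phi_class C Q X Y M f q) =
    Phi_class C Q X' Y' M (u 0 \<Zsemi> f \<Zsemi> (\<one> M \<odot> v 0)) (FAr Q (act_arr C (\<one> M) (shift u), shift v) q)"
proof -
  let ?H = "\<lambda>M f q. Phi_class C Q X' Y' M (u 0 \<Zsemi> f \<Zsemi> (\<one> M \<odot> v 0)) (FAr Q (act_arr C (\<one> M) (shift u), shift v) q)"
  have X: "X i \<in> Obj C" and X': "X' i \<in> Obj C" and Y: "Y i \<in> Obj C" and Y': "Y' i \<in> Obj C" for i
    using hom_obj[OF u[of i]] hom_obj[OF v[of i]] by auto
  note uv = u[unfolded hom_iff] v[unfolded hom_iff]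
  have us: "shift u i \<in> hom C (shift X' i) (shift X i)" and vs: "shift v i \<in> hom C (shift Y i) (shift Y' i)" for i
    using u v by auto
  have iX: "\<one> (shift X i) \<in> hom C (shift X i) (shift X i)" "\<one> (shift X' i) \<in> hom C (shift X' i) (shift X' i)"
    and iY: "\<one> (shift Y i) \<in> hom C (shift Y i) (shift Y i)" "\<one> (shift Y' i) \<in> hom C (shift Y' i) (shift Y' i)" for i
    using X X' Y Y' by (simp_all add: idt_hom)
  have "(\<Union>(N, (g, p))\<in>Phi_class C Q X Y M f q. ?H N g p) = ?H M f q"
  proof (rule Phi_class_UN[OF Q wt X Y])
    fix M N r f q assume r: "r \<in> hom C N M" and f: "f \<in> hom C (X 0) (N \<otimes> Y 0)"
      and q: "q \<in> FOb Q (act_obj C M (shift X), shift Y)"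
    have M: "M \<in> Obj C" and N: "N \<in> Obj C" using r hom_obj by auto
    let ?q = "FAr Q (act_arr C (\<one> M) (shift u), shift v) q"
    have q': "?q \<in> FOb Q (act_obj C M (shift X'), shift Y')"
      by (rule is_setfunD(1)[OF Q act_arr_hom[OF idt_hom[OF M] us] vs q])
    have "slide_act Q X' Y' r ?q = FAr Q (\<lambda>i. act_arr C r (\<lambda>i. \<one> (shift X' i)) i \<Zsemi> act_arr C (\<one> M) (shift u) i,
        \<lambda>i. shift v i \<Zsemi> \<one> (shift Y' i)) q"
      unfolding slide_act_def
      by (rule is_setfunD(3)[OF Q act_arr_hom[OF idt_hom[OF M] us] vs q act_arr_hom[OF r iX(2)] iY(2), symmetric])
    also have "\<dots> = FAr Q (\<lambda>i. act_arr C (\<one> N) (shift u) i \<Zsemi> act_arr C r (\<lambda>i. \<one> (shift X i)) i,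
        \<lambda>i. \<one> (shift Y i) \<Zsemi> shift v i) q"
    proof -
      have "act_arr C r (\<lambda>i. \<one> (shift X' i)) i \<Zsemi> act_arr C (\<one> M) (shift u) i
          = act_arr C (\<one> N) (shift u) i \<Zsemi> act_arr C r (\<lambda>i. \<one> (shift X i)) i" for i
        using uv r X X' M N by (cases i) (auto simp: hom_iff)
      moreover have "shift v i \<Zsemi> \<one> (shift Y' i) = \<one> (shift Y i) \<Zsemi> shift v i" for i
        using uv Y Y' by simp
      ultimately show ?thesis by simp
    qed
    also have "\<dots> = FAr Q (act_arr C (\<one> N) (shift u), shift v) (slide_act Q X Y r q)"
      unfolding slide_act_def
      by (rule is_setfunD(3)[OF Q act_arr_hom[OF r iX(1)] iY(1) q act_arr_hom[OF idt_hom[OF N] us] vs])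
    finally have sl: "slide_act Q X' Y' r ?q = FAr Q (act_arr C (\<one> N) (shift u), shift v) (slide_act Q X Y r q)" .
    have "?H M (f \<Zsemi> (r \<odot> \<one> (Y 0))) q = Phi_class C Q X' Y' M ((u 0 \<Zsemi> f \<Zsemi> (\<one> N \<odot> v 0)) \<Zsemi> (r \<odot> \<one> (Y' 0))) ?q"
      using uv r f M N Y Y' by (simp add: hom_iff)
    also have "\<dots> = Phi_class C Q X' Y' N (u 0 \<Zsemi> f \<Zsemi> (\<one> N \<odot> v 0)) (slide_act Q X' Y' r ?q)"
      using uv f N by (intro Phi_step[OF Q r _ q' X' Y']) (simp add: hom_iff)
    finally show "?H M (f \<Zsemi> (r \<odot> \<one> (Y 0))) q = ?H N f (slide_act Q X Y r q)"
      by (simp add: sl)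
  qed
  then show ?thesis by (simp add: Phi_def uv)
qed

lemma slide_act_oelt:
  assumes wt: "(N, g) \<in> seqs UNIV (act_obj C M (shift X)) (shift Y)" and r: "r \<in> hom C M' M"
    and X: "\<And>i. X i \<in> Obj C" and Y: "\<And>i. Y i \<in> Obj C"
  shows "slide_act (oSeq C) X Y r (oelt (act_obj C M (shift X)) (shift Y) N g)
    = oelt (act_obj C M' (shift X)) (shift Y) N (head_act X r g)"
proof -
  have "act_seq (act_arr C r (\<lambda>i. \<one> (shift X i))) (\<lambda>i. \<one> (shift Y i)) N g i = head_act X r g i" for i
    using seqsD[OF wt, of i] seqsD[OF wt, of "i - 1"] r X Y
    by (cases i) (auto simp: act_seq_simps head_act_def hom_iff)
  then have "act_seq (act_arr C r (\<lambda>i. \<one> (shift X i))) (\<lambda>i. \<one> (shift Y i)) N g = head_act X r g" by blast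
  moreover have "FAr (oSeq C) (act_arr C r (\<lambda>i. \<one> (shift X i)), \<lambda>i. \<one> (shift Y i)) (oelt (act_obj C M (shift X)) (shift Y) N g)
    = oelt (act_obj C M' (shift X)) (shift Y) N (act_seq (act_arr C r (\<lambda>i. \<one> (shift X i))) (\<lambda>i. \<one> (shift Y i)) N g)"
    by (rule oSeq_FAr[OF wt act_arr_hom[OF r]]) (simp_all add: X Y idt_hom)
  ultimately show ?thesis by (simp add: slide_act_def)
qed

text \<open>This will be the inverse of the coalgebra structure. \<open>unpad\<close> is taken over
  \<open>act_obj C M (shift X)\<close> because the tail has its own unit in front of its first
  input.\<close>

definition cons_elt :: "(nat \<Rightarrow> 'o) \<Rightarrow> (nat \<Rightarrow> 'o) \<Rightarrow> 'o \<Rightarrow> 'a \<Rightarrow>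
    ((nat \<Rightarrow> 'o) \<times> (nat \<Rightarrow> 'a)) set set \<Rightarrow> ((nat \<Rightarrow> 'o) \<times> (nat \<Rightarrow> 'a)) set set" where
  "cons_elt X Y M f c = (\<Union>a\<in>c. \<Union>(N, h)\<in>a. oelt X Y (prev M N) (prev f (unpad (act_obj C M (shift X)) h)))"

lemma cons_elt_oelt:
  assumes wt: "(N, g) \<in> seqs UNIV (act_obj C M (shift X)) (shift Y)" and M: "M \<in> Obj C"
    and f: "f \<in> hom C (X 0) (M \<otimes> Y 0)"
    and X: "\<And>i. X i \<in> Obj C" and Y: "\<And>i. Y i \<in> Obj C"
  shows "cons_elt X Y M f (oelt (act_obj C M (shift X)) (shift Y) N g) = oelt X Y (prev M N) (prev f g)"
  unfolding cons_elt_def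
proof (rule oelt_UN[OF wt])
  let ?X = "act_obj C M (shift X)"
  fix N' g' assume wt': "(N', g') \<in> seqs UNIV ?X (shift Y)"
    and st: "\<And>n. steq {..n} ?X (shift Y) (N, g) (N', g')"
  have "unpad ?X (pad ?X g') = g'"
    using seqsD(2)[OF wt', of 0] X M by (intro unpad_pad) (auto simp: hom_iff)
  moreover have "oelt X Y (prev M N') (prev f g') = oelt X Y (prev M N) (prev f g)"
  proof -
    have "steq {..n} X Y (prev M N', prev f g') (prev M N, prev f g)" for n
      by (rule steq_cons[OF equivclp_sym[OF st[of n]] f M Y X]) simp
    then show ?thesis
      using oelt_eq_iff[OF seqs_prev[OF wt' f M] seqs_prev[OF wt f M] X Y] by simp
  qed
  ultimately show "oelt X Y (prev M N') (prev f (unpad ?X (pad ?X g'))) = oelt X Y (prev M N) (prev f g)"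
    by simp
qed (use X Y M in auto)

lemma oSeq_eltE:
  assumes "(M, (f, q)) \<in> Phi_elts (oSeq C) X Y" and X: "\<And>i. X i \<in> Obj C" and Y: "\<And>i. Y i \<in> Obj C"
  obtains N g where "(N, g) \<in> seqs UNIV (act_obj C M (shift X)) (shift Y)"
    "q = oelt (act_obj C M (shift X)) (shift Y) N g" "M \<in> Obj C" "f \<in> hom C (X 0) (M \<otimes> Y 0)"
proof -
  have M: "M \<in> Obj C" and f: "f \<in> hom C (X 0) (M \<otimes> Y 0)"
    and q: "q \<in> FOb (oSeq C) (act_obj C M (shift X), shift Y)"
    using assms(1) by (auto simp: Phi_elts_def)
  have "act_obj C M (shift X) i \<in> Obj C" "shift Y i \<in> Obj C" for i using X Y M by auto
  then show ?thesis using that q M f by (auto simp: oSeq_FOb_iff)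
qed

text \<open>A generator of the coend in \<open>Phi\<close> becomes the single slide of
  \<open>slide_head\<close>, which restricts to every stage.\<close>

lemma cons_elt_class:
  assumes eq: "Phi_class C (oSeq C) X Y M f q = Phi_class C (oSeq C) X Y M' f' q'"
    and wt: "(M, (f, q)) \<in> Phi_elts (oSeq C) X Y"
    and X: "\<And>i. X i \<in> Obj C" and Y: "\<And>i. Y i \<in> Obj C"
  shows "cons_elt X Y M f q = cons_elt X Y M' f' q'"
proof -
  let ?F = "\<lambda>(M, (f, q)). cons_elt X Y M f q"
  have "?F (M, (f, q)) = ?F (M', (f', q'))"
  proof (rule Phi_invariant[OF oSeq_setfun _ wt X Y, THEN conjunct2])
    show "equivclp (coend_step C (Phi_integrand C (oSeq C) X Y)) (M, (f, q)) (M', (f', q'))"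
      using eq by (simp add: Phi_class_def coend_class_eq_iff)
    fix M N r f q assume r: "r \<in> hom C N M" and f: "f \<in> hom C (X 0) (N \<otimes> Y 0)"
      and q: "q \<in> FOb (oSeq C) (act_obj C M (shift X), shift Y)"
    have M: "M \<in> Obj C" and N: "N \<in> Obj C" using r hom_obj by auto
    have fr: "f \<Zsemi> (r \<odot> \<one> (Y 0)) \<in> hom C (X 0) (M \<otimes> Y 0)"
      using f r Y by (simp add: hom_iff)
    then have "(M, (f \<Zsemi> (r \<odot> \<one> (Y 0)), q)) \<in> Phi_elts (oSeq C) X Y"
      using q M by (simp add: Phi_elts_def)
    then obtain K g where g: "(K, g) \<in> seqs UNIV (act_obj C M (shift X)) (shift Y)"
      and q: "q = oelt (act_obj C M (shift X)) (shift Y) K g"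
      using X Y by (rule oSeq_eltE)
    have g': "(K, head_act X r g) \<in> seqs UNIV (act_obj C N (shift X)) (shift Y)"
      unfolding head_act_def by (rule seqs_head_slide[OF g r Y X])
    have "slide {..n} X Y (prev M K, prev (f \<Zsemi> (r \<odot> \<one> (Y 0))) g) (prev N K, prev f (head_act X r g))" for n
      unfolding head_act_def
      by (rule slide_mono[OF slide_head[OF g f r Y X]]) auto
    then have "oelt X Y (prev M K) (prev (f \<Zsemi> (r \<odot> \<one> (Y 0))) g) = oelt X Y (prev N K) (prev f (head_act X r g))"
      using oelt_eq_iff[OF seqs_prev[OF g fr M] seqs_prev[OF g' f N] X Y] by auto
    then show "?F (M, (f \<Zsemi> (r \<odot> \<one> (Y 0)), q)) = ?F (N, (f, slide_act (oSeq C) X Y r q))"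
      unfolding q slide_act_oelt[OF g r X Y] prod.case
      by (simp only: cons_elt_oelt[OF g M fr X Y] cons_elt_oelt[OF g' N f X Y])
  qed
  then show ?thesis by simp
qed

end

section \<open>Splitting off the first component\<close>

locale productive_category = symmetric_monoidal_category +
  assumes productive: "productive C"
begin

text \<open>Both sides are rewritten as classes with the same head \<open>a0\<close> over
  \<open>P\<close>: the arrows \<open>s\<close> are slid from the heads into the tails by
  \<open>Phi_step\<close>. The resulting tails agree at stage \<open>n\<close> because the given
  sequences agree at stage \<open>Suc n\<close>.\<close>

lemma Phi_class_tail_eq:
  assumes wt: "(M, f) \<in> seqs UNIV X Y" "(N, g) \<in> seqs UNIV X Y"
    and st: "\<And>n. steq {..n} X Y (M, f) (N, g)"
    and X: "\<And>i. X i \<in> Obj C" and Y: "\<And>i. Y i \<in> Obj C"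
  shows "Phi_class C (oSeq C) X Y (M 0) (f 0) (oelt (act_obj C (M 0) (shift X)) (shift Y) (shift M) (shift f))
    = Phi_class C (oSeq C) X Y (N 0) (g 0) (oelt (act_obj C (N 0) (shift X)) (shift Y) (shift N) (shift g))"
proof -
  define \<alpha> where \<alpha>: "\<alpha> = coend_class C (out_fun C (X 0) (Y 0)) (M 0) (f 0)"
  have "\<alpha> \<in> coend C (out_fun C (X 0) (Y 0))"
    unfolding mem_coend_iff \<alpha> using seqsD[OF wt(1), of 0]
    by (intro exI[of _ "M 0"] exI[of _ "f 0"]) (simp add: out_fun_def)
  then have "terminating C (X 0) (Y 0) \<alpha>"
    using productive X Y by (simp add: productive_def)
  then obtain P a0 s where ft: "factors_through (X 0) (Y 0) \<alpha> P a0 s"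
    unfolding terminating_iff by blast
  have M0: "(M 0, f 0) \<in> \<alpha>" by (simp add: \<alpha> self_mem_coend_class)
  note tail = steq_tail[OF ft st \<alpha> M0 X Y]
  have N0: "(N 0, g 0) \<in> \<alpha>" using tail by blast
  have reduce: "Phi_class C (oSeq C) X Y (L 0) (h 0) (oelt (act_obj C (L 0) (shift X)) (shift Y) (shift L) (shift h))
      = Phi_class C (oSeq C) X Y P a0 (oelt (act_obj C P (shift X)) (shift Y) (shift L) (head_act X (s (L 0) (h 0)) (shift h)))
      \<and> (shift L, head_act X (s (L 0) (h 0)) (shift h)) \<in> seqs UNIV (act_obj C P (shift X)) (shift Y)"
    if L: "(L, h) \<in> seqs UNIV X Y" "(L 0, h 0) \<in> \<alpha>" for L h
  proof -
    have s: "s (L 0) (h 0) \<in> hom C P (L 0)" and h: "h 0 = a0 \<Zsemi> (s (L 0) (h 0) \<odot> \<one> (Y 0))"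
      using factors_throughD(3,4)[OF ft L(2)] .
    have t: "(shift L, shift h) \<in> seqs UNIV (act_obj C (L 0) (shift X)) (shift Y)"
      by (rule seqs_tail[OF L(1)]) simp
    have q: "oelt (act_obj C (L 0) (shift X)) (shift Y) (shift L) (shift h)
        \<in> FOb (oSeq C) (act_obj C (L 0) (shift X), shift Y)"
      using t X Y seqsD(1)[OF L(1), of 0] by (subst oSeq_FOb_iff) auto
    have "Phi_class C (oSeq C) X Y (L 0) (a0 \<Zsemi> (s (L 0) (h 0) \<odot> \<one> (Y 0)))
          (oelt (act_obj C (L 0) (shift X)) (shift Y) (shift L) (shift h))
        = Phi_class C (oSeq C) X Y P a0 (slide_act (oSeq C) X Y (s (L 0) (h 0))
          (oelt (act_obj C (L 0) (shift X)) (shift Y) (shift L) (shift h)))"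
      by (rule Phi_step[OF oSeq_setfun s factors_throughD(2)[OF ft] q X Y])
    then show ?thesis
      unfolding slide_act_oelt[OF t s X Y] using h seqs_head_slide[OF t s Y X] by (simp add: head_act_def)
  qed
  have "oelt (act_obj C P (shift X)) (shift Y) (shift M) (head_act X (s (M 0) (f 0)) (shift f))
      = oelt (act_obj C P (shift X)) (shift Y) (shift N) (head_act X (s (N 0) (g 0)) (shift g))"
    using oelt_eq_iff[OF conjunct2[OF reduce[OF wt(1) M0]] conjunct2[OF reduce[OF wt(2) N0]]]
      tail X Y factors_throughD(1)[OF ft] by simp
  then show ?thesis using reduce[OF wt(1) M0] reduce[OF wt(2) N0] by simp
qed

lemma oSeq_coalg_oelt:
  assumes wt: "(M, f) \<in> seqs UNIV X Y" and X: "\<And>i. X i \<in> Obj C" and Y: "\<And>i. Y i \<in> Obj C"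
  shows "oSeq_coalg C (X, Y) (oelt X Y M f) = Phi_class C (oSeq C) X Y (M 0) (f 0)
    (oelt (act_obj C (M 0) (shift X)) (shift Y) (shift M) (shift f))"
proof -
  let ?H = "\<lambda>M f. Phi_class C (oSeq C) X Y (M 0) (lunit_inv (X 0) \<Zsemi> f 0)
          (oSeq_class C (act_obj C (M 0) (shift X)) (shift Y) (shift M)
             ((shift f)(0 := lunit C (M 0 \<otimes> X 1) \<Zsemi> f 1)))"
  have "?H N (pad X g) = Phi_class C (oSeq C) X Y (M 0) (f 0)
      (oelt (act_obj C (M 0) (shift X)) (shift Y) (shift M) (shift f))"
    if wt': "(N, g) \<in> seqs UNIV X Y" and st: "\<And>n. steq {..n} X Y (M, f) (N, g)" for N g
  proof -
    \<comment> \<open>\<open>shift\<close> discards the padded component, so the tail is unpadded;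
      the \<open>lunit\<close> that \<open>oSeq_coalg\<close> inserts before component
      \<open>1\<close> is exactly its missing padding.\<close>
    have "(shift (pad X g))(0 := lunit C (N 0 \<otimes> X 1) \<Zsemi> pad X g 1) = pad (act_obj C (N 0) (shift X)) (shift g)"
      by (auto simp: pad_def)
    moreover have "lunit_inv (X 0) \<Zsemi> pad X g 0 = g 0"
      using seqsD(2)[OF wt', of 0] X by (auto simp: hom_iff)
    ultimately have "?H N (pad X g) = Phi_class C (oSeq C) X Y (N 0) (g 0)
        (oelt (act_obj C (N 0) (shift X)) (shift Y) (shift N) (shift g))"
      by (simp only: oelt_def)
    then show ?thesis using Phi_class_tail_eq[OF wt wt' st X Y] by simp
  qed
  then have "(\<Union>a\<in>oelt X Y M f. \<Union>(N, h)\<in>a. ?H N h) = Phi_class C (oSeq C) X Y (M 0) (f 0)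
      (oelt (act_obj C (M 0) (shift X)) (shift Y) (shift M) (shift f))"
    by (rule oelt_UN[OF wt X Y])
  moreover have "oelt X Y M f \<in> FOb (oSeq C) (X, Y)" using wt X Y by (auto simp: oSeq_FOb_iff)
  ultimately show ?thesis using X Y by (simp add: oSeq_coalg_def)
qed

lemma oSeq_tail_elts:
  assumes wt: "(M, f) \<in> seqs UNIV X Y" and X: "\<And>i. X i \<in> Obj C" and Y: "\<And>i. Y i \<in> Obj C"
  shows "(M 0, (f 0, oelt (act_obj C (M 0) (shift X)) (shift Y) (shift M) (shift f))) \<in> Phi_elts (oSeq C) X Y"
proof -
  have M: "M 0 \<in> Obj C" "f 0 \<in> hom C (X 0) (M 0 \<otimes> Y 0)" using seqsD[OF wt, of 0] by auto
  have t: "(shift M, shift f) \<in> seqs UNIV (act_obj C (M 0) (shift X)) (shift Y)"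
    by (rule seqs_tail[OF wt]) simp
  have "oelt (act_obj C (M 0) (shift X)) (shift Y) (shift M) (shift f) \<in> FOb (oSeq C) (act_obj C (M 0) (shift X), shift Y)"
    using t X Y M by (subst oSeq_FOb_iff) auto
  then show ?thesis using M by (simp add: Phi_elts_def)
qed

lemma oSeq_coalg_cons:
  assumes wt: "(M, (f, q)) \<in> Phi_elts (oSeq C) X Y" and X: "\<And>i. X i \<in> Obj C" and Y: "\<And>i. Y i \<in> Obj C"
  shows "oSeq_coalg C (X, Y) (cons_elt X Y M f q) = Phi_class C (oSeq C) X Y M f q"
    and "cons_elt X Y M f q \<in> FOb (oSeq C) (X, Y)"
proof -
  obtain N g where g: "(N, g) \<in> seqs UNIV (act_obj C M (shift X)) (shift Y)"
    and q: "q = oelt (act_obj C M (shift X)) (shift Y) N g" and M: "M \<in> Obj C" and f: "f \<in> hom C (X 0) (M \<otimes> Y 0)"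
    using wt X Y by (rule oSeq_eltE)
  have p: "(prev M N, prev f g) \<in> seqs UNIV X Y" by (rule seqs_prev[OF g f M]) simp
  note c = cons_elt_oelt[OF g M f X Y]
  show "oSeq_coalg C (X, Y) (cons_elt X Y M f q) = Phi_class C (oSeq C) X Y M f q"
    unfolding q c oSeq_coalg_oelt[OF p X Y] by simp
  show "cons_elt X Y M f q \<in> FOb (oSeq C) (X, Y)"
    unfolding q c using p X Y by (auto simp: oSeq_FOb_iff)
qed

text \<open>The class may be given by any representative, since a chain connects it to the typed one
  computed from \<open>c\<close>. This yields injectivity and, later, the recursion equation of a
  coalgebra morphism.\<close>

lemma cons_oSeq_coalg:
  assumes c: "c \<in> FOb (oSeq C) (X, Y)" and eq: "oSeq_coalg C (X, Y) c = Phi_class C (oSeq C) X Y M f q"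
    and X: "\<And>i. X i \<in> Obj C" and Y: "\<And>i. Y i \<in> Obj C"
  shows "c = cons_elt X Y M f q"
proof -
  obtain N g where wt: "(N, g) \<in> seqs UNIV X Y" and c: "c = oelt X Y N g"
    using c X Y by (auto simp: oSeq_FOb_iff)
  have N: "N 0 \<in> Obj C" "g 0 \<in> hom C (X 0) (N 0 \<otimes> Y 0)" using seqsD[OF wt, of 0] by auto
  have t: "(shift N, shift g) \<in> seqs UNIV (act_obj C (N 0) (shift X)) (shift Y)"
    by (rule seqs_tail[OF wt]) simp
  have "cons_elt X Y (N 0) (g 0) (oelt (act_obj C (N 0) (shift X)) (shift Y) (shift N) (shift g)) = cons_elt X Y M f q"
    using eq by (intro cons_elt_class[OF _ oSeq_tail_elts[OF wt X Y] X Y]) (simp add: c oSeq_coalg_oelt[OF wt X Y])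
  then show ?thesis by (simp add: c cons_elt_oelt[OF t N X Y] prev_head_tail)
qed

lemma oSeq_coalgebra: "Phi_coalgebra C (oSeq C) (oSeq_coalg C)"
  unfolding Phi_coalgebra_def is_nat_trans_def
proof (intro conjI oSeq_setfun ballI)
  have "oSeq_coalg C (X, Y) c \<in> FOb (Phi C (oSeq C)) (X, Y)"
    if X: "\<And>i. X i \<in> Obj C" and Y: "\<And>i. Y i \<in> Obj C" and c: "c \<in> FOb (oSeq C) (X, Y)" for X Y c
  proof -
    obtain M f where wt: "(M, f) \<in> seqs UNIV X Y" and c: "c = oelt X Y M f"
      using c X Y by (auto simp: oSeq_FOb_iff)
    show ?thesis
      unfolding c oSeq_coalg_oelt[OF wt X Y] Phi_FOb_iff using oSeq_tail_elts[OF wt X Y] by blast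
  qed
  then show "oSeq_coalg C \<in> (\<Pi>\<^sub>E A\<in>Obj (prof_cat C). FOb (oSeq C) A \<rightarrow>\<^sub>E FOb (Phi C (oSeq C)) A)"
    by (auto simp: oSeq_coalg_def)
next
  fix a c assume a: "a \<in> Arr (prof_cat C)" and c: "c \<in> FOb (oSeq C) (Src (prof_cat C) a)"
  obtain u v where uv: "a = (u, v)" by (cases a)
  define X X' Y Y' where d: "X = (\<lambda>i. Tgt C (u i))" "X' = (\<lambda>i. Src C (u i))" "Y = (\<lambda>i. Src C (v i))" "Y' = (\<lambda>i. Tgt C (v i))"
  have u: "u i \<in> hom C (X' i) (X i)" and v: "v i \<in> hom C (Y i) (Y' i)" for i
    using a by (auto simp: hom_iff d uv)
  have X: "X i \<in> Obj C" and X': "X' i \<in> Obj C" and Y: "Y i \<in> Obj C" and Y': "Y' i \<in> Obj C" for i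
    using hom_obj[OF u[of i]] hom_obj[OF v[of i]] by auto
  have ST: "Src (prof_cat C) a = (X, Y)" "Tgt (prof_cat C) a = (X', Y')" by (simp_all add: uv d)
  obtain M f where wt: "(M, f) \<in> seqs UNIV X Y" and c: "c = oelt X Y M f"
    using c X Y by (auto simp: oSeq_FOb_iff ST)
  have M: "M 0 \<in> Obj C" using seqsD[OF wt, of 0] by auto
  have t: "(shift M, shift f) \<in> seqs UNIV (act_obj C (M 0) (shift X)) (shift Y)"
    by (rule seqs_tail[OF wt]) simp
  have "FAr (oSeq C) (act_arr C (\<one> (M 0)) (shift u), shift v) (oelt (act_obj C (M 0) (shift X)) (shift Y) (shift M) (shift f))
      = oelt (act_obj C (M 0) (shift X')) (shift Y') (shift M) (shift (act_seq u v M f))"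
    unfolding act_seq_shift by (rule oSeq_FAr[OF t act_arr_hom[OF idt_hom[OF M]]]) (simp_all add: u v)
  then show "oSeq_coalg C (Tgt (prof_cat C) a) (FAr (oSeq C) a c)
      = FAr (Phi C (oSeq C)) a (oSeq_coalg C (Src (prof_cat C) a) c)"
    unfolding ST unfolding uv c oSeq_FAr[OF wt u v] oSeq_coalg_oelt[OF wt X Y]
      oSeq_coalg_oelt[OF act_seq_seqs[OF wt u v] X' Y', OF UNIV_I]
      Phi_FAr[OF oSeq_setfun oSeq_tail_elts[OF wt X Y] u v] act_seq_simps by simp
qed

lemma oSeq_fixpoint: "Phi_fixpoint C (oSeq C) (oSeq_coalg C)"
  unfolding Phi_fixpoint_def
proof (intro conjI oSeq_coalgebra ballI)
  fix A assume A: "A \<in> Obj (prof_cat C)"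
  obtain X Y where [simp]: "A = (X, Y)" by (cases A)
  have X: "X i \<in> Obj C" and Y: "Y i \<in> Obj C" for i using A by auto
  have mem: "oSeq_coalg C A c \<in> FOb (Phi C (oSeq C)) A" if "c \<in> FOb (oSeq C) A" for c
    using oSeq_coalgebra A that unfolding Phi_coalgebra_def is_nat_trans_def by auto
  have "c = d" if c: "c \<in> FOb (oSeq C) A" and d: "d \<in> FOb (oSeq C) A" and eq: "oSeq_coalg C A c = oSeq_coalg C A d" for c d
  proof -
    obtain M f q where m: "oSeq_coalg C (X, Y) c = Phi_class C (oSeq C) X Y M f q"
      using mem[OF c] by (auto simp: Phi_FOb_iff)
    have "c = cons_elt X Y M f q" "d = cons_elt X Y M f q"
      by (rule cons_oSeq_coalg[OF _ _ X Y]; use c d eq m in simp)+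
    then show ?thesis by simp
  qed
  moreover have "c \<in> oSeq_coalg C A ` FOb (oSeq C) A" if "c \<in> FOb (Phi C (oSeq C)) A" for c
  proof -
    obtain M f q where m: "(M, (f, q)) \<in> Phi_elts (oSeq C) X Y" "c = Phi_class C (oSeq C) X Y M f q"
      using \<open>c \<in> FOb (Phi C (oSeq C)) A\<close> by (auto simp: Phi_FOb_iff)
    show ?thesis
      using oSeq_coalg_cons[OF m(1) X Y] m(2) by (metis \<open>A = (X, Y)\<close> imageI)
  qed
  ultimately show "bij_betw (oSeq_coalg C A) (FOb (oSeq C) A) (FOb (Phi C (oSeq C)) A)"
    unfolding bij_betw_def inj_on_def using mem by blast
qed

end

section \<open>Finality\<close>

lemma nat_trans_mem:
  assumes "is_nat_trans D F G \<eta>" "A \<in> Obj D" "x \<in> FOb F A"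
  shows "\<eta> A x \<in> FOb G A"
  using PiE_mem[OF PiE_mem[OF conjunct1[OF assms(1)[unfolded is_nat_trans_def]] assms(2)] assms(3)] .

locale coalgebra = productive_category C for C :: "('o, 'a, 'm) smc_scheme" (structure) +
  fixes Q :: "('o, 'a, 'q) prof" and \<gamma>
  assumes coalgebra: "Phi_coalgebra C Q \<gamma>"
begin

lemma Q_setfun: "is_setfun (prof_cat C) Q"
  using coalgebra by (simp add: Phi_coalgebra_def)

lemma \<gamma>_class:
  assumes X: "\<And>i. X i \<in> Obj C" and Y: "\<And>i. Y i \<in> Obj C" and q: "q \<in> FOb Q (X, Y)"
  obtains M f p where "(M, (f, p)) \<in> Phi_elts Q X Y" "\<gamma> (X, Y) q = Phi_class C Q X Y M f p"
proof -
  have "\<gamma> (X, Y) q \<in> FOb (Phi C Q) (X, Y)"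
    using coalgebra X Y q by - (rule nat_trans_mem[of "prof_cat C" Q]; simp add: Phi_coalgebra_def)
  then show ?thesis using that by (auto simp: Phi_FOb_iff)
qed

lemma \<gamma>_mem:
  assumes X: "\<And>i. X i \<in> Obj C" and Y: "\<And>i. Y i \<in> Obj C" and q: "q \<in> FOb Q (X, Y)"
    and b: "(N, (g, p)) \<in> \<gamma> (X, Y) q"
  shows "(N, (g, p)) \<in> Phi_elts Q X Y" "\<gamma> (X, Y) q = Phi_class C Q X Y N g p"
proof -
  obtain M f p' where m: "(M, (f, p')) \<in> Phi_elts Q X Y" and c: "\<gamma> (X, Y) q = Phi_class C Q X Y M f p'"
    using X Y q by (rule \<gamma>_class)
  show "(N, (g, p)) \<in> Phi_elts Q X Y"
    using b by (intro Phi_class_elts[OF Q_setfun _ m X Y]) (simp add: c)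
  show "\<gamma> (X, Y) q = Phi_class C Q X Y N g p"
    using b unfolding c Phi_class_def by (rule mem_coend_classD[symmetric])
qed

text \<open>Stated by membership: the image of a representative represents the image, although
  \<open>rep\<close> may choose another one there.\<close>

lemma \<gamma>_natural:
  assumes q: "q \<in> FOb Q (X, Y)" and b: "(M, (f, p)) \<in> \<gamma> (X, Y) q"
    and u: "\<And>i. u i \<in> hom C (X' i) (X i)" and v: "\<And>i. v i \<in> hom C (Y i) (Y' i)"
  shows "(M, (u 0 \<Zsemi> f \<Zsemi> (\<one> M \<odot> v 0), FAr Q (act_arr C (\<one> M) (shift u), shift v) p))
    \<in> \<gamma> (X', Y') (FAr Q (u, v) q)"
proof -
  have X: "X i \<in> Obj C" and Y: "Y i \<in> Obj C" for i
    using hom_obj[OF u[of i]] hom_obj[OF v[of i]] by auto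
  have ST: "Src (prof_cat C) (u, v) = (X, Y)" "Tgt (prof_cat C) (u, v) = (X', Y')"
    using u v by (auto simp: hom_iff)
  have "(u, v) \<in> Arr (prof_cat C)" using u v by (auto simp: hom_iff)
  then have "\<gamma> (Tgt (prof_cat C) (u, v)) (FAr Q (u, v) q) = FAr (Phi C Q) (u, v) (\<gamma> (Src (prof_cat C) (u, v)) q)"
    using coalgebra q unfolding Phi_coalgebra_def is_nat_trans_def ST[symmetric] by blast
  then have "\<gamma> (X', Y') (FAr Q (u, v) q) = FAr (Phi C Q) (u, v) (\<gamma> (X, Y) q)"
    unfolding ST .
  also have "\<dots> = Phi_class C Q X' Y' M (u 0 \<Zsemi> f \<Zsemi> (\<one> M \<odot> v 0)) (FAr Q (act_arr C (\<one> M) (shift u), shift v) p)"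
    unfolding \<gamma>_mem(2)[OF X Y q b] by (rule Phi_FAr[OF Q_setfun \<gamma>_mem(1)[OF X Y q b] u v])
  finally show ?thesis by (simp add: Phi_class_def self_mem_coend_class)
qed

text \<open>A state carries the pair \<open>(X, Y)\<close> along with the element, because the index
  of the next element depends on the memory object that was chosen.\<close>

definition rep :: "((nat \<Rightarrow> 'o) \<times> (nat \<Rightarrow> 'o)) \<times> 'q \<Rightarrow> 'o \<times> ('a \<times> 'q)" where
  "rep x = (SOME b. b \<in> \<gamma> (fst x) (snd x))"

definition next_state :: "((nat \<Rightarrow> 'o) \<times> (nat \<Rightarrow> 'o)) \<times> 'q \<Rightarrow> ((nat \<Rightarrow> 'o) \<times> (nat \<Rightarrow> 'o)) \<times> 'q" where
  "next_state x = ((act_obj C (fst (rep x)) (shift (fst (fst x))), shift (snd (fst x))), snd (snd (rep x)))"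

definition memory :: "((nat \<Rightarrow> 'o) \<times> (nat \<Rightarrow> 'o)) \<times> 'q \<Rightarrow> nat \<Rightarrow> 'o" where
  "memory x n = fst (rep ((next_state ^^ n) x))"

definition process :: "((nat \<Rightarrow> 'o) \<times> (nat \<Rightarrow> 'o)) \<times> 'q \<Rightarrow> nat \<Rightarrow> 'a" where
  "process x n = fst (snd (rep ((next_state ^^ n) x)))"

lemma rep_mem:
  assumes X: "\<And>i. X i \<in> Obj C" and Y: "\<And>i. Y i \<in> Obj C" and q: "q \<in> FOb Q (X, Y)"
  shows "rep ((X, Y), q) \<in> \<gamma> (X, Y) q"
proof -
  obtain M f p where "\<gamma> (X, Y) q = Phi_class C Q X Y M f p"
    using X Y q by (rule \<gamma>_class)
  then have "(M, (f, p)) \<in> \<gamma> (X, Y) q" by (simp add: Phi_class_def self_mem_coend_class)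
  then have "\<exists>b. b \<in> \<gamma> (X, Y) q" by blast
  then show ?thesis unfolding rep_def fst_conv snd_conv by (rule someI_ex)
qed

lemma unfold_rep:
  assumes "rep ((X, Y), q) = (M, (f, p))"
  shows "memory ((X, Y), q) = prev M (memory ((act_obj C M (shift X), shift Y), p))"
    and "process ((X, Y), q) = prev f (process ((act_obj C M (shift X), shift Y), p))"
proof -
  have n: "next_state ((X, Y), q) = ((act_obj C M (shift X), shift Y), p)"
    by (simp add: next_state_def assms)
  have "memory ((X, Y), q) i = prev M (memory ((act_obj C M (shift X), shift Y), p)) i"
    "process ((X, Y), q) i = prev f (process ((act_obj C M (shift X), shift Y), p)) i" for i
    by (cases i; simp add: memory_def process_def assms n funpow_swap1 del: funpow.simps;
      simp add: assms n funpow_Suc_right del: funpow.simps)+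
  then show "memory ((X, Y), q) = prev M (memory ((act_obj C M (shift X), shift Y), p))"
    "process ((X, Y), q) = prev f (process ((act_obj C M (shift X), shift Y), p))" by blast+
qed

text \<open>Typing of an infinite unfolding is cut down to \<open>{..<n}\<close> to allow an
  induction that varies \<open>X\<close>, \<open>Y\<close> and \<open>q\<close>; the strict bound
  makes the base case vacuous.\<close>

lemma unfold_seqs_finite:
  assumes "\<And>i. X i \<in> Obj C" and "\<And>i. Y i \<in> Obj C" and "q \<in> FOb Q (X, Y)"
  shows "(memory ((X, Y), q), process ((X, Y), q)) \<in> seqs {..<n} X Y"
  using assms
proof (induction n arbitrary: X Y q)
  case 0
  then show ?case by (simp add: seqs_def)
next
  case (Suc n)
  note X = Suc.prems(1) and Y = Suc.prems(2) and q = Suc.prems(3)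
  obtain M f p where r: "rep ((X, Y), q) = (M, (f, p))" by (cases "rep ((X, Y), q)")
  have m: "(M, (f, p)) \<in> Phi_elts Q X Y"
    using rep_mem[OF X Y q] by (intro \<gamma>_mem(1)[OF X Y q]) (simp add: r)
  then have M: "M \<in> Obj C" "f \<in> hom C (X 0) (M \<otimes> Y 0)" "p \<in> FOb Q (act_obj C M (shift X), shift Y)"
    by (auto simp: Phi_elts_def)
  have "(memory ((act_obj C M (shift X), shift Y), p), process ((act_obj C M (shift X), shift Y), p))
      \<in> seqs {..<n} (act_obj C M (shift X)) (shift Y)"
  proof (rule Suc.IH)
    show "act_obj C M (shift X) i \<in> Obj C" "shift Y i \<in> Obj C" for i using X Y M by auto
    show "p \<in> FOb Q (act_obj C M (shift X), shift Y)" by (rule M)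
  qed
  then show ?case
    unfolding unfold_rep[OF r] by (rule seqs_prev) (use M in auto)
qed

lemma unfold_seqs:
  assumes X: "\<And>i. X i \<in> Obj C" and Y: "\<And>i. Y i \<in> Obj C" and q: "q \<in> FOb Q (X, Y)"
  shows "(memory ((X, Y), q), process ((X, Y), q)) \<in> seqs UNIV X Y"
  using unfold_seqs_finite[OF X Y q] seqsD[of _ _ "{..<Suc i}" X Y i for i] unfolding seqs_def by blast

text \<open>
  The two statements need a simultaneous induction: independence of the representative at one stage
  uses naturality at the previous stage, and naturality at a stage uses independence at that stage.
\<close>

lemma
  shows unfold_natural: "\<lbrakk>q \<in> FOb Q (X, Y); \<And>i. u i \<in> hom C (X' i) (X i); \<And>i. v i \<in> hom C (Y i) (Y' i)\<rbrakk>
      \<Longrightarrow> steq {..<n} X' Y' (memory ((X', Y'), FAr Q (u, v) q), process ((X', Y'), FAr Q (u, v) q))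
        (memory ((X, Y), q), act_seq u v (memory ((X, Y), q)) (process ((X, Y), q)))"
    and unfold_any_rep: "\<lbrakk>\<And>i. X i \<in> Obj C; \<And>i. Y i \<in> Obj C; q \<in> FOb Q (X, Y); (M, (f, p)) \<in> \<gamma> (X, Y) q\<rbrakk>
      \<Longrightarrow> steq {..<n} X Y (memory ((X, Y), q), process ((X, Y), q))
        (prev M (memory ((act_obj C M (shift X), shift Y), p)), prev f (process ((act_obj C M (shift X), shift Y), p)))"
proof (induction n arbitrary: X Y X' Y' q u v M f p)
  \<comment> \<open>Over the empty index set any two sequences are one slide apart.\<close>
  have "slide {..<0} X Y a b" for X Y a b by (simp add: slide_def split: prod.splits)
  then have triv: "steq {..<0} X Y a b" for X Y a b by blast
  case 0
  {
    case 1
    show ?case by (rule triv)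
  next
    case 2
    show ?case by (rule triv)
  }
next
  case (Suc n)
  let ?F = "\<lambda>X Y (M, (f, p)). (prev M (memory ((act_obj C M (shift X), shift Y), p)),
      prev f (process ((act_obj C M (shift X), shift Y), p)))"
  \<comment> \<open>Independence at \<open>Suc n\<close> follows from naturality at
    \<open>n\<close>, and is then available for naturality at \<open>Suc n\<close>.\<close>
  have rep_indep: "steq {..<Suc n} X Y (memory ((X, Y), q), process ((X, Y), q)) (?F X Y (M, (f, p)))"
    if X: "\<And>i. X i \<in> Obj C" and Y: "\<And>i. Y i \<in> Obj C" and q: "q \<in> FOb Q (X, Y)" and b: "(M, (f, p)) \<in> \<gamma> (X, Y) q"
    for X Y q M f p
  proof -
    obtain M' f' p' where r: "rep ((X, Y), q) = (M', (f', p'))" by (cases "rep ((X, Y), q)")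
    have m: "(M', (f', p')) \<in> \<gamma> (X, Y) q" using rep_mem[OF X Y q] by (simp add: r)
    have "equivclp (coend_step C (Phi_integrand C Q X Y)) (M', (f', p')) (M, (f, p))"
      using trans[OF \<gamma>_mem(2)[OF X Y q m, symmetric] \<gamma>_mem(2)[OF X Y q b]]
      by (simp add: Phi_class_def coend_class_eq_iff)
    then have "steq {..<Suc n} X Y (?F X Y (M', (f', p'))) (?F X Y (M, (f, p)))"
    proof (rule equivclp_map)
      fix a b assume st: "coend_step C (Phi_integrand C Q X Y) a b"
      obtain L N r f q where r: "r \<in> hom C N L" and f: "f \<in> hom C (X 0) (N \<otimes> Y 0)"
        and q: "q \<in> FOb Q (act_obj C L (shift X), shift Y)"
        and a: "a = (L, (f \<Zsemi> (r \<odot> \<one> (Y 0)), q))" and b: "b = (N, (f, slide_act Q X Y r q))"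
        by (rule Phi_stepE[OF Q_setfun st X Y])
      have L: "L \<in> Obj C" and N: "N \<in> Obj C" using r hom_obj by auto
      let ?XL = "act_obj C L (shift X)" and ?XN = "act_obj C N (shift X)"
      let ?u = "act_arr C r (\<lambda>i. \<one> (shift X i))" and ?v = "\<lambda>i. \<one> (shift Y i)"
      have u: "?u i \<in> hom C (?XN i) (?XL i)" and v: "?v i \<in> hom C (shift Y i) (shift Y i)" for i
        by (rule act_arr_hom[OF r]) (simp_all add: X Y idt_hom)
      let ?m = "memory ((?XL, shift Y), q)" and ?o = "process ((?XL, shift Y), q)"
      have wt: "(?m, ?o) \<in> seqs UNIV ?XL (shift Y)"
      proof (rule unfold_seqs)
        show "?XL i \<in> Obj C" "shift Y i \<in> Obj C" for i using X Y L by auto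
        show "q \<in> FOb Q (?XL, shift Y)" by (rule q)
      qed
      have "act_seq ?u ?v ?m ?o i = (?o(0 := (r \<odot> \<one> (X 1)) \<Zsemi> ?o 0)) i" for i
        using seqsD[OF wt, of i] seqsD[OF wt, of "i - 1"] r X Y
        by (cases i) (auto simp: act_seq_simps hom_iff)
      then have act: "act_seq ?u ?v ?m ?o = ?o(0 := (r \<odot> \<one> (X 1)) \<Zsemi> ?o 0)" by blast
      have "slide {..<Suc n} X Y (prev L ?m, prev (f \<Zsemi> (r \<odot> \<one> (Y 0))) ?o)
          (prev N ?m, prev f (?o(0 := (r \<odot> \<one> (X 1)) \<Zsemi> ?o 0)))"
        by (rule slide_mono[OF slide_head[OF wt f r Y X]]) auto
      then have 1: "slide {..<Suc n} X Y (?F X Y a) (prev N ?m, prev f (act_seq ?u ?v ?m ?o))"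
        unfolding a act prod.case .
      \<comment> \<open>The head \<open>f\<close> accounts for one index; the tails are compared by
        naturality at \<open>n\<close>, applied to the arrow along which \<open>r\<close> reindexes
        \<open>q\<close>.\<close>
      have "steq {..<Suc n} X Y (prev N (memory ((?XN, shift Y), FAr Q (?u, ?v) q)), prev f (process ((?XN, shift Y), FAr Q (?u, ?v) q)))
          (prev N ?m, prev f (act_seq ?u ?v ?m ?o))"
        by (rule steq_cons[OF Suc.IH(1)[OF q u v] f N Y X]) simp
      then have 2: "steq {..<Suc n} X Y (?F X Y b) (prev N ?m, prev f (act_seq ?u ?v ?m ?o))"
        unfolding b slide_act_def prod.case .
      show "steq {..<Suc n} X Y (?F X Y a) (?F X Y b)"
        by (rule equivclp_trans[OF r_into_equivclp[where r = "slide {..<Suc n} X Y", OF 1] equivclp_sym[OF 2]])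
    qed
    then show ?thesis by (simp add: unfold_rep[OF r])
  qed
  {
    case 1
    note q = 1(1) and u = 1(2) and v = 1(3)
    have X: "X i \<in> Obj C" and X': "X' i \<in> Obj C" and Y: "Y i \<in> Obj C" and Y': "Y' i \<in> Obj C" for i
      using hom_obj[OF u[of i]] hom_obj[OF v[of i]] by auto
    obtain M f p where r: "rep ((X, Y), q) = (M, (f, p))" by (cases "rep ((X, Y), q)")
    have m: "(M, (f, p)) \<in> \<gamma> (X, Y) q" using rep_mem[OF X Y q] by (simp add: r)
    have M: "M \<in> Obj C" and f: "f \<in> hom C (X 0) (M \<otimes> Y 0)" and p: "p \<in> FOb Q (act_obj C M (shift X), shift Y)"
      using \<gamma>_mem(1)[OF X Y q m] by (auto simp: Phi_elts_def)
    let ?g = "u 0 \<Zsemi> f \<Zsemi> (\<one> M \<odot> v 0)" and ?u = "act_arr C (\<one> M) (shift u)"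
    let ?p = "FAr Q (?u, shift v) p"
    let ?XM = "act_obj C M (shift X)" and ?XM' = "act_obj C M (shift X')"
    let ?m = "memory ((?XM, shift Y), p)" and ?o = "process ((?XM, shift Y), p)"
    have q': "FAr Q (u, v) q \<in> FOb Q (X', Y')" by (rule is_setfunD(1)[OF Q_setfun u v q])
    have g: "?g \<in> hom C (X' 0) (M \<otimes> Y' 0)"
      using u[of 0] v[of 0] f M by (auto simp: hom_iff)
    have us: "?u i \<in> hom C (?XM' i) (?XM i)" for i
      by (rule act_arr_hom[OF idt_hom[OF M]]) (simp add: u)
    have vs: "shift v i \<in> hom C (shift Y i) (shift Y' i)" for i using v by simp
    \<comment> \<open>By naturality of \<gamma> the transported triple \<open>(M, (?g, ?p))\<close>
      represents the value at \<open>FAr Q (u, v) q\<close>, but it need not be the chosen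
      representative, whence \<open>rep_indep\<close>.\<close>
    have 1: "steq {..<Suc n} X' Y' (memory ((X', Y'), FAr Q (u, v) q), process ((X', Y'), FAr Q (u, v) q)) (?F X' Y' (M, (?g, ?p)))"
      by (rule rep_indep[OF X' Y' q' \<gamma>_natural[OF q m u v]])
    have 2: "steq {..<Suc n} X' Y' (prev M (memory ((?XM', shift Y'), ?p)), prev ?g (process ((?XM', shift Y'), ?p)))
        (prev M ?m, prev ?g (act_seq ?u (shift v) ?m ?o))"
      by (rule steq_cons[OF Suc.IH(1)[OF p us vs] g M Y' X']) simp
    have "act_seq u v (prev M ?m) (prev f ?o) i = prev ?g (act_seq ?u (shift v) ?m ?o) i" for i
    proof (cases i)
      case (Suc k)
      then show ?thesis by (cases k) (simp_all add: act_seq_simps)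
    qed (simp add: act_seq_simps)
    then have "act_seq u v (prev M ?m) (prev f ?o) = prev ?g (act_seq ?u (shift v) ?m ?o)" by blast
    then show ?case using equivclp_trans[OF 1] 2 by (simp add: unfold_rep[OF r])
  next
    case 2
    then show ?case by (rule rep_indep[unfolded prod.case])
  }
qed

section \<open>The morphism given by the unfolding, and its uniqueness\<close>

definition eta :: "(nat \<Rightarrow> 'o) \<times> (nat \<Rightarrow> 'o) \<Rightarrow> 'q \<Rightarrow> ((nat \<Rightarrow> 'o) \<times> (nat \<Rightarrow> 'a)) set set" where
  "eta = (\<lambda>A\<in>Obj (prof_cat C). \<lambda>q\<in>FOb Q A. oelt (fst A) (snd A) (memory (A, q)) (process (A, q)))"

lemma eta_apply:
  "\<lbrakk>\<And>i. X i \<in> Obj C; \<And>i. Y i \<in> Obj C; q \<in> FOb Q (X, Y)\<rbrakk>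
    \<Longrightarrow> eta (X, Y) q = oelt X Y (memory ((X, Y), q)) (process ((X, Y), q))"
  by (simp add: eta_def)

lemma eta_mem:
  assumes "\<And>i. X i \<in> Obj C" "\<And>i. Y i \<in> Obj C" "q \<in> FOb Q (X, Y)"
  shows "eta (X, Y) q \<in> FOb (oSeq C) (X, Y)"
  using unfold_seqs[OF assms] assms by (auto simp: oSeq_FOb_iff eta_apply)

lemma steq_lessThan: "steq {..<Suc n} X Y a b \<longleftrightarrow> steq {..n} X Y a b"
  by (simp add: lessThan_Suc_atMost)

lemma eta_natural: "is_nat_trans (prof_cat C) Q (oSeq C) eta"
  unfolding is_nat_trans_def
proof (intro conjI ballI)
  show "eta \<in> (\<Pi>\<^sub>E A\<in>Obj (prof_cat C). FOb Q A \<rightarrow>\<^sub>E FOb (oSeq C) A)"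
    using eta_mem by (fastforce simp: eta_def)
  fix a q assume a: "a \<in> Arr (prof_cat C)" and q: "q \<in> FOb Q (Src (prof_cat C) a)"
  obtain u v where uv: "a = (u, v)" by (cases a)
  define X X' Y Y' where d: "X = (\<lambda>i. Tgt C (u i))" "X' = (\<lambda>i. Src C (u i))" "Y = (\<lambda>i. Src C (v i))" "Y' = (\<lambda>i. Tgt C (v i))"
  have u: "u i \<in> hom C (X' i) (X i)" and v: "v i \<in> hom C (Y i) (Y' i)" for i
    using a by (auto simp: hom_iff d uv)
  have X: "X i \<in> Obj C" and X': "X' i \<in> Obj C" and Y: "Y i \<in> Obj C" and Y': "Y' i \<in> Obj C" for i
    using hom_obj[OF u[of i]] hom_obj[OF v[of i]] by auto
  have ST: "Src (prof_cat C) a = (X, Y)" "Tgt (prof_cat C) a = (X', Y')" by (simp_all add: uv d)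
  have q: "q \<in> FOb Q (X, Y)" using q by (simp add: ST)
  have q': "FAr Q (u, v) q \<in> FOb Q (X', Y')" by (rule is_setfunD(1)[OF Q_setfun u v q])
  note wt = unfold_seqs[OF X Y q] and wt' = unfold_seqs[OF X' Y' q']
  have "oelt X' Y' (memory ((X', Y'), FAr Q (u, v) q)) (process ((X', Y'), FAr Q (u, v) q))
      = oelt X' Y' (memory ((X, Y), q)) (act_seq u v (memory ((X, Y), q)) (process ((X, Y), q)))"
    using oelt_eq_iff[OF wt' act_seq_seqs[OF wt u v] X' Y'] unfold_natural[OF q u v, of "Suc n" for n]
    by (simp add: steq_lessThan)
  then show "eta (Tgt (prof_cat C) a) (FAr Q a q) = FAr (oSeq C) a (eta (Src (prof_cat C) a) q)"
    unfolding ST unfolding uv eta_apply[OF X Y q] eta_apply[OF X' Y' q'] oSeq_FAr[OF wt u v] .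
qed

lemma eta_hom: "Phi_coalgebra_hom C Q \<gamma> (oSeq C) (oSeq_coalg C) eta"
  unfolding Phi_coalgebra_hom_def
proof (intro conjI eta_natural ballI)
  fix A q assume A: "A \<in> Obj (prof_cat C)" and q: "q \<in> FOb Q A"
  obtain X Y where A_eq: "A = (X, Y)" by (cases A)
  have X: "X i \<in> Obj C" and Y: "Y i \<in> Obj C" for i using A A_eq by auto
  have q: "q \<in> FOb Q (X, Y)" using q A_eq by simp
  \<comment> \<open>\<open>Phi_map\<close> is a union over all representatives in
    \<open>\<gamma> (X, Y) q\<close>, so each of them, and not just \<open>rep\<close>, must give
    the same value; \<open>unfold_any_rep\<close> provides this.\<close>
  have "Phi_class C (oSeq C) X Y M f (eta (act_obj C M (shift X), shift Y) p) = oSeq_coalg C (X, Y) (eta (X, Y) q)"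
    if b: "(M, (f, p)) \<in> \<gamma> (X, Y) q" for M f p
  proof -
    have M: "M \<in> Obj C" and f: "f \<in> hom C (X 0) (M \<otimes> Y 0)" and p: "p \<in> FOb Q (act_obj C M (shift X), shift Y)"
      using \<gamma>_mem(1)[OF X Y q b] by (auto simp: Phi_elts_def)
    have XM: "act_obj C M (shift X) i \<in> Obj C" and YM: "shift Y i \<in> Obj C" for i using X Y M by auto
    note wt = unfold_seqs[OF XM YM p]
    note wt' = seqs_prev[OF wt f M, of UNIV, OF UNIV_I]
    have "oelt X Y (memory ((X, Y), q)) (process ((X, Y), q))
        = oelt X Y (prev M (memory ((act_obj C M (shift X), shift Y), p))) (prev f (process ((act_obj C M (shift X), shift Y), p)))"
      using oelt_eq_iff[OF unfold_seqs[OF X Y q] wt' X Y] unfold_any_rep[OF X Y q b, of "Suc n" for n]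
      by (simp add: steq_lessThan)
    then show ?thesis
      unfolding eta_apply[OF X Y q] eta_apply[OF XM YM p] by (simp add: oSeq_coalg_oelt[OF wt' X Y])
  qed
  then have "(case b of (M, (f, p)) \<Rightarrow> Phi_class C (oSeq C) X Y M f (eta (act_obj C M (shift X), shift Y) p))
      = oSeq_coalg C (X, Y) (eta (X, Y) q)" if "b \<in> \<gamma> (X, Y) q" for b
    using that by (cases b) simp
  then have "(\<Union>(M, (f, p))\<in>\<gamma> (X, Y) q. Phi_class C (oSeq C) X Y M f (eta (act_obj C M (shift X), shift Y) p))
      = oSeq_coalg C (X, Y) (eta (X, Y) q)"
    by (rule SUP_eq_const[rotated]) (use rep_mem[OF X Y q] in auto)
  then show "oSeq_coalg C A (eta A q) = Phi_map C (oSeq C) eta A (\<gamma> A q)"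
    by (simp add: A_eq Phi_map_def)
qed

text \<open>As \<open>cons_elt\<close> inverts \<open>oSeq_coalg\<close>, the square of a coalgebra
  morphism becomes a recursion equation, valid for any representative of
  \<open>\<gamma> (X, Y) q\<close>.\<close>

lemma hom_cons:
  assumes \<eta>: "Phi_coalgebra_hom C Q \<gamma> (oSeq C) (oSeq_coalg C) \<eta>"
    and X: "\<And>i. X i \<in> Obj C" and Y: "\<And>i. Y i \<in> Obj C" and q: "q \<in> FOb Q (X, Y)"
    and b: "(M, (f, p)) \<in> \<gamma> (X, Y) q"
  shows "\<eta> (X, Y) q \<in> FOb (oSeq C) (X, Y)"
    and "\<eta> (X, Y) q = cons_elt X Y M f (\<eta> (act_obj C M (shift X), shift Y) p)"
proof -
  let ?d = "oSeq_coalg C (X, Y) (\<eta> (X, Y) q)"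
  have A: "(X, Y) \<in> Obj (prof_cat C)" using X Y by simp
  show mem: "\<eta> (X, Y) q \<in> FOb (oSeq C) (X, Y)"
    using \<eta> A q by - (rule nat_trans_mem[of "prof_cat C" Q]; simp add: Phi_coalgebra_hom_def)
  have "?d = Phi_map C (oSeq C) \<eta> (X, Y) (\<gamma> (X, Y) q)"
    using \<eta> A q unfolding Phi_coalgebra_hom_def by blast
  then have "Phi_class C (oSeq C) X Y M f (\<eta> (act_obj C M (shift X), shift Y) p) \<subseteq> ?d"
    using b by (auto simp: Phi_map_def)
  then have e: "(M, (f, \<eta> (act_obj C M (shift X), shift Y) p)) \<in> ?d"
    using self_mem_coend_class by (fastforce simp: Phi_class_def)
  \<comment> \<open>So far \<open>?d\<close> is only known to contain the member above; being a
    coend class, it is determined by that member.\<close>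
  have "?d \<in> FOb (Phi C (oSeq C)) (X, Y)"
    using oSeq_coalgebra A mem by - (rule nat_trans_mem[of "prof_cat C" "oSeq C"]; simp add: Phi_coalgebra_def)
  then obtain M' f' q' where "?d = Phi_class C (oSeq C) X Y M' f' q'"
    by (auto simp: Phi_FOb_iff)
  with e have "?d = Phi_class C (oSeq C) X Y M f (\<eta> (act_obj C M (shift X), shift Y) p)"
    unfolding Phi_class_def by (simp add: mem_coend_classD)
  then show "\<eta> (X, Y) q = cons_elt X Y M f (\<eta> (act_obj C M (shift X), shift Y) p)"
    by (rule cons_oSeq_coalg[OF mem _ X Y])
qed

text \<open>Both morphisms satisfy the same recursion with the same head \<open>f\<close>, so
  unrolling it \<open>n\<close> times makes them agree on \<open>n\<close> components. The
  representatives are generalised because the recursion passes to those of the tails.\<close>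

lemma hom_unique_stage:
  assumes \<eta>: "Phi_coalgebra_hom C Q \<gamma> (oSeq C) (oSeq_coalg C) \<eta>"
    and \<theta>: "Phi_coalgebra_hom C Q \<gamma> (oSeq C) (oSeq_coalg C) \<theta>"
  shows "\<lbrakk>\<And>i. X i \<in> Obj C; \<And>i. Y i \<in> Obj C; q \<in> FOb Q (X, Y);
    (K, k) \<in> seqs UNIV X Y; \<eta> (X, Y) q = oelt X Y K k; (L, l) \<in> seqs UNIV X Y; \<theta> (X, Y) q = oelt X Y L l\<rbrakk>
    \<Longrightarrow> steq {..<n} X Y (K, k) (L, l)"
proof (induction n arbitrary: X Y q K k L l)
  case 0
  have "slide {..<0} X Y (K, k) (L, l)" by (simp add: slide_def)
  then show ?case by blast
next
  case (Suc n)
  note X = Suc.prems(1) and Y = Suc.prems(2) and q = Suc.prems(3)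
  obtain M f p where r: "rep ((X, Y), q) = (M, (f, p))" by (cases "rep ((X, Y), q)")
  have m: "(M, (f, p)) \<in> \<gamma> (X, Y) q" using rep_mem[OF X Y q] by (simp add: r)
  have M: "M \<in> Obj C" and f: "f \<in> hom C (X 0) (M \<otimes> Y 0)" and p: "p \<in> FOb Q (act_obj C M (shift X), shift Y)"
    using \<gamma>_mem(1)[OF X Y q m] by (auto simp: Phi_elts_def)
  let ?X = "act_obj C M (shift X)"
  have XM: "?X i \<in> Obj C" and YM: "shift Y i \<in> Obj C" for i using X Y M by auto
  \<comment> \<open>\<open>hom_cons(1)\<close> takes a member of the class at \<open>p\<close> in
    order to place the values of both morphisms there in \<open>oSeq C\<close>.\<close>
  have b: "rep ((?X, shift Y), p) \<in> \<gamma> (?X, shift Y) p" by (rule rep_mem[OF XM YM p])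
  obtain M' f' p' where b: "(M', (f', p')) \<in> \<gamma> (?X, shift Y) p"
    using b by (cases "rep ((?X, shift Y), p)") auto
  obtain K' k' where K': "(K', k') \<in> seqs UNIV ?X (shift Y)" "\<eta> (?X, shift Y) p = oelt ?X (shift Y) K' k'"
    using hom_cons(1)[OF \<eta> XM YM p b] XM YM by (auto simp: oSeq_FOb_iff)
  obtain L' l' where L': "(L', l') \<in> seqs UNIV ?X (shift Y)" "\<theta> (?X, shift Y) p = oelt ?X (shift Y) L' l'"
    using hom_cons(1)[OF \<theta> XM YM p b] XM YM by (auto simp: oSeq_FOb_iff)
  have IH: "steq {..<n} ?X (shift Y) (K', k') (L', l')"
    by (rule Suc.IH[OF XM YM p K' L'])
  have "steq {..<Suc n} X Y (prev M K', prev f k') (prev M L', prev f l')"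
    by (rule steq_cons[OF IH f M Y X]) simp
  moreover have "oelt X Y K k = oelt X Y (prev M K') (prev f k')"
    using hom_cons(2)[OF \<eta> X Y q m] cons_elt_oelt[OF K'(1) M f X Y] by (simp add: Suc.prems(5) K'(2))
  then have "steq {..n} X Y (K, k) (prev M K', prev f k')"
    using oelt_eq_iff[OF Suc.prems(4) seqs_prev[OF K'(1) f M, of UNIV, OF UNIV_I] X Y] by simp
  moreover have "oelt X Y L l = oelt X Y (prev M L') (prev f l')"
    using hom_cons(2)[OF \<theta> X Y q m] cons_elt_oelt[OF L'(1) M f X Y] by (simp add: Suc.prems(7) L'(2))
  then have "steq {..n} X Y (L, l) (prev M L', prev f l')"
    using oelt_eq_iff[OF Suc.prems(6) seqs_prev[OF L'(1) f M, of UNIV, OF UNIV_I] X Y] by simp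
  ultimately show ?case
    unfolding steq_lessThan by (meson equivclp_sym equivclp_trans)
qed

lemma hom_unique:
  assumes \<eta>: "Phi_coalgebra_hom C Q \<gamma> (oSeq C) (oSeq_coalg C) \<eta>"
    and \<theta>: "Phi_coalgebra_hom C Q \<gamma> (oSeq C) (oSeq_coalg C) \<theta>"
  shows "\<eta> = \<theta>"
proof -
  have ext: "\<eta> \<in> (\<Pi>\<^sub>E A\<in>Obj (prof_cat C). FOb Q A \<rightarrow>\<^sub>E FOb (oSeq C) A)"
    "\<theta> \<in> (\<Pi>\<^sub>E A\<in>Obj (prof_cat C). FOb Q A \<rightarrow>\<^sub>E FOb (oSeq C) A)"
    using \<eta> \<theta> by (simp_all add: Phi_coalgebra_hom_def is_nat_trans_def)
  show ?thesis
  proof (rule PiE_ext[OF ext])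
    fix A assume A: "A \<in> Obj (prof_cat C)"
    obtain X Y where A_eq: "A = (X, Y)" by (cases A)
    have X: "X i \<in> Obj C" and Y: "Y i \<in> Obj C" for i using A A_eq by auto
    have comp: "\<eta> A \<in> FOb Q A \<rightarrow>\<^sub>E FOb (oSeq C) A" "\<theta> A \<in> FOb Q A \<rightarrow>\<^sub>E FOb (oSeq C) A"
      using ext A by (blast dest: PiE_mem)+
    show "\<eta> A = \<theta> A"
    proof (rule PiE_ext[OF comp])
      fix q assume q: "q \<in> FOb Q A"
      have "\<eta> A q \<in> FOb (oSeq C) A" "\<theta> A q \<in> FOb (oSeq C) A" using comp q by (blast dest: PiE_mem)+
      then obtain K k L l where Kk: "(K, k) \<in> seqs UNIV X Y" "\<eta> (X, Y) q = oelt X Y K k"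
        and Ll: "(L, l) \<in> seqs UNIV X Y" "\<theta> (X, Y) q = oelt X Y L l"
        unfolding A_eq using X Y by (auto simp: oSeq_FOb_iff)
      have q': "q \<in> FOb Q (X, Y)" using q A_eq by simp
      have "steq {..<Suc n} X Y (K, k) (L, l)" for n
        by (rule hom_unique_stage[OF \<eta> \<theta> X Y q' Kk Ll])
      then show "\<eta> A q = \<theta> A q"
        using oelt_eq_iff[OF Kk(1) Ll(1) X Y] Kk(2) Ll(2) by (simp add: A_eq steq_lessThan)
    qed
  qed
qed

end

theorem theorem6p18:
  fixes C :: "('o, 'a) smc"
  assumes "symmetric_monoidal_category C"
    and "productive C"
  shows "Phi_coalgebra C (oSeq C) (oSeq_coalg C) \<and>
    (\<forall>(Q :: ('o, 'a, 'q) prof) \<gamma>. Phi_coalgebra C Q \<gamma> \<longrightarrow>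
       (\<exists>!\<eta>. Phi_coalgebra_hom C Q \<gamma> (oSeq C) (oSeq_coalg C) \<eta>)) \<and>
    Phi_fixpoint C (oSeq C) (oSeq_coalg C) \<and>
    (\<forall>(Q :: ('o, 'a, 'q) prof) \<gamma>. Phi_fixpoint C Q \<gamma> \<longrightarrow>
       (\<exists>!\<eta>. Phi_coalgebra_hom C Q \<gamma> (oSeq C) (oSeq_coalg C) \<eta>))"
proof -
  interpret productive_category C
    using assms by (intro productive_category.intro productive_category_axioms.intro)
  have final: "\<exists>!\<eta>. Phi_coalgebra_hom C Q \<gamma> (oSeq C) (oSeq_coalg C) \<eta>"
    if "Phi_coalgebra C Q \<gamma>" for Q :: "('o, 'a, 'q) prof" and \<gamma>
  proof -
    interpret coalgebra C Q \<gamma> by unfold_locales (rule that)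
    show ?thesis using eta_hom hom_unique by blast
  qed
  \<comment> \<open>A fixpoint is in particular a coalgebra, so finality among fixpoints is an
    instance of finality among coalgebras.\<close>
  then show ?thesis
    using oSeq_coalgebra oSeq_fixpoint by (auto simp: Phi_fixpoint_def)
qed

end
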